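(* Let $P=\mathbb{Q}[x_1,\dots,x_n]$, let $\sigma$ be a term-ordering, let $I$ be a zero-dimensional ideal in $P$ and let $f\in P$. For every choice of the primes made in it, the following procedure terminates after finitely many steps and returns the minimal polynomial $\mu_{f,I}(z)\in\mathbb{Q}[z]$. 1. Compute the reduced $\sigma$-Gröbner basis of $I$. 2. Choose a usable prime $p$. 3. Compute $f_p=\pi_p(f)$ and the ideal $I_{(p,\sigma)}$. 4. Compute $\mu_p=\mu_{f_p,I_{(p,\sigma)}}\in\mathbb{F}_p[z]$. 5. Let $\mu_{\rm crt}=\mu_p$ and $p_{\rm crt}=p$. 6. Main Loop: 6.1. Choose a new usable prime $p$ (different from all primes chosen before). 6.2. Compute $\mu_p=\mu_{\pi_p(f),I_{(p,\sigma)}}\in\mathbb{F}_p[z]$. 6.3. If $\deg(\mu_{\rm crt})\neq\deg(\mu_p)$ then: if $\deg(\mu_{\rm crt})<\deg(\mu_p)$, let $\mu_{\rm crt}=\mu_p$ and $p_{\rm crt}=p$; in either case continue with the next iteration of the Main Loop. 6.4. Let $\tilde p_{\rm crt}=p\cdot p_{\rm crt}$ and let $\tilde\mu_{\rm crt}$ be the polynomial with coefficients modulo $\tilde p_{\rm crt}$ obtained by the Chinese Remainder Theorem from the coefficients of $\mu_{\rm crt}$ (modulo $p_{\rm crt}$) and $\mu_p$ (modulo $p$). 6.5. Compute the polynomial $\mu_{\rm calc}\in\mathbb{Q}[z]$ whose coefficients are the fault-tolerant rational reconstructions of the coefficients of $\tilde\mu_{\rm crt}$ modulo $\tilde p_{\rm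 crt}$. 6.6. If all coefficients were reliably reconstructed: if $\mu_{\rm calc}(f)\in I$, return $\mu_{\rm calc}$. If not all coefficients were reliably reconstructed: let $\mu_{\rm crt}=\tilde\mu_{\rm crt}$ and $p_{\rm crt}=\tilde p_{\rm crt}$. 6.7. Continue with the next iteration of the Main Loop.
   Context: An ideal $J$ of a polynomial ring $K[x_1,\dots,x_n]$ over a field $K$ is zero-dimensional if the quotient ring is non-zero and finite-dimensional over $K$. For such $J$ and $g\in K[x_1,\dots,x_n]$, the minimal polynomial $\mu_{g,J}(z)\in K[z]$ is the monic generator of the kernel of the $K$-algebra homomorphism $K[z]\to K[x_1,\dots,x_n]/J$, $z\mapsto g \bmod J$. For $f\in P$, $\mathrm{den}(f)$ is $1$ if $f=0$ and otherwise the least common multiple of the denominators of the coefficients of $f$. If $G$ is the reduced $\sigma$-Gröbner basis of $I$, then $\mathrm{den}_\sigma(I)=\mathrm{lcm}\{\mathrm{den}(g):g\in G\}$. For a positive integer $\delta$, $\mathbb{Z}_\delta\subset\mathbb{Q}$ is the ring of fractions $a/\delta^k$ ($a\in\mathbb{Z}$, $k\in\mathbb{N}$); for a prime $p\nmid\delta$, $\pi_p$ denotes the canonical homomorphism $\mathbb{Z}_\delta\to\mathbb{F}_p=\mathbb{Z}/p\mathbb{Z}$ and its coefficientwise extensions to polynomials. A prime $p$ is usable (for $f$ with respect to $(I,\sigma)$) if $p$ does not divide $\mathrm{den}(f)\cdot\mathrm{den}_\sigma(I)$. For such $p$, $I_{(p,\sigma)}=\langle\pi_p(G)\rangle\subseteq\mathbb{F}_p[x_1,\dots,x_n]$,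 which is a zero-dimensional ideal. Fault-tolerant rational reconstruction is a subroutine which, given a modulus $m$ and a residue class modulo $m$, returns a rational number together with an indication "reliable" or "not reliable". It is used as a black box with the following properties: the residue class $1$ is reconstructed as $1$ (so that $\mu_{\rm calc}$ is monic of the same degree as $\tilde\mu_{\rm crt}$); and for every $q\in\mathbb{Q}$ there is a bound $N_q$ such that, for every square-free $m\ge N_q$ coprime to the denominator of $q$, the reconstruction of the residue class of $q$ modulo $m$ is $q$ and is indicated as reliable. No guarantee is assumed that a reconstruction indicated as reliable is correct. *)

theory Defs
  imports
    "HOL-Algebra.Algebra"
    "HOL-Algebra.Algebraic_Closure_Type"
    "HOL-Computational_Algebra.Squarefree"
    "HOL-Number_Theory.Residues"
begin

section \<open>Multivariate polynomials over a ring\<close>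

text \<open>
  The type \<^typ>\<open>'v\<close> is the set of indeterminates. A power product is a finite multiset of
  indeterminates, so that \<open>+\<close> multiplies power products and \<open>\<subseteq>#\<close> is divisibility. A polynomial maps
  each power product to its coefficient, just as univariate polynomials are represented in
  \<^theory>\<open>HOL-Algebra.UnivPoly\<close>.
\<close>

definition supp :: "('a, 'm) ring_scheme \<Rightarrow> ('v multiset \<Rightarrow> 'a) \<Rightarrow> 'v multiset set"
  where "supp R f = {t. f t \<noteq> \<zero>\<^bsub>R\<^esub>}"

definition mpoly_ring :: "('a, 'm) ring_scheme \<Rightarrow> ('v multiset \<Rightarrow> 'a) ring"
  where "mpoly_ring R =
    \<lparr>carrier = {f. range f \<subseteq> carrier R \<and> finite (supp R f)},
     monoid.mult = (\<lambda>f g t. \<Oplus>\<^bsub>R\<^esub>s \<in> {s. s \<subseteq># t}. f s \<otimes>\<^bsub>R\<^esub> g (t - s)),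
     one = (\<lambda>t. if t = {#} then \<one>\<^bsub>R\<^esub> else \<zero>\<^bsub>R\<^esub>),
     ring.zero = (\<lambda>t. \<zero>\<^bsub>R\<^esub>),
     add = (\<lambda>f g t. f t \<oplus>\<^bsub>R\<^esub> g t)\<rparr>"

definition mpoly_const :: "('a, 'm) ring_scheme \<Rightarrow> 'a \<Rightarrow> 'v multiset \<Rightarrow> 'a"
  where "mpoly_const R c = (\<lambda>t. if t = {#} then c else \<zero>\<^bsub>R\<^esub>)"

abbreviation quot_ring ::
    "('a, 'm) ring_scheme \<Rightarrow> ('v multiset \<Rightarrow> 'a) set \<Rightarrow> ('v multiset \<Rightarrow> 'a) set ring"
  where "quot_ring R J \<equiv> mpoly_ring R Quot J"

definition quot_const ::
    "('a, 'm) ring_scheme \<Rightarrow> ('v multiset \<Rightarrow> 'a) set \<Rightarrow> 'a \<Rightarrow> ('v multiset \<Rightarrow> 'a) set"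
  where "quot_const R J c = J +>\<^bsub>mpoly_ring R\<^esub> mpoly_const R c"

text \<open>
  The notion of dimension from \<^theory>\<open>HOL-Algebra.Embedded_Algebras\<close> takes the scalars to be a
  subset of the ring, here the image of the coefficient field in the quotient.
\<close>

definition zero_dimensional :: "('a, 'm) ring_scheme \<Rightarrow> ('v multiset \<Rightarrow> 'a) set \<Rightarrow> bool"
  where "zero_dimensional R J \<longleftrightarrow>
    ideal J (mpoly_ring R) \<and>
    carrier (quot_ring R J) \<noteq> {\<zero>\<^bsub>quot_ring R J\<^esub>} \<and>
    (\<exists>d. ring.dimension (quot_ring R J) d (quot_const R J ` carrier R) (carrier (quot_ring R J)))"


section \<open>Minimal polynomials\<close>

text \<open>
  The \<open>K\<close>-algebra homomorphism \<open>K[z] \<rightarrow> K[x\<^sub>1,\<dots>,x\<^sub>n]/J\<close> that maps \<open>z\<close> to the class of \<open>g\<close>.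
\<close>

definition subst_hom ::
    "('a, 'm) ring_scheme \<Rightarrow> ('v multiset \<Rightarrow> 'a) \<Rightarrow> ('v multiset \<Rightarrow> 'a) set \<Rightarrow>
      (nat \<Rightarrow> 'a) \<Rightarrow> ('v multiset \<Rightarrow> 'a) set"
  where "subst_hom R g J =
    UnivPoly.eval R (quot_ring R J) (quot_const R J) (J +>\<^bsub>mpoly_ring R\<^esub> g)"

definition min_poly ::
    "('a, 'm) ring_scheme \<Rightarrow> ('v multiset \<Rightarrow> 'a) \<Rightarrow> ('v multiset \<Rightarrow> 'a) set \<Rightarrow> nat \<Rightarrow> 'a"
  where "min_poly R g J =
    (THE \<mu>. \<mu> \<in> carrier (UP R) \<and> \<mu> (deg R \<mu>) = \<one>\<^bsub>R\<^esub> \<and>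
      Idl\<^bsub>UP R\<^esub> {\<mu>} = a_kernel (UP R) (quot_ring R J) (subst_hom R g J))"


section \<open>Term orderings and reduced Groebner bases\<close>

definition term_ordering :: "'v multiset rel \<Rightarrow> bool"
  where "term_ordering \<sigma> \<longleftrightarrow>
    linear_order \<sigma> \<and> (\<forall>t. ({#}, t) \<in> \<sigma>) \<and> (\<forall>s t u. (s, t) \<in> \<sigma> \<longrightarrow> (s + u, t + u) \<in> \<sigma>)"

definition lead_term ::
    "('a, 'm) ring_scheme \<Rightarrow> 'v multiset rel \<Rightarrow> ('v multiset \<Rightarrow> 'a) \<Rightarrow> 'v multiset"
  where "lead_term R \<sigma> f = (THE t. t \<in> supp R f \<and> (\<forall>s \<in> supp R f. (s, t) \<in> \<sigma>))"

definition is_groebner_basis ::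
    "('a, 'm) ring_scheme \<Rightarrow> 'v multiset rel \<Rightarrow> ('v multiset \<Rightarrow> 'a) set \<Rightarrow>
      ('v multiset \<Rightarrow> 'a) set \<Rightarrow> bool"
  where "is_groebner_basis R \<sigma> I G \<longleftrightarrow>
    finite G \<and> G \<subseteq> I - {\<zero>\<^bsub>mpoly_ring R\<^esub>} \<and>
    (\<forall>f \<in> I - {\<zero>\<^bsub>mpoly_ring R\<^esub>}. \<exists>g \<in> G. lead_term R \<sigma> g \<subseteq># lead_term R \<sigma> f)"

definition is_reduced_groebner_basis ::
    "('a, 'm) ring_scheme \<Rightarrow> 'v multiset rel \<Rightarrow> ('v multiset \<Rightarrow> 'a) set \<Rightarrow>
      ('v multiset \<Rightarrow> 'a) set \<Rightarrow> bool"
  where "is_reduced_groebner_basis R \<sigma> I G \<longleftrightarrow>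
    is_groebner_basis R \<sigma> I G \<and>
    (\<forall>g \<in> G. g (lead_term R \<sigma> g) = \<one>\<^bsub>R\<^esub>) \<and>
    (\<forall>g \<in> G. \<forall>t \<in> supp R g. \<forall>h \<in> G - {g}. \<not> lead_term R \<sigma> h \<subseteq># t)"

definition reduced_groebner_basis ::
    "('a, 'm) ring_scheme \<Rightarrow> 'v multiset rel \<Rightarrow> ('v multiset \<Rightarrow> 'a) set \<Rightarrow>
      ('v multiset \<Rightarrow> 'a) set"
  where "reduced_groebner_basis R \<sigma> I = (THE G. is_reduced_groebner_basis R \<sigma> I G)"


section \<open>Denominators and reduction modulo a prime\<close>

abbreviation QQ :: "rat ring"
  where "QQ \<equiv> ring_of_type_algebra"

definition denom :: "rat \<Rightarrow> int"
  where "denom q = snd (quotient_of q)"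

definition den :: "('v multiset \<Rightarrow> rat) \<Rightarrow> int"
  where "den f = Lcm ((\<lambda>t. denom (f t)) ` supp QQ f)"

definition den_ideal :: "'v multiset rel \<Rightarrow> ('v multiset \<Rightarrow> rat) set \<Rightarrow> int"
  where "den_ideal \<sigma> I = Lcm (den ` reduced_groebner_basis QQ \<sigma> I)"

text \<open>
  The residue class modulo \<open>m\<close> of a rational number whose denominator is coprime to \<open>m\<close>. For
  \<open>m = p\<close> prime this is the canonical homomorphism \<open>\<pi>\<^sub>p : \<int>\<^sub>\<delta> \<rightarrow> F\<^sub>p\<close>, for every \<open>\<delta>\<close>
  not divisible by \<open>p\<close>. If the denominator is not coprime to \<open>m\<close>, the value is meaningless.
\<close>

definition residue :: "int \<Rightarrow> rat \<Rightarrow> int"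
  where "residue m q =
    (fst (quotient_of q) mod m) \<otimes>\<^bsub>residue_ring m\<^esub> (inv\<^bsub>residue_ring m\<^esub> (denom q mod m))"

definition mpoly_residue :: "int \<Rightarrow> ('v multiset \<Rightarrow> rat) \<Rightarrow> 'v multiset \<Rightarrow> int"
  where "mpoly_residue p f = (\<lambda>t. residue p (f t))"

definition usable ::
    "'v multiset rel \<Rightarrow> ('v multiset \<Rightarrow> rat) set \<Rightarrow> ('v multiset \<Rightarrow> rat) \<Rightarrow> int \<Rightarrow> bool"
  where "usable \<sigma> I f p \<longleftrightarrow> Factorial_Ring.prime p \<and> \<not> p dvd den f * den_ideal \<sigma> I"

definition ideal_residue ::
    "'v multiset rel \<Rightarrow> ('v multiset \<Rightarrow> rat) set \<Rightarrow> int \<Rightarrow> ('v multiset \<Rightarrow> int) set"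
  where "ideal_residue \<sigma> I p =
    Idl\<^bsub>mpoly_ring (residue_ring p)\<^esub> (mpoly_residue p ` reduced_groebner_basis QQ \<sigma> I)"

definition min_poly_mod ::
    "'v multiset rel \<Rightarrow> ('v multiset \<Rightarrow> rat) set \<Rightarrow> ('v multiset \<Rightarrow> rat) \<Rightarrow> int \<Rightarrow> nat \<Rightarrow> int"
  where "min_poly_mod \<sigma> I f p =
    min_poly (residue_ring p) (mpoly_residue p f) (ideal_residue \<sigma> I p)"


section \<open>Chinese remaindering and rational reconstruction\<close>

definition crt :: "int \<Rightarrow> int \<Rightarrow> int \<Rightarrow> int \<Rightarrow> int"
  where "crt m a p b = (THE x. x \<in> {0..<p * m} \<and> [x = a] (mod m) \<and> [x = b] (mod p))"

definition crt_poly :: "int \<Rightarrow> (nat \<Rightarrow> int) \<Rightarrow> int \<Rightarrow> (nat \<Rightarrow> int) \<Rightarrow> nat \<Rightarrow> int"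
  where "crt_poly m \<mu> p \<nu> = (\<lambda>i. crt m (\<mu> i) p (\<nu> i))"

text \<open>
  A reconstruction procedure takes a modulus and a residue class (given by its representative
  in \<open>{0..<m}\<close>), and returns a rational number together with the flag ``reliable''.
\<close>

type_synonym reconstruction = "int \<Rightarrow> int \<Rightarrow> rat \<times> bool"

definition fault_tolerant_reconstruction :: "reconstruction \<Rightarrow> bool"
  where "fault_tolerant_reconstruction rec \<longleftrightarrow>
    (\<forall>m > 1. fst (rec m 1) = 1) \<and>
    (\<forall>q. \<exists>N. \<forall>m \<ge> N. squarefree m \<longrightarrow> coprime m (denom q) \<longrightarrow> rec m (residue m q) = (q, True))"

definition reconstruct_poly :: "reconstruction \<Rightarrow> int \<Rightarrow> (nat \<Rightarrow> int) \<Rightarrow> nat \<Rightarrow> rat"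
  where "reconstruct_poly rec m \<mu> =
    (\<lambda>i. if i \<le> deg (residue_ring m) \<mu> then fst (rec m (\<mu> i)) else 0)"

definition all_reliable :: "reconstruction \<Rightarrow> int \<Rightarrow> (nat \<Rightarrow> int) \<Rightarrow> bool"
  where "all_reliable rec m \<mu> \<longleftrightarrow> (\<forall>i \<le> deg (residue_ring m) \<mu>. snd (rec m (\<mu> i)))"


section \<open>The modular algorithm\<close>

text \<open>\<open>Running \<mu> m\<close> records the current \<open>\<mu>\<^sub>c\<^sub>r\<^sub>t\<close> and \<open>p\<^sub>c\<^sub>r\<^sub>t\<close>.\<close>

datatype state = Running "nat \<Rightarrow> int" int | Returned "nat \<Rightarrow> rat"

definition main_loop_step ::
    "reconstruction \<Rightarrow> 'v multiset rel \<Rightarrow> ('v multiset \<Rightarrow> rat) set \<Rightarrow> ('v multiset \<Rightarrow> rat) \<Rightarrow>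
      int \<Rightarrow> (nat \<Rightarrow> int) \<Rightarrow> int \<Rightarrow> state"
  where "main_loop_step rec \<sigma> I f p \<mu>_crt p_crt =
    (let \<mu>_p = min_poly_mod \<sigma> I f p;
         d_crt = deg (residue_ring p_crt) \<mu>_crt;
         d_p = deg (residue_ring p) \<mu>_p
     in if d_crt \<noteq> d_p then
          (if d_crt < d_p then Running \<mu>_p p else Running \<mu>_crt p_crt)
        else
          (let p_crt' = p * p_crt;
               \<mu>_crt' = crt_poly p_crt \<mu>_crt p \<mu>_p;
               \<mu>_calc = reconstruct_poly rec p_crt' \<mu>_crt'
           in if all_reliable rec p_crt' \<mu>_crt' then
                (if UnivPoly.eval QQ (mpoly_ring QQ) (mpoly_const QQ) f \<mu>_calc \<in> I
                 then Returned \<mu>_calc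
                 else Running \<mu>_crt p_crt)
              else Running \<mu>_crt' p_crt'))"

text \<open>
  The state after \<open>k\<close> iterations of the main loop, where \<open>ps\<close> is the sequence of the primes
  chosen. Once a polynomial is returned, the remaining primes of \<open>ps\<close> are ignored.
\<close>

primrec run ::
    "reconstruction \<Rightarrow> 'v multiset rel \<Rightarrow> ('v multiset \<Rightarrow> rat) set \<Rightarrow> ('v multiset \<Rightarrow> rat) \<Rightarrow>
      (nat \<Rightarrow> int) \<Rightarrow> nat \<Rightarrow> state"
  where
    "run rec \<sigma> I f ps 0 = Running (min_poly_mod \<sigma> I f (ps 0)) (ps 0)"
  | "run rec \<sigma> I f ps (Suc k) =
      (case run rec \<sigma> I f ps k of
         Running \<mu> m \<Rightarrow> main_loop_step rec \<sigma> I f (ps (Suc k)) \<mu> m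
       | Returned \<mu> \<Rightarrow> Returned \<mu>)"

end

theory Submission
  imports Defs "HOL-Library.Poly_Mapping"
begin

text \<open>
  Let \<open>\<mu>\<close> be the minimal polynomial of \<open>f\<close> modulo \<open>I\<close>, let \<open>d\<close> be its degree, and write \<open>\<int>\<^sub>(\<^sub>p\<^sub>)\<close> for
  the rational numbers with denominator prime to \<open>p\<close>. The procedure is correct and terminates for
  two reasons of different nature.

  A returned polynomial is correct because it is monic, has degree at most \<open>d\<close>, and vanishes at
  \<open>f\<close> modulo \<open>I\<close>, which leaves only \<open>\<mu>\<close> (\<open>returned_correct\<close>). The degree bound holds because \<open>\<mu>\<close>
  is \<open>p\<close>-integral for every usable \<open>p\<close> (\<open>\<mu>_integral\<close>), so that its reduction is a monic element of
  the kernel modulo \<open>p\<close>. Hence \<open>\<mu>\<^sub>p\<close> has degree at most \<open>d\<close>, and \<open>\<mu>\<^sub>p\<close> is the reduction of \<open>\<mu>\<close> if its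
  degree is \<open>d\<close> (\<open>min_poly_mod_props\<close>).

  The loop stops because only finitely many usable primes give a smaller degree
  (\<open>finite_bad_primes\<close>). After the first prime of degree \<open>d\<close>, the pair \<open>(\<mu>\<^sub>c\<^sub>r\<^sub>t, p\<^sub>c\<^sub>r\<^sub>t)\<close> always
  consists of the residues of \<open>\<mu>\<close> modulo \<open>p\<^sub>c\<^sub>r\<^sub>t\<close>. It does not matter how often this pair is
  updated: the next modulus \<open>p p\<^sub>c\<^sub>r\<^sub>t\<close> is at least the new prime \<open>p\<close>, and distinct primes
  become arbitrarily large, so that eventually every coefficient is reconstructed correctly.

  Both arithmetic facts come from linear functionals. If \<open>e < d\<close>, then the powers \<open>1, f, \<dots>, f\<^sup>e\<close>
  are independent modulo \<open>I\<close>, so there is a functional \<open>L\<close> that vanishes on \<open>I\<close> and on \<open>f\<^sup>i\<close> for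
  \<open>i < e\<close>, with \<open>L(f\<^sup>e) = 1\<close>. The reduced Groebner basis is monic and \<open>p\<close>-integral, so it reduces every
  monomial to standard monomials over \<open>\<int>\<^sub>(\<^sub>p\<^sub>)\<close>; as there are finitely many standard monomials, \<open>L\<close>
  has bounded denominators on \<open>p\<close>-integral polynomials, and is even \<open>p\<close>-integral there for all but
  finitely many \<open>p\<close> (\<open>functional_integral\<close>).

  For those \<open>p\<close> the degree of \<open>\<mu>\<^sub>p\<close> is not \<open>e\<close>: a relation of degree \<open>e\<close> modulo \<open>p\<close> lifts to an
  integral monic \<open>h\<close> of degree \<open>e\<close> such that \<open>h(f)\<close> lies in \<open>I\<close> up to \<open>p\<close> times a \<open>p\<close>-integral
  polynomial, and then \<open>1 = L(h(f))\<close> would be divisible by \<open>p\<close>. The lifting is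
  possible because \<open>I\<^sub>(\<^sub>p\<^sub>,\<^sub>\<sigma>\<^sub>)\<close> is the reduction of the \<open>p\<close>-integral part of \<open>I\<close>
  (\<open>generated_ideal\<close>).

  For the integrality of \<open>\<mu>\<close>, suppose that it fails at \<open>p\<close>, and scale \<open>\<mu>\<close> to a primitive polynomial;
  its degree \<open>e\<close> modulo \<open>p\<close> is less than \<open>d\<close>. The sequence \<open>L(f\<^sup>k)\<close> satisfies the recurrence with
  these coefficients and has bounded denominators, and an argument of Fatou shows that it would be
  infinitely divisible by \<open>p\<close>, contrary to \<open>L(f\<^sup>e) = 1\<close> (\<open>fatou\<close>).

  Polynomials are handled as finitely supported maps with type class arithmetic, and the rings of
  the statement are images of these under coefficientwise maps (\<open>coeff_map\<close>).
\<close>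


section \<open>Power products and finitely supported maps\<close>


abbreviation "lookup \<equiv> Poly_Mapping.lookup"
abbreviation "keys \<equiv> Poly_Mapping.keys"
abbreviation "single \<equiv> Poly_Mapping.single"


text \<open>
  Dickson's lemma. Treating one indeterminate after the other, one passes to subsequences along which
  its exponent is nondecreasing.
\<close>
lemma dickson:
  fixes s :: "nat \<Rightarrow> 'v::finite multiset"
  shows "\<exists>i j. i < j \<and> s i \<subseteq># s j"
proof -
  have "\<exists>r. strict_mono r \<and> (\<forall>a\<in>A. incseq (\<lambda>i. count (s (r i)) a))" if "finite A" for A :: "'v set"
    using that
  proof induction
    case empty
    show ?case by (rule exI[of _ id]) (simp add: strict_mono_def)
  next
    case (insert x A)
    then obtain r where r: "strict_mono r" "\<forall>a\<in>A. incseq (\<lambda>i. count (s (r i)) a)" by blast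
    obtain q where q: "strict_mono q" "monoseq (\<lambda>n. count (s (r (q n))) x)"
      using seq_monosub[of "\<lambda>i. count (s (r i)) x"] by blast
    have "\<exists>N. incseq (\<lambda>n. count (s (r (q (n + N)))) x)"
    proof (cases "incseq (\<lambda>n. count (s (r (q n))) x)")
      case True
      then show ?thesis by (intro exI[of _ 0]) simp
    next
      case False
      then have dec: "decseq (\<lambda>n. count (s (r (q n))) x)"
        using q(2) by (auto simp: monoseq_iff)
      \<comment> \<open>a decreasing sequence of natural numbers is constant from its minimum on\<close>
      obtain N where N: "\<And>n. count (s (r (q N))) x \<le> count (s (r (q n))) x"
        using exists_least_iff[of "\<lambda>k. \<exists>n. count (s (r (q n))) x = k"] by (metis not_le_imp_less)
      have "count (s (r (q (n + N)))) x = count (s (r (q N))) x" for n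
        using N[of "n + N"] decseqD[OF dec, of N "n + N"] by simp
      then show ?thesis by (intro exI[of _ N]) simp
    qed
    then obtain N where N: "incseq (\<lambda>n. count (s (r (q (n + N)))) x)" ..
    have sm: "strict_mono (\<lambda>n. q (n + N))"
      using q(1) by (simp add: strict_mono_def)
    have "incseq (\<lambda>i. count (s (r (q (i + N)))) a)" if "a \<in> insert x A" for a
    proof (cases "a = x")
      case True
      then show ?thesis using N by simp
    next
      case False
      then have "incseq (\<lambda>i. count (s (r i)) a)" using r that by blast
      then show ?thesis
        using strict_mono_leD[OF sm] by (simp add: mono_def)
    qed
    moreover have "strict_mono (\<lambda>i. r (q (i + N)))"
      using r(1) sm by (simp add: strict_mono_def)
    ultimately show ?case by blast
  qed
  from this[OF finite_UNIV] obtain r :: "nat \<Rightarrow> nat"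
    where r: "strict_mono r" "\<And>a. incseq (\<lambda>i. count (s (r i)) a)" by auto
  have "r 0 < r 1" using r(1) by (simp add: strict_mono_def)
  moreover have "s (r 0) \<subseteq># s (r 1)"
    by (rule mset_subset_eqI) (use r(2) incseqD in blast)
  ultimately show ?thesis by blast
qed

lemma finite_submultisets: "finite {s. s \<subseteq># t}"
proof -
  have "{s. s \<subseteq># t} \<subseteq> mset ` {xs. set xs \<subseteq> set_mset t \<and> length xs \<le> size t}"
  proof
    fix s assume "s \<in> {s. s \<subseteq># t}"
    then have s: "s \<subseteq># t" by simp
    obtain xs where "mset xs = s" using ex_mset by blast
    then have "set xs \<subseteq> set_mset t" "length xs \<le> size t"
      using set_mset_mono[OF s] size_mset_mono[OF s] by auto
    with \<open>mset xs = s\<close> show "s \<in> mset ` {xs. set xs \<subseteq> set_mset t \<and> length xs \<le> size t}"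
      by blast
  qed
  then show ?thesis
    using finite_lists_length_le[of "set_mset t" "size t"] finite_subset by blast
qed

lemma lookup_mult_sum:
  fixes a b :: "'v multiset \<Rightarrow>\<^sub>0 'a::semiring_0"
  shows "lookup (a * b) t = (\<Sum>s\<in>{s. s \<subseteq># t}. lookup a s * lookup b (t - s))"
proof -
  have inner: "Sum_any (\<lambda>q. lookup b q when t = l + q) = (lookup b (t - l) when l \<subseteq># t)" for l
  proof (cases "l \<subseteq># t")
    case True
    then have "(t = l + q) = (q = t - l)" for q by (metis add_diff_cancel_left' subset_mset.add_diff_inverse)
    then show ?thesis using True by simp
  next
    case False
    then have "t \<noteq> l + q" for q by auto
    then show ?thesis using False by simp
  qed
  have "lookup (a * b) t = Sum_any (\<lambda>l. lookup a l * (lookup b (t - l) when l \<subseteq># t))"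
    by (simp add: lookup_mult inner)
  also have "\<dots> = (\<Sum>l\<in>{l. l \<subseteq># t}. lookup a l * (lookup b (t - l) when l \<subseteq># t))"
    by (rule Sum_any.expand_superset[OF finite_submultisets]) (auto simp: when_def)
  finally show ?thesis by simp
qed

lemma lookup_single_mult:
  fixes a :: "'v multiset \<Rightarrow>\<^sub>0 'a::semiring_0"
  shows "lookup (single s c * a) t = (if s \<subseteq># t then c * lookup a (t - s) else 0)"
proof -
  have "lookup (single s c * a) t = (\<Sum>u\<in>{u. u \<subseteq># t}. if u = s then c * lookup a (t - s) else 0)"
    unfolding lookup_mult_sum by (rule sum.cong) (auto simp: lookup_single when_def)
  then show ?thesis by (simp add: finite_submultisets)
qed

lemma lookup_single_mult_shift [simp]:
  fixes a :: "'v multiset \<Rightarrow>\<^sub>0 'a::semiring_0"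
  shows "lookup (single s c * a) (s + t) = c * lookup a t"
  by (simp add: lookup_single_mult)

lemma keys_single_mult:
  fixes a :: "'v multiset \<Rightarrow>\<^sub>0 'a::semiring_no_zero_divisors"
  assumes "c \<noteq> 0"
  shows "keys (single s c * a) = (+) s ` keys a"
proof -
  have "t \<in> keys (single s c * a) \<longleftrightarrow> t \<in> (+) s ` keys a" for t
  proof (cases "s \<subseteq># t")
    case True
    then obtain u where "t = s + u" by (metis subset_mset.add_diff_inverse)
    then show ?thesis using assms by (auto simp: in_keys_iff)
  next
    case False
    then have "t \<notin> (+) s ` keys a" by auto
    with False show ?thesis by (simp add: in_keys_iff lookup_single_mult)
  qed
  then show ?thesis by blast
qed

lemma poly_mapping_monomial_sum:
  fixes a :: "'b \<Rightarrow>\<^sub>0 'a::comm_monoid_add"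
  shows "a = (\<Sum>t\<in>keys a. single t (lookup a t))"
proof (rule poly_mapping_eqI)
  fix t
  have "lookup (\<Sum>t\<in>keys a. single t (lookup a t)) t
      = (\<Sum>s\<in>keys a. if s = t then lookup a s else 0)"
    unfolding lookup_sum by (rule sum.cong) (auto simp: lookup_single when_def)
  then show "lookup a t = lookup (\<Sum>t\<in>keys a. single t (lookup a t)) t"
    by (simp add: in_keys_iff)
qed


section \<open>Linear algebra modulo a subspace\<close>

text \<open>
  Gaussian elimination: a member of the family that involves the generator \<open>s\<close> serves to eliminate
  \<open>s\<close> from all the others.
\<close>
lemma (in vector_space) infinite_family_dependent:
  assumes "finite S" and W: "subspace W"
    and "infinite K" and "\<And>k. k \<in> K \<Longrightarrow> a k \<in> span (S \<union> W)"
  shows "\<exists>K0 c. finite K0 \<and> K0 \<subseteq> K \<and> (\<exists>k\<in>K0. c k \<noteq> 0) \<and> (\<Sum>k\<in>K0. scale (c k) (a k)) \<in> W"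
  using assms(1,3,4)
proof (induction arbitrary: K a)
  case empty
  from \<open>infinite K\<close> obtain k where "k \<in> K" using infinite_imp_nonempty by blast
  moreover have "a k \<in> W" using empty.prems(2)[OF \<open>k \<in> K\<close>] W by (simp add: span_eq_iff[THEN iffD2])
  ultimately show ?case by (intro exI[of _ "{k}"] exI[of _ "\<lambda>_. 1"]) simp
next
  case (insert s S)
  have "\<exists>t. a k - scale t s \<in> span (S \<union> W)" if "k \<in> K" for k
    using insert.prems(2)[OF that] by (simp add: span_breakdown_eq)
  then obtain t where t: "\<And>k. k \<in> K \<Longrightarrow> a k - scale (t k) s \<in> span (S \<union> W)" by metis
  show ?case
  proof (cases "\<forall>k\<in>K. t k = 0")
    case True
    then show ?thesis using insert.IH[OF insert.prems(1), of a] t by fastforce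
  next
    case False
    then obtain k0 where k0: "k0 \<in> K" "t k0 \<noteq> 0" by blast
    define r where "r k = t k / t k0" for k
    have mem: "a k - scale (r k) (a k0) \<in> span (S \<union> W)" if "k \<in> K - {k0}" for k
    proof -
      have "(a k - scale (t k) s) - scale (r k) (a k0 - scale (t k0) s) \<in> span (S \<union> W)"
        using that k0 by (intro span_diff span_scale[of "_ - _"] t) auto
      moreover have "(a k - scale (t k) s) - scale (r k) (a k0 - scale (t k0) s) = a k - scale (r k) (a k0)"
        using k0 by (simp add: scale_right_diff_distrib r_def)
      ultimately show ?thesis by simp
    qed
    have inf: "infinite (K - {k0})" using insert.prems(1) by simp
    have "\<exists>K0 c. finite K0 \<and> K0 \<subseteq> K - {k0} \<and> (\<exists>k\<in>K0. c k \<noteq> 0) \<and>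
        (\<Sum>k\<in>K0. scale (c k) (a k - scale (r k) (a k0))) \<in> W"
      by (rule insert.IH[OF inf]) (rule mem)
    then obtain K0 c where K0: "finite K0" "K0 \<subseteq> K - {k0}" "\<exists>k\<in>K0. c k \<noteq> 0"
      "(\<Sum>k\<in>K0. scale (c k) (a k - scale (r k) (a k0))) \<in> W"
      by (elim exE conjE) (rule that)
    define c' where "c' k = (if k = k0 then - (\<Sum>k\<in>K0. c k * r k) else c k)" for k
    have "k0 \<notin> K0" using K0 by blast
    then have "(\<Sum>k\<in>insert k0 K0. scale (c' k) (a k)) =
        scale (- (\<Sum>k\<in>K0. c k * r k)) (a k0) + (\<Sum>k\<in>K0. scale (c k) (a k))"
      using K0(1) by (simp add: c'_def) (intro sum.cong, auto)
    also have "\<dots> = (\<Sum>k\<in>K0. scale (c k) (a k - scale (r k) (a k0)))"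
      by (simp add: scale_right_diff_distrib sum_subtractf scale_sum_left scale_minus_left)
    finally show ?thesis using K0 k0 \<open>k0 \<notin> K0\<close>
      by (intro exI[of _ "insert k0 K0"] exI[of _ c']) (auto simp: c'_def)
  qed
qed

lemma (in vector_space) separating_functional:
  assumes W: "subspace W" and v: "v \<notin> W"
  obtains g where "Vector_Spaces.linear scale (*) g" "\<And>w. w \<in> W \<Longrightarrow> g w = 0" "g v = 1"
proof -
  interpret vector_space_pair scale "(*) :: 'a \<Rightarrow> 'a \<Rightarrow> 'a"
    by unfold_locales (auto simp: algebra_simps)
  obtain B where B: "B \<subseteq> W" "independent B" "W \<subseteq> span B"
    using maximal_independent_subset[of W] by blast
  have sB: "span B = W" using B W span_minimal by blast
  then have "independent (insert v B)" using v B(2) by (simp add: independent_insert)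
  then obtain g where g: "Vector_Spaces.linear scale (*) g" "\<And>x. x \<in> insert v B \<Longrightarrow> g x = (if x = v then 1 else 0)"
    using linear_independent_extend[of "insert v B" "\<lambda>x. if x = v then 1 else 0"] by blast
  have "v \<notin> B" using v B(1) by blast
  then have "g w = 0" if "w \<in> W" for w
    using linear_eq_0_on_span[OF g(1), of B w] g(2) that sB by (metis insertCI)
  moreover have "g v = 1" using g(2)[of v] by simp
  ultimately show ?thesis by (rule that[OF g(1)])
qed


text \<open>
  Linear independence modulo \<open>W\<close> is used in this form: for the powers \<open>v i\<close> of a ring element and an
  ideal \<open>W\<close>, the functional turns a polynomial relation of degree \<open>e\<close> into an equation between numbers.
\<close>
lemma (in vector_space) triangular_functional:
  fixes v :: "nat \<Rightarrow> 'b"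
  assumes W: "subspace W"
    and indep: "\<And>c. scale 1 (v e) + (\<Sum>i<e. scale (c i) (v i)) \<notin> W"
  obtains g where "Vector_Spaces.linear scale (*) g" "\<And>w. w \<in> W \<Longrightarrow> g w = 0"
    "\<And>i. i < e \<Longrightarrow> g (v i) = 0" "g (v e) = 1"
proof -
  \<comment> \<open>the span of \<open>W\<close> and the \<open>v i\<close> with \<open>i < e\<close>\<close>
  let ?U = "{w + (\<Sum>i<e. scale (c i) (v i)) |w c. w \<in> W}"
  have U: "subspace ?U"
  proof (rule subspaceI)
    show "0 \<in> ?U"
      using subspace_0[OF W] by (intro CollectI exI[of _ 0] exI[of _ "\<lambda>_. 0"]) simp
  next
    fix x y assume "x \<in> ?U" "y \<in> ?U"
    then obtain w c w' c' where "x = w + (\<Sum>i<e. scale (c i) (v i))" "w \<in> W"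
      "y = w' + (\<Sum>i<e. scale (c' i) (v i))" "w' \<in> W" by blast
    then show "x + y \<in> ?U"
      using subspace_add[OF W]
      by (intro CollectI exI[of _ "w + w'"] exI[of _ "\<lambda>i. c i + c' i"])
        (simp add: scale_left_distrib sum.distrib algebra_simps)
  next
    fix r x assume "x \<in> ?U"
    then obtain w c where "x = w + (\<Sum>i<e. scale (c i) (v i))" "w \<in> W" by blast
    then show "scale r x \<in> ?U"
      using subspace_scale[OF W]
      by (intro CollectI exI[of _ "scale r w"] exI[of _ "\<lambda>i. r * c i"])
        (simp add: scale_right_distrib scale_sum_right)
  qed
  have "v e \<notin> ?U"
  proof
    assume "v e \<in> ?U"
    then obtain w c where "v e = w + (\<Sum>i<e. scale (c i) (v i))" "w \<in> W" by blast
    then have "scale 1 (v e) + (\<Sum>i<e. scale (- c i) (v i)) = w"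
      by (simp add: sum_negf scale_minus_left)
    with indep[of "\<lambda>i. - c i"] \<open>w \<in> W\<close> show False by simp
  qed
  from separating_functional[OF U this] obtain g where
    g: "Vector_Spaces.linear scale (*) g" "\<And>w. w \<in> ?U \<Longrightarrow> g w = 0" "g (v e) = 1" by blast
  have "w \<in> ?U" if "w \<in> W" for w
    using that by (intro CollectI exI[of _ w] exI[of _ "\<lambda>_. 0"]) simp
  moreover have "v i \<in> ?U" if "i < e" for i
  proof -
    have "v i = 0 + (\<Sum>j<e. scale (if j = i then 1 else 0) (v j))"
      using that by (simp add: if_distrib[of "\<lambda>x. scale x _"] sum.delta cong: if_cong)
    with subspace_0[OF W] show ?thesis by (intro CollectI exI conjI)
  qed
  ultimately show ?thesis using g by (intro that[OF g(1)]) blast+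
qed

abbreviation smul :: "rat \<Rightarrow> ('b::comm_monoid_add \<Rightarrow>\<^sub>0 rat) \<Rightarrow> ('b \<Rightarrow>\<^sub>0 rat)"
  where "smul c a \<equiv> single 0 c * a"

interpretation polyvs: vector_space "smul :: rat \<Rightarrow> ('b::comm_monoid_add \<Rightarrow>\<^sub>0 rat) \<Rightarrow> _"
proof
  fix a b :: rat and x y :: "'b \<Rightarrow>\<^sub>0 rat"
  show "smul (a + b) x = smul a x + smul b x" by (simp add: single_add distrib_right)
  show "smul a (smul b x) = smul (a * b) x"
    by (simp add: mult_single flip: mult.assoc)
  show "smul 1 x = x" by simp
qed (simp add: distrib_left)


section \<open>Term orderings and leading terms\<close>

locale term_order =
  fixes \<sigma> :: "'v::finite multiset rel"
  assumes ord: "term_ordering \<sigma>"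
begin

lemma ord_refl: "(t, t) \<in> \<sigma>"
  and ord_trans: "(s, t) \<in> \<sigma> \<Longrightarrow> (t, u) \<in> \<sigma> \<Longrightarrow> (s, u) \<in> \<sigma>"
  and ord_antisym: "(s, t) \<in> \<sigma> \<Longrightarrow> (t, s) \<in> \<sigma> \<Longrightarrow> s = t"
  and ord_total: "(s, t) \<in> \<sigma> \<or> (t, s) \<in> \<sigma>"
  and ord_add: "(s, t) \<in> \<sigma> \<Longrightarrow> (u + s, u + t) \<in> \<sigma>"
proof -
  have lin: "linear_order \<sigma>" using ord by (simp add: term_ordering_def)
  show r: "(t, t) \<in> \<sigma>" for t using lin by (auto simp: order_on_defs refl_on_def)
  show "(s, t) \<in> \<sigma> \<Longrightarrow> (t, u) \<in> \<sigma> \<Longrightarrow> (s, u) \<in> \<sigma>"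
    using lin by (auto simp: order_on_defs dest: transD)
  show "(s, t) \<in> \<sigma> \<Longrightarrow> (t, s) \<in> \<sigma> \<Longrightarrow> s = t"
    using lin by (auto simp: order_on_defs dest: antisymD)
  show "(s, t) \<in> \<sigma> \<or> (t, s) \<in> \<sigma>"
    using lin r by (cases "s = t") (auto simp: order_on_defs total_on_def)
  show "(s, t) \<in> \<sigma> \<Longrightarrow> (u + s, u + t) \<in> \<sigma>"
    using ord by (simp add: term_ordering_def add.commute[of u])
qed

lemma ord_submultiset: "s \<subseteq># t \<Longrightarrow> (s, t) \<in> \<sigma>"
proof -
  assume "s \<subseteq># t"
  then obtain u where "t = s + u" by (metis subset_mset.add_diff_inverse)
  moreover have "(s + {#}, s + u) \<in> \<sigma>" by (rule ord_add) (use ord in \<open>simp add: term_ordering_def\<close>)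
  ultimately show ?thesis by simp
qed


text \<open>
  In an infinite descending sequence some term would divide a later one, and divisors are smaller.
\<close>
lemma ord_wf: "wf (\<sigma> - Id)"
  unfolding wf_iff_no_infinite_down_chain
proof
  assume "\<exists>f. \<forall>i. (f (Suc i), f i) \<in> \<sigma> - Id"
  then obtain f where f: "\<And>i. (f (Suc i), f i) \<in> \<sigma> - Id" by blast
  have desc: "(f j, f i) \<in> \<sigma> - Id" if "i < j" for i j
    using that
  proof (induction rule: less_Suc_induct)
    case (2 i j k)
    then show ?case using ord_trans[of "f k" "f j" "f i"] ord_antisym[of "f k" "f j"] by auto
  qed (rule f)
  obtain i j where "i < j" "f i \<subseteq># f j" using dickson by blast
  with desc[of i j] show False using ord_submultiset[of "f i" "f j"] ord_antisym[of "f i" "f j"] by auto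
qed

lemma ord_finite_max:
  assumes "finite T" "T \<noteq> {}"
  shows "\<exists>t\<in>T. \<forall>s\<in>T. (s, t) \<in> \<sigma>"
  using assms
proof (induction rule: finite_ne_induct)
  case (singleton x)
  then show ?case using ord_refl by blast
next
  case (insert x F)
  then obtain t where "t \<in> F" "\<forall>s\<in>F. (s, t) \<in> \<sigma>" by blast
  then show ?case using ord_total[of x t] ord_trans ord_refl by blast
qed

definition LT :: "('v multiset \<Rightarrow>\<^sub>0 rat) \<Rightarrow> 'v multiset"
  where "LT a = lead_term QQ \<sigma> (lookup a)"

lemma supp_lookup: "supp QQ (lookup a) = keys a"
  by (auto simp: supp_def ring_of_type_algebra_def in_keys_iff)

lemma LT_eqI:
  assumes "t \<in> keys a" "\<And>s. s \<in> keys a \<Longrightarrow> (s, t) \<in> \<sigma>"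
  shows "LT a = t"
  unfolding LT_def lead_term_def supp_lookup
proof (rule the_equality)
  fix u assume "u \<in> keys a \<and> (\<forall>s\<in>keys a. (s, u) \<in> \<sigma>)"
  then show "u = t" using assms ord_antisym[of u t] by simp
qed (use assms in simp)

lemma LT_props:
  assumes "a \<noteq> 0"
  shows LT_in_keys: "LT a \<in> keys a" and LT_max: "s \<in> keys a \<Longrightarrow> (s, LT a) \<in> \<sigma>"
proof -
  have "keys a \<noteq> {}" using assms poly_mapping_eqI[of a 0] by (metis empty_iff in_keys_iff lookup_zero)
  then obtain t where t: "t \<in> keys a" "\<And>s. s \<in> keys a \<Longrightarrow> (s, t) \<in> \<sigma>"
    using ord_finite_max[of "keys a"] by auto
  then have "LT a = t" by (rule LT_eqI)
  with t show "LT a \<in> keys a" "s \<in> keys a \<Longrightarrow> (s, LT a) \<in> \<sigma>" by simp_all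
qed

lemma LT_single_mult:
  assumes "a \<noteq> 0" "c \<noteq> 0"
  shows "LT (single s c * a) = s + LT a"
proof (rule LT_eqI)
  show "s + LT a \<in> keys (single s c * a)"
    using LT_in_keys[OF assms(1)] assms(2) by (simp add: keys_single_mult)
next
  fix t assume "t \<in> keys (single s c * a)"
  then obtain u where "u \<in> keys a" "t = s + u" using assms(2) by (auto simp: keys_single_mult)
  then show "(t, s + LT a) \<in> \<sigma>" using LT_max[OF assms(1)] ord_add by simp
qed

end


lemma lookup_smul [simp]:
  "lookup (smul c a) t = c * lookup a (t :: 'v multiset)"
  by (simp add: lookup_single_mult)


section \<open>Existence and uniqueness of reduced Groebner bases\<close>

locale order_ideal = term_order \<sigma> for \<sigma> :: "'v::finite multiset rel" +
  fixes I :: "('v::finite multiset \<Rightarrow>\<^sub>0 rat) set"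
  assumes zero_mem: "0 \<in> I"
    and add_mem: "a \<in> I \<Longrightarrow> b \<in> I \<Longrightarrow> a + b \<in> I"
    and mult_mem: "a \<in> I \<Longrightarrow> c * a \<in> I"
begin

lemma diff_mem: "a \<in> I \<Longrightarrow> b \<in> I \<Longrightarrow> a - b \<in> I"
  using add_mem[of a "- 1 * b"] mult_mem[of b "- 1"] by simp

lemma sum_mem: "(\<And>k. k \<in> K \<Longrightarrow> a k \<in> I) \<Longrightarrow> sum a K \<in> I"
  by (induction K rule: infinite_finite_induct) (auto intro: zero_mem add_mem)

lemma ideal_subspace: "polyvs.subspace I"
  by (rule polyvs.subspaceI) (auto intro: zero_mem add_mem mult_mem)


text \<open>
  The standard terms. Their classes form a basis of the quotient by \<open>I\<close>.
\<close>
definition std :: "'v multiset set"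
  where "std = {t. \<forall>a\<in>I. a \<noteq> 0 \<longrightarrow> LT a \<noteq> t}"

lemma LT_notin_std: "a \<in> I \<Longrightarrow> a \<noteq> 0 \<Longrightarrow> LT a \<notin> std"
  by (auto simp: std_def)

lemma std_subset: assumes "t \<in> std" "s \<subseteq># t" shows "s \<in> std"
proof (rule ccontr)
  assume "s \<notin> std"
  then obtain a where a: "a \<in> I" "a \<noteq> 0" "LT a = s" by (auto simp: std_def)
  have LT: "LT (single (t - s) 1 * a) = t"
    using a(2,3) assms(2) by (simp add: LT_single_mult)
  have "lookup (single (t - s) 1 * a) ((t - s) + s) \<noteq> 0"
    using LT_in_keys[OF a(2)] a(3) by (simp only: lookup_single_mult_shift in_keys_iff mult_1 not_False_eq_True)
  then have "single (t - s) 1 * a \<noteq> 0" by (metis lookup_zero)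
  with mult_mem[OF a(1)] LT have "t \<notin> std" by (auto simp: std_def)
  with assms(1) show False by simp
qed

lemma std_supported_eq_0:
  assumes "a \<in> I" "keys a \<subseteq> std" shows "a = 0"
  using assms LT_in_keys[of a] LT_notin_std[of a] by blast


text \<open>
  A term \<open>t\<close> that is not standard is the leading term of an element of \<open>I\<close>, and modulo this element it
  is a combination of smaller terms.
\<close>
lemma normal_form:
  "\<exists>r. single t 1 - r \<in> I \<and> keys r \<subseteq> std \<and> (\<forall>s\<in>keys r. (s, t) \<in> \<sigma>)"
proof (induction t rule: wf_induct_rule[OF ord_wf])
  case (1 t)
  show ?case
  proof (cases "t \<in> std")
    case True
    then show ?thesis by (intro exI[of _ "single t 1"]) (simp add: zero_mem ord_refl)
  next
    case False
    then obtain a where a: "a \<in> I" "a \<noteq> 0" "LT a = t" by (auto simp: std_def)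
    define c where "c = lookup a t"
    have c: "c \<noteq> 0" using LT_in_keys[OF a(2)] a(3) by (simp add: c_def in_keys_iff)
    let ?T = "keys a - {t}"
    have "\<exists>r. single s 1 - r \<in> I \<and> keys r \<subseteq> std \<and> (\<forall>u\<in>keys r. (u, s) \<in> \<sigma>)" if "s \<in> ?T" for s
      using that LT_max[OF a(2)] a(3) 1[of s] by auto
    then obtain r where r: "\<And>s. s \<in> ?T \<Longrightarrow> single s 1 - r s \<in> I"
        "\<And>s. s \<in> ?T \<Longrightarrow> keys (r s) \<subseteq> std" "\<And>s u. s \<in> ?T \<Longrightarrow> u \<in> keys (r s) \<Longrightarrow> (u, s) \<in> \<sigma>"
      by metis
    define q where "q = - (\<Sum>s\<in>?T. smul (lookup a s / c) (r s))"
    have "smul (1 / c) a - (\<Sum>s\<in>?T. smul (lookup a s / c) (single s 1 - r s)) \<in> I"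
      by (intro diff_mem sum_mem mult_mem a(1) r(1))
    moreover have "smul (1 / c) a = single t 1 + (\<Sum>s\<in>?T. single s (lookup a s / c))"
    proof -
      have "smul (1 / c) a = smul (1 / c) (\<Sum>s\<in>keys a. single s (lookup a s))"
        by (simp flip: poly_mapping_monomial_sum)
      also have "\<dots> = (\<Sum>s\<in>keys a. single s (lookup a s / c))"
        by (simp add: sum_distrib_left mult_single)
      also have "\<dots> = single t (lookup a t / c) + (\<Sum>s\<in>?T. single s (lookup a s / c))"
        using LT_in_keys[OF a(2)] a(3) by (intro sum.remove) auto
      finally show ?thesis using c by (simp add: c_def)
    qed
    ultimately have "single t 1 - q \<in> I"
      by (simp add: q_def right_diff_distrib mult_single sum_subtractf)
    moreover have q: "\<exists>s\<in>?T. u \<in> keys (r s)" if "u \<in> keys q" for u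
    proof (rule ccontr)
      assume "\<not> ?thesis"
      then have "lookup q u = 0"
        by (auto simp: q_def lookup_sum in_keys_iff intro!: sum.neutral)
      with that show False by (simp add: in_keys_iff)
    qed
    moreover have "(u, t) \<in> \<sigma>" if "u \<in> keys q" for u
      using q[OF that] r(3) LT_max[OF a(2)] a(3) ord_trans by blast
    moreover have "keys q \<subseteq> std" using q r(2) by blast
    ultimately show ?thesis by blast
  qed
qed

end

locale zero_dim_ideal = order_ideal \<sigma> I for \<sigma> and I :: "('v::finite multiset \<Rightarrow>\<^sub>0 rat) set" +
  assumes finite_codim: "\<exists>S. finite S \<and> polyvs.span (S \<union> I) = UNIV"
begin


text \<open>
  In a quotient of finite dimension infinitely many standard terms would be dependent; the dependence
  is a nonzero element of \<open>I\<close> supported in the standard terms.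
\<close>
lemma finite_std: "finite std"
proof (rule ccontr)
  assume inf: "infinite std"
  obtain S where S: "finite S" "polyvs.span (S \<union> I) = UNIV" using finite_codim by blast
  have "\<exists>K0 c. finite K0 \<and> K0 \<subseteq> std \<and> (\<exists>k\<in>K0. c k \<noteq> 0) \<and> (\<Sum>k\<in>K0. smul (c k) (single k 1)) \<in> I"
    using polyvs.infinite_family_dependent[OF S(1) ideal_subspace inf, of "\<lambda>t. single t 1"] S(2) by simp
  then obtain K0 c where K0: "finite K0" "K0 \<subseteq> std" "\<exists>k\<in>K0. c k \<noteq> 0"
    "(\<Sum>k\<in>K0. smul (c k) (single k 1)) \<in> I" by (elim exE conjE) (rule that)
  let ?a = "\<Sum>k\<in>K0. smul (c k) (single k 1)"
  have look: "lookup ?a t = (if t \<in> K0 then c t else 0)" for t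
  proof -
    have "lookup ?a t = (\<Sum>k\<in>K0. if t = k then c k else 0)"
      unfolding lookup_sum by (rule sum.cong) (auto simp: lookup_single when_def)
    then show ?thesis using K0(1) by (simp add: sum.delta)
  qed
  have "keys ?a \<subseteq> std"
  proof
    fix t assume "t \<in> keys ?a"
    then have "lookup ?a t \<noteq> 0" by (simp only: in_keys_iff not_False_eq_True)
    then have "t \<in> K0" unfolding look by (simp split: if_splits)
    then show "t \<in> std" using K0(2) by blast
  qed
  then have zero: "?a = 0" by (rule std_supported_eq_0[OF K0(4)])
  from K0(3) obtain t where t: "t \<in> K0" "c t \<noteq> 0" by blast
  have "lookup ?a t = 0" unfolding zero by simp
  with look[of t] t show False by simp
qed

definition mingens :: "'v multiset set"
  where "mingens = {t. t \<notin> std \<and> (\<forall>s. s \<subset># t \<longrightarrow> s \<in> std)}"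


text \<open>
  Removing one indeterminate from a minimal generator leaves a standard term.
\<close>
lemma finite_mingens: "finite mingens"
proof -
  have "mingens \<subseteq> insert {#} (\<Union>x\<in>UNIV. add_mset x ` std)"
  proof
    fix t assume t: "t \<in> mingens"
    show "t \<in> insert {#} (\<Union>x\<in>UNIV. add_mset x ` std)"
    proof (cases t)
      case (add x s)
      then have "s \<in> std" using t by (auto simp: mingens_def)
      with add show ?thesis by blast
    qed simp
  qed
  then show ?thesis by (rule finite_subset) (simp add: finite_std)
qed

lemma mingens_below: "t \<notin> std \<Longrightarrow> \<exists>m\<in>mingens. m \<subseteq># t"
proof (induction "size t" arbitrary: t rule: less_induct)
  case less
  show ?case
  proof (cases "t \<in> mingens")
    case False
    then obtain s where s: "s \<subset># t" "s \<notin> std" using less.prems by (auto simp: mingens_def)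
    then obtain m where "m \<in> mingens" "m \<subseteq># s" using less.hyps[of s] mset_subset_size by blast
    with s(1) show ?thesis by (meson subset_mset.less_imp_le subset_mset.order_trans)
  qed auto
qed

definition reduced_gb :: "('v multiset \<Rightarrow>\<^sub>0 rat) set \<Rightarrow> bool"
  where "reduced_gb G \<longleftrightarrow> finite G \<and> G \<subseteq> I - {0} \<and> (\<forall>a\<in>I - {0}. \<exists>g\<in>G. LT g \<subseteq># LT a) \<and>
    (\<forall>g\<in>G. lookup g (LT g) = 1) \<and> (\<forall>g\<in>G. \<forall>t\<in>keys g. \<forall>h\<in>G - {g}. \<not> LT h \<subseteq># t)"

lemma reduced_gb_iff: "is_reduced_groebner_basis QQ \<sigma> (lookup ` I) (lookup ` G) \<longleftrightarrow> reduced_gb G"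
proof -
  have inj: "inj lookup" by (auto intro: injI poly_mapping_eqI)
  have z: "\<zero>\<^bsub>mpoly_ring QQ\<^esub> = lookup 0"
    by (simp add: mpoly_ring_def ring_of_type_algebra_def fun_eq_iff)
  have one: "\<one>\<^bsub>QQ\<^esub> = (1::rat)" by (simp add: ring_of_type_algebra_def)
  have im: "lookup ` Y - {lookup 0} = lookup ` (Y - {0})" "lookup ` Y - {lookup g} = lookup ` (Y - {g})"
    for Y :: "('v multiset \<Rightarrow>\<^sub>0 rat) set" and g using inj by (auto dest: injD)
  have fin: "finite (lookup ` G) = finite G"
    using finite_image_iff[OF inj_on_subset[OF inj subset_UNIV]] .
  show ?thesis
    unfolding is_reduced_groebner_basis_def is_groebner_basis_def reduced_gb_def z im one ball_simps
      bex_simps supp_lookup LT_def[symmetric]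
      fin inj_image_subset_iff[OF inj] conj_assoc ..
qed

lemma mingens_gen:
  obtains g where "\<And>t. t \<in> mingens \<Longrightarrow> g t \<in> I" "\<And>t. t \<in> mingens \<Longrightarrow> LT (g t) = t"
    "\<And>t. t \<in> mingens \<Longrightarrow> lookup (g t) t = 1" "\<And>t. t \<in> mingens \<Longrightarrow> keys (g t) \<subseteq> insert t std"
proof -
  obtain nf where nf: "\<And>t. single t 1 - nf t \<in> I" "\<And>t. keys (nf t) \<subseteq> std"
    "\<And>t s. s \<in> keys (nf t) \<Longrightarrow> (s, t) \<in> \<sigma>"
    using normal_form by metis
  define g where "g t = single t 1 - nf t" for t
  have keys: "keys (g t) \<subseteq> insert t (keys (nf t))" for t
    by (auto simp: g_def in_keys_iff lookup_minus lookup_single when_def split: if_splits)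
  have one: "lookup (g t) t = 1" if "t \<in> mingens" for t
  proof -
    have "t \<notin> keys (nf t)" using nf(2) that by (auto simp: mingens_def)
    then show ?thesis by (simp add: g_def lookup_minus in_keys_iff)
  qed
  have LT: "LT (g t) = t" if "t \<in> mingens" for t
    using keys[of t] one[OF that] nf(3)[of _ t] ord_refl by (intro LT_eqI) (auto simp: in_keys_iff)
  have "keys (g t) \<subseteq> insert t std" for t using keys[of t] nf(2)[of t] by blast
  moreover have "g t \<in> I" for t using nf(1) by (simp add: g_def)
  ultimately show ?thesis using that[of g] one LT by simp
qed


text \<open>
  The elements of the basis are the minimal generators minus their normal forms. Conversely, the
  leading terms of a reduced basis are the minimal generators and the other terms in it are standard, and
  two elements of \<open>I\<close> of this shape with the same leading term differ by an element of \<open>I\<close> supported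
  in the standard terms.
\<close>
lemma reduced_gb_ex1: "\<exists>!G. reduced_gb G"
proof -
  obtain g where g: "\<And>t. t \<in> mingens \<Longrightarrow> g t \<in> I" "\<And>t. t \<in> mingens \<Longrightarrow> LT (g t) = t"
    "\<And>t. t \<in> mingens \<Longrightarrow> lookup (g t) t = 1" "\<And>t. t \<in> mingens \<Longrightarrow> keys (g t) \<subseteq> insert t std"
    using mingens_gen by metis
  have min: "s = t" if "s \<notin> std" "t \<in> mingens" "s \<subseteq># t" for s t
    using that by (auto simp: mingens_def subset_mset.le_less)
  show ?thesis
  proof (rule ex1I)
    show "reduced_gb (g ` mingens)"
      unfolding reduced_gb_def
    proof (intro conjI ballI)
      show "finite (g ` mingens)" by (simp add: finite_mingens)
    next
      have "g t \<noteq> 0" if "t \<in> mingens" for t using g(3)[OF that] by auto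
      then show "g ` mingens \<subseteq> I - {0}" using g(1) by (intro image_subsetI) simp
    next
      fix a assume "a \<in> I - {0}"
      then obtain m where "m \<in> mingens" "m \<subseteq># LT a" using mingens_below[OF LT_notin_std[of a]] by blast
      then show "\<exists>h\<in>g ` mingens. LT h \<subseteq># LT a" using g(2)[of m] by (intro bexI[of _ "g m"]) simp_all
    next
      fix h assume "h \<in> g ` mingens"
      then obtain t where "t \<in> mingens" "h = g t" by blast
      then show "lookup h (LT h) = 1" using g(2,3)[of t] by simp
    next
      fix h u h' assume h: "h \<in> g ` mingens" and u: "u \<in> keys h" and h': "h' \<in> g ` mingens - {h}"
      from h obtain t where t: "t \<in> mingens" "h = g t" by blast
      from h' obtain t' where t': "t' \<in> mingens" "h' = g t'" "t' \<noteq> t" using t by blast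
      have "t' \<notin> std" using t' by (simp add: mingens_def)
      have "\<not> t' \<subseteq># u"
      proof (cases "u = t")
        case True
        then show ?thesis using min[OF \<open>t' \<notin> std\<close> t(1)] t'(3) by blast
      next
        case False
        then have "u \<in> std" using u g(4)[OF t(1)] t(2) by blast
        then show ?thesis using std_subset \<open>t' \<notin> std\<close> by blast
      qed
      then show "\<not> LT h' \<subseteq># u" using g(2) t' by simp
    qed
  next
    fix G assume "reduced_gb G"
    then have G: "G \<subseteq> I - {0}" "\<And>a. a \<in> I \<Longrightarrow> a \<noteq> 0 \<Longrightarrow> \<exists>g\<in>G. LT g \<subseteq># LT a"
      "\<And>g. g \<in> G \<Longrightarrow> lookup g (LT g) = 1"
      "\<And>g t h. g \<in> G \<Longrightarrow> t \<in> keys g \<Longrightarrow> h \<in> G \<Longrightarrow> LT h \<subseteq># t \<Longrightarrow> h = g"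
      unfolding reduced_gb_def by blast+
    have div: "\<exists>h\<in>G. LT h \<subseteq># t" if "t \<notin> std" for t using G(2) that unfolding std_def by blast
    have sub: "LT h \<in> mingens \<and> h = g (LT h)" if h: "h \<in> G" for h
    proof
      have h0: "h \<noteq> 0" "h \<in> I" using h G(1) by auto
      have tail: "u \<in> std" if "u \<in> keys h" "u \<noteq> LT h" for u
      proof (rule ccontr)
        assume "u \<notin> std"
        then obtain k where k: "k \<in> G" "LT k \<subseteq># u" using div by blast
        then have "k = h" using G(4)[OF h that(1)] by blast
        then show False using k(2) ord_submultiset LT_max[OF h0(1) that(1)] ord_antisym that(2) by blast
      qed
      obtain m where m: "m \<in> mingens" "m \<subseteq># LT h" using mingens_below[OF LT_notin_std[OF h0(2,1)]] by blast
      then obtain k where k: "k \<in> G" "LT k \<subseteq># m" using div[of m] by (auto simp: mingens_def)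
      then have "LT k \<subseteq># LT h" using m(2) by (meson subset_mset.order_trans)
      then have "k = h" using G(4)[OF h LT_in_keys[OF h0(1)] k(1)] by blast
      then have "m = LT h" using k(2) m(2) by (simp add: subset_mset.antisym)
      then show mem: "LT h \<in> mingens" using m(1) by simp
      have "keys (h - g (LT h)) \<subseteq> std"
      proof
        fix u assume u: "u \<in> keys (h - g (LT h))"
        have "u \<noteq> LT h"
          using u G(3)[OF h] g(3)[OF mem] by (auto simp: in_keys_iff lookup_minus)
        moreover have "u \<in> keys h \<or> u \<in> keys (g (LT h))"
          using u by (auto simp: in_keys_iff lookup_minus)
        ultimately show "u \<in> std" using tail g(4)[OF mem] by blast
      qed
      then have "h - g (LT h) = 0" by (rule std_supported_eq_0[OF diff_mem[OF h0(2) g(1)[OF mem]]])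
      then show "h = g (LT h)" by simp
    qed
    have "g t \<in> G" if t: "t \<in> mingens" for t
    proof -
      obtain h where h: "h \<in> G" "LT h \<subseteq># t" using div[of t] t by (auto simp: mingens_def)
      then have "LT h = t" using sub[OF h(1)] min t by (auto simp: mingens_def)
      then show ?thesis using sub[OF h(1)] h(1) by simp
    qed
    then show "G = g ` mingens" using sub by blast
  qed
qed

definition GB :: "('v multiset \<Rightarrow>\<^sub>0 rat) set"
  where "GB = (THE G. reduced_gb G)"

lemma reduced_gb_GB: "reduced_gb GB"
  unfolding GB_def by (rule theI'[OF reduced_gb_ex1])

lemma reduced_groebner_basis_eq: "reduced_groebner_basis QQ \<sigma> (lookup ` I) = lookup ` GB"
  unfolding reduced_groebner_basis_def
proof (rule the_equality)
  show "is_reduced_groebner_basis QQ \<sigma> (lookup ` I) (lookup ` GB)"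
    using reduced_gb_iff reduced_gb_GB by simp
next
  fix G assume G: "is_reduced_groebner_basis QQ \<sigma> (lookup ` I) G"
  then have "G \<subseteq> lookup ` I" by (auto simp: is_reduced_groebner_basis_def is_groebner_basis_def)
  then obtain G' where G': "G = lookup ` G'" by (auto simp: subset_image_iff)
  then have "reduced_gb G'" using G reduced_gb_iff by simp
  then show "G = lookup ` GB" using reduced_gb_ex1 reduced_gb_GB G' by blast
qed

end


section \<open>Rational numbers integral at a prime\<close>

lemma rat_eq_denom: "q = of_int (fst (quotient_of q)) / of_int (denom q)"
  and denom_pos: "denom q > 0"
  and coprime_denom: "coprime (fst (quotient_of q)) (denom q)"
  unfolding denom_def
  using quotient_of_div[of q] quotient_of_denom_pos'[of q] quotient_of_coprime[of q]
  by (metis prod.collapse)+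

definition p_integral :: "int \<Rightarrow> rat \<Rightarrow> bool"
  where "p_integral p q \<longleftrightarrow> \<not> p dvd denom q"

lemma p_integralE:
  assumes "p_integral p q"
  obtains a b where "q = of_int a / of_int b" "\<not> p dvd b" "b \<noteq> 0"
  using assms rat_eq_denom[of q] denom_pos[of q] unfolding p_integral_def by (metis less_irrefl)


text \<open>
  The fraction need not be in lowest terms, which makes closure under the ring operations immediate.
\<close>
lemma p_integralI:
  assumes "Factorial_Ring.prime p" "\<not> p dvd b" "q = of_int a / of_int b"
  shows "p_integral p q"
  unfolding p_integral_def
proof
  assume p: "p dvd denom q"
  let ?n = "fst (quotient_of q)"
  have "b \<noteq> 0" using assms(2) by auto
  have "of_int a / of_int b = of_int ?n / (of_int (denom q) :: rat)"
    using rat_eq_denom[of q] assms(3) by simp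
  then have "of_int (a * denom q) = (of_int (?n * b) :: rat)"
    using \<open>b \<noteq> 0\<close> denom_pos[of q] by (simp add: field_simps)
  then have "a * denom q = ?n * b" by (simp only: of_int_eq_iff)
  then have "p dvd ?n * b" using p by (metis dvd_mult)
  then have "p dvd ?n" using assms(1,2) prime_dvd_multD by blast
  with p coprime_denom[of q] have "is_unit p" by (meson coprime_common_divisor)
  with assms(1) show False using not_prime_unit by blast
qed

context
  fixes p :: int
  assumes p: "Factorial_Ring.prime p"
begin

lemma p_integral_of_int: "p_integral p (of_int a)"
  using p not_prime_unit[of p] by (intro p_integralI[where b = 1 and a = a]) auto

lemma p_integral_0: "p_integral p 0" and p_integral_1: "p_integral p 1"
  using p_integral_of_int[of 0] p_integral_of_int[of 1] by simp_all

lemma p_integral_add: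
  assumes "p_integral p x" "p_integral p y" shows "p_integral p (x + y)"
proof -
  obtain a b where x: "x = of_int a / of_int b" "\<not> p dvd b" "b \<noteq> 0" using assms(1) by (rule p_integralE)
  obtain c d where y: "y = of_int c / of_int d" "\<not> p dvd d" "d \<noteq> 0" using assms(2) by (rule p_integralE)
  show ?thesis
    by (rule p_integralI[OF p, where b = "b * d" and a = "a * d + c * b"])
      (use x y p in \<open>auto simp: prime_dvd_mult_iff field_simps\<close>)
qed

lemma p_integral_mult:
  assumes "p_integral p x" "p_integral p y" shows "p_integral p (x * y)"
proof -
  obtain a b where x: "x = of_int a / of_int b" "\<not> p dvd b" "b \<noteq> 0" using assms(1) by (rule p_integralE)
  obtain c d where y: "y = of_int c / of_int d" "\<not> p dvd d" "d \<noteq> 0" using assms(2) by (rule p_integralE)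
  show ?thesis
    by (rule p_integralI[OF p, where b = "b * d" and a = "a * c"])
      (use x y p in \<open>auto simp: prime_dvd_mult_iff\<close>)
qed

lemma p_integral_uminus: "p_integral p x \<Longrightarrow> p_integral p (- x)"
  using p_integral_mult[OF p_integral_of_int[of "-1"]] by simp

lemma p_integral_sum: "(\<And>k. k \<in> K \<Longrightarrow> p_integral p (f k)) \<Longrightarrow> p_integral p (sum f K)"
  by (induction K rule: infinite_finite_induct) (auto intro: p_integral_0 p_integral_add)

lemma p_integral_scaled_mono:
  assumes "p_integral p (of_int p ^ s * q)" "s \<le> t" shows "p_integral p (of_int p ^ t * q)"
proof -
  have "of_int p ^ t * q = of_int (p ^ (t - s)) * (of_int p ^ s * q)"
    using assms(2) by (simp flip: power_add mult.assoc)
  then show ?thesis using p_integral_mult[OF p_integral_of_int assms(1)] by metis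
qed

lemma p_integral_scaled: "\<exists>t. p_integral p (of_int p ^ t * q)"
proof -
  have nu: "\<not> is_unit p" using p not_prime_unit by blast
  obtain b where b: "denom q = p ^ multiplicity p (denom q) * b" "\<not> p dvd b"
    using multiplicity_decompose'[of "denom q" p] denom_pos[of q] nu by (metis less_irrefl)
  let ?t = "multiplicity p (denom q)"
  have "p \<noteq> 0" using p by auto
  have "of_int p ^ ?t * q = of_int p ^ ?t * (of_int (fst (quotient_of q)) / of_int (p ^ ?t * b))"
    using rat_eq_denom[of q] b(1) by simp
  also have "\<dots> = of_int (fst (quotient_of q)) / of_int b" using \<open>p \<noteq> 0\<close> by simp
  finally show ?thesis using p_integralI[OF p b(2)] by blast
qed

lemma p_integral_inverse:
  assumes "p_integral p x" "\<not> p_integral p (x / of_int p)"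
  shows "p_integral p (1 / x)" "x \<noteq> 0"
proof -
  obtain a b where x: "x = of_int a / of_int b" "\<not> p dvd b" "b \<noteq> 0" using assms(1) by (rule p_integralE)
  have "p \<noteq> 0" using p by auto
  have "\<not> p dvd a"
  proof
    assume "p dvd a"
    then obtain c where "a = p * c" by blast
    then have "x / of_int p = of_int c / of_int b" using x \<open>p \<noteq> 0\<close> by simp
    with p_integralI[OF p x(2)] assms(2) show False by blast
  qed
  then show "p_integral p (1 / x)" by (rule p_integralI[OF p, where a = b]) (use x in simp)
  show "x \<noteq> 0" using assms(2) p_integral_0 by auto
qed

lemma p_integral_infinitely_divisible:
  assumes "\<And>n. p_integral p (x / of_int p ^ n)" shows "x = 0"
proof (rule ccontr)
  assume "x \<noteq> 0"
  define a b where "a = fst (quotient_of x)" and "b = denom x"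
  have x: "x = of_int a / of_int b" and b: "b > 0" using rat_eq_denom denom_pos by (simp_all add: a_def b_def)
  have "a \<noteq> 0" using x \<open>x \<noteq> 0\<close> by auto
  have "p \<noteq> 0" "p > 1" using p prime_gt_1_int by auto
  define n where "n = nat \<bar>a\<bar>"
  obtain c d where c: "x / of_int p ^ n = of_int c / of_int d" "\<not> p dvd d" "d \<noteq> 0"
    using assms[of n] by (rule p_integralE)
  then have "of_int (a * d) = (of_int (p ^ n * (c * b)) :: rat)"
    using x b \<open>p \<noteq> 0\<close> by (simp add: field_simps)
  then have "a * d = p ^ n * (c * b)" by (simp only: of_int_eq_iff)
  moreover have "coprime (p ^ n) d" using c(2) p by (simp add: prime_imp_coprime)
  ultimately have "p ^ n dvd a" by (metis coprime_dvd_mult_left_iff dvd_triv_left)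
  then have "p ^ n \<le> \<bar>a\<bar>" using \<open>a \<noteq> 0\<close> by (meson dvd_imp_le_int zdvd_imp_le abs_ge_self dvd_abs_iff zero_less_abs_iff)
  moreover have "int n < 2 ^ n" by (metis of_nat_less_two_power)
  moreover have "(2::int) ^ n \<le> p ^ n" using \<open>p > 1\<close> by (intro power_mono) auto
  ultimately show False by (simp add: n_def)
qed


text \<open>
  Fatou's argument on linear recurrences with integral coefficients. Modulo \<open>p\<close> the recurrence has order
  \<open>e\<close> and starts from \<open>e\<close> zeros, so that \<open>p\<close> divides every \<open>D * w k\<close> as soon as these are \<open>p\<close>-integral.
  Then \<open>D / p\<close> can take the place of \<open>D\<close>, and so on forever.
\<close>
lemma fatou:
  fixes w b :: "nat \<Rightarrow> rat"
  assumes bounded: "D \<noteq> 0" "\<And>k. p_integral p (D * w k)"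
    and w: "\<And>i. i < e \<Longrightarrow> w i = 0" "w e = 1"
    and rec: "\<And>k. (\<Sum>i\<le>d. b i * w (k + i)) = 0"
    and b: "\<And>i. i \<le> d \<Longrightarrow> p_integral p (b i)"
    and e: "e \<le> d" "b e \<noteq> 0" "p_integral p (1 / b e)"
    and above: "\<And>i. e < i \<Longrightarrow> i \<le> d \<Longrightarrow> p_integral p (b i / of_int p)"
  shows False
proof -
  have p0: "(of_int p :: rat) \<noteq> 0" using p by auto
  have step: "p_integral p (D / of_int p * w k)" if D: "\<And>k. p_integral p (D * w k)" for D k
  proof (induction k rule: less_induct)
    case (less k)
    show ?case
    proof (cases "k < e")
      case True
      then show ?thesis using w(1) p_integral_0 by simp
    next
      case False
      then obtain j where k: "k = j + e" using le_Suc_ex by (metis add.commute not_less)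
      have term_int: "p_integral p (b i * (D / of_int p * w (j + i)))" if "i \<in> {..d} - {e}" for i
      proof (cases "i < e")
        case True
        then show ?thesis using p_integral_mult[OF b[of i] less[of "j + i"]] k that by simp
      next
        case False
        then have "p_integral p (b i / of_int p)" using above that by auto
        from p_integral_mult[OF this D[of "j + i"]] show ?thesis by (simp add: mult.assoc)
      qed
      have "0 = D / of_int p * (\<Sum>i\<le>d. b i * w (j + i))" using rec by simp
      also have "\<dots> = (\<Sum>i\<le>d. b i * (D / of_int p * w (j + i)))"
        by (simp add: sum_distrib_left mult_ac)
      also have "\<dots> = b e * (D / of_int p * w k) + (\<Sum>i\<in>{..d} - {e}. b i * (D / of_int p * w (j + i)))"
        using e(1) by (subst sum.remove[of _ e]) (auto simp: k)
      finally have "D / of_int p * w k = - (1 / b e * (\<Sum>i\<in>{..d} - {e}. b i * (D / of_int p * w (j + i))))"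
        using e(2) by (simp add: field_simps)
      also have "p_integral p \<dots>"
        by (intro p_integral_uminus p_integral_mult[OF e(3)] p_integral_sum term_int)
      finally show ?thesis .
    qed
  qed
  have "p_integral p (D / of_int p ^ n * w k)" for n k
  proof (induction n arbitrary: k)
    case 0
    then show ?case using bounded by simp
  next
    case (Suc n)
    from step[of "D / of_int p ^ n", OF this] show ?case by (simp add: mult.commute)
  qed
  from this[of _ e] have "D = 0" using w(2) by (intro p_integral_infinitely_divisible) simp
  with bounded(1) show False by simp
qed


text \<open>
  The multiple by \<open>p ^ t\<close> is primitive at \<open>p\<close>, and \<open>e\<close> is its degree modulo \<open>p\<close>; the leading
  coefficient \<open>p ^ t\<close> vanishes modulo \<open>p\<close>, which gives \<open>e < d\<close>.
\<close>
lemma primitive_multiple: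
  fixes c :: "nat \<Rightarrow> rat"
  assumes monic: "c d = 1" and "\<exists>i\<le>d. \<not> p_integral p (c i)"
  obtains t e where "e < d" "\<And>i. i \<le> d \<Longrightarrow> p_integral p (of_int p ^ t * c i)"
    "\<not> p_integral p (of_int p ^ t * c e / of_int p)"
    "\<And>i. e < i \<Longrightarrow> i \<le> d \<Longrightarrow> p_integral p (of_int p ^ t * c i / of_int p)"
proof -
  have p0: "(of_int p :: rat) \<noteq> 0" using p by auto
  let ?P = "\<lambda>t. \<forall>i\<le>d. p_integral p (of_int p ^ t * c i)"
  obtain s where s: "\<And>i. p_integral p (of_int p ^ s i * c i)"
    using choice[of "\<lambda>i t. p_integral p (of_int p ^ t * c i)"] p_integral_scaled by auto
  have "s i \<le> Max (s ` {..d})" if "i \<le> d" for i using that by simp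
  then have "?P (Max (s ` {..d}))" using p_integral_scaled_mono[OF s] by blast
  then have t: "?P (LEAST t. ?P t)" by (rule LeastI)
  define t where "t = (LEAST t. ?P t)"
  have "t \<noteq> 0" using t assms(2) unfolding t_def[symmetric] by (metis mult_1 power_0)
  then have "\<not> ?P (t - 1)" unfolding t_def by (intro not_less_Least) simp
  moreover have div: "of_int p ^ t * x / of_int p = of_int p ^ (t - 1) * x" for x :: rat
    using \<open>t \<noteq> 0\<close> p0 by (cases t) auto
  ultimately obtain i where i: "i \<le> d" "\<not> p_integral p (of_int p ^ t * c i / of_int p)" by auto
  define E where "E = {i. i \<le> d \<and> \<not> p_integral p (of_int p ^ t * c i / of_int p)}"
  have E: "finite E" "E \<noteq> {}" using i by (auto simp: E_def)
  have "d \<notin> E"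
    using p_integral_of_int[of "p ^ (t - 1)"] by (simp add: E_def div monic)
  show ?thesis
  proof (rule that[of "Max E" t])
    show "Max E < d" using Max_in[OF E] \<open>d \<notin> E\<close> unfolding E_def
      by (metis (mono_tags, lifting) le_neq_implies_less mem_Collect_eq)
    show "p_integral p (of_int p ^ t * c i)" if "i \<le> d" for i using t that by (simp add: t_def)
    show "\<not> p_integral p (of_int p ^ t * c (Max E) / of_int p)" using Max_in[OF E] by (simp add: E_def)
    show "p_integral p (of_int p ^ t * c i / of_int p)" if "Max E < i" "i \<le> d" for i
    proof -
      have "i \<notin> E" using Max_ge[OF E(1), of i] that(1) by auto
      then show ?thesis using that(2) by (simp add: E_def)
    qed
  qed
qed

end

section \<open>Residues\<close>

lemma residue_props:
  assumes m: "m > 1" and q: "q = of_int a / of_int b" and b: "coprime b m"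
  shows residue_range: "0 \<le> residue m q" "residue m q < m"
    and residue_cong: "[residue m q * b = a] (mod m)"
proof -
  interpret residues m "residue_ring m" using m by unfold_locales
  let ?n = "fst (quotient_of q)" and ?d = "denom q"
  have "b \<noteq> 0" using b m by auto
  have "of_int a / of_int b = of_int ?n / (of_int ?d :: rat)" using q rat_eq_denom[of q] by metis
  then have "of_int (a * ?d) = (of_int (?n * b) :: rat)"
    using \<open>b \<noteq> 0\<close> denom_pos[of q] by (simp add: field_simps)
  then have cross: "a * ?d = ?n * b" by (simp only: of_int_eq_iff)
  have "?d dvd ?n * b" using cross by (metis dvd_triv_right)
  then have "?d dvd b" using coprime_denom[of q] by (metis coprime_commute coprime_dvd_mult_right_iff)
  then have d: "coprime ?d m" using b by (meson coprime_divisors dvd_refl)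
  let ?u = "inv\<^bsub>residue_ring m\<^esub> (?d mod m)"
  have unit: "?d mod m \<in> Units (residue_ring m)" using mod_in_res_units[OF m d] .
  have "?u \<otimes>\<^bsub>residue_ring m\<^esub> (?d mod m) = \<one>\<^bsub>residue_ring m\<^esub>" using Units_l_inv[OF unit] .
  then have u: "[?u * ?d = 1] (mod m)"
    using m by (simp add: res_mult_eq res_one_eq cong_def mod_simps)
  have r: "residue m q = (?n * ?u) mod m" by (simp add: residue_def res_mult_eq mod_simps)
  then show "0 \<le> residue m q" "residue m q < m" using m by simp_all
  have "[residue m q * b * ?d = ?n * ?u * b * ?d] (mod m)"
    by (intro cong_mult cong_refl) (simp add: r)
  also have "?n * ?u * b * ?d = (?n * b) * (?u * ?d)" by (simp add: mult_ac)
  also have "[\<dots> = (?n * b) * 1] (mod m)" by (intro cong_mult cong_refl u)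
  also have "(?n * b) * 1 = a * ?d" using cross by simp
  finally show "[residue m q * b = a] (mod m)" using d by (simp add: cong_mult_rcancel)
qed

lemma residue_eqI:
  assumes m: "m > 1" and q: "q = of_int a / of_int b" and b: "coprime b m"
    and x: "0 \<le> x" "x < m" "[x * b = a] (mod m)"
  shows "residue m q = x"
proof -
  have "[residue m q * b = x * b] (mod m)"
    using residue_cong[OF m q b] x(3) cong_sym cong_trans by blast
  then have "[residue m q = x] (mod m)" using b by (simp add: cong_mult_rcancel)
  then show ?thesis using residue_range[OF m q b] x by (simp add: cong_def)
qed

lemma residue_of_int: "m > 1 \<Longrightarrow> residue m (of_int a) = a mod m"
  by (rule residue_eqI[where b = 1 and a = a]) (auto simp: cong_def)

lemma residue_0: "m > 1 \<Longrightarrow> residue m 0 = 0" and residue_1: "m > 1 \<Longrightarrow> residue m 1 = 1"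
  using residue_of_int[of m 0] residue_of_int[of m 1] by simp_all

context
  fixes m :: int and x y :: rat
  assumes m: "m > 1" and x: "coprime m (denom x)" and y: "coprime m (denom y)"
begin

lemma residue_add: "residue m (x + y) = (residue m x + residue m y) mod m"
proof (rule residue_eqI[OF m])
  let ?a = "fst (quotient_of x)" and ?c = "fst (quotient_of y)"
  show "x + y = of_int (?a * denom y + ?c * denom x) / of_int (denom x * denom y)"
    using rat_eq_denom[of x] rat_eq_denom[of y] denom_pos[of x] denom_pos[of y] 
    by (simp add: add_frac_eq) (metis add_frac_eq less_irrefl mult.commute of_int_0_eq_iff)
  show "coprime (denom x * denom y) m" using x y by (simp add: coprime_commute)
  have "[residue m x * denom x = ?a] (mod m)" "[residue m y * denom y = ?c] (mod m)"
    using residue_cong[OF m rat_eq_denom] x y by (simp_all add: coprime_commute)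
  then have "[(residue m x * denom x) * denom y + (residue m y * denom y) * denom x
      = ?a * denom y + ?c * denom x] (mod m)" by (intro cong_add cong_mult cong_refl)
  moreover have "[(residue m x + residue m y) mod m * (denom x * denom y)
      = (residue m x + residue m y) * (denom x * denom y)] (mod m)"
    by (intro cong_mult cong_refl) simp
  ultimately show "[(residue m x + residue m y) mod m * (denom x * denom y) = ?a * denom y + ?c * denom x] (mod m)"
    by (auto simp: algebra_simps intro: cong_trans)
qed (use m in auto)

lemma residue_mult: "residue m (x * y) = (residue m x * residue m y) mod m"
proof (rule residue_eqI[OF m])
  let ?a = "fst (quotient_of x)" and ?c = "fst (quotient_of y)"
  show "x * y = of_int (?a * ?c) / of_int (denom x * denom y)"
    using rat_eq_denom[of x] rat_eq_denom[of y] by (metis of_int_mult times_divide_times_eq)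
  show "coprime (denom x * denom y) m" using x y by (simp add: coprime_commute)
  have "[residue m x * denom x = ?a] (mod m)" "[residue m y * denom y = ?c] (mod m)"
    using residue_cong[OF m rat_eq_denom] x y by (simp_all add: coprime_commute)
  then have "[(residue m x * denom x) * (residue m y * denom y) = ?a * ?c] (mod m)"
    by (rule cong_mult)
  moreover have "[(residue m x * residue m y) mod m * (denom x * denom y)
      = (residue m x * residue m y) * (denom x * denom y)] (mod m)"
    by (intro cong_mult cong_refl) simp
  ultimately show "[(residue m x * residue m y) mod m * (denom x * denom y) = ?a * ?c] (mod m)"
    by (auto simp: algebra_simps intro: cong_trans)
qed (use m in auto)

end

lemma p_integral_coprime: "Factorial_Ring.prime p \<Longrightarrow> p_integral p q \<longleftrightarrow> coprime p (denom q)"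
  unfolding p_integral_def using prime_imp_coprime[of p "denom q"]
  by (metis coprime_absorb_left not_prime_unit)

lemma residue_eq_0_iff:
  assumes p: "Factorial_Ring.prime p" and q: "p_integral p q"
  shows "residue p q = 0 \<longleftrightarrow> p_integral p (q / of_int p)"
proof -
  have p1: "p > 1" using p prime_gt_1_int by blast
  have cop: "coprime b p" if "\<not> p dvd b" for b using that p by (metis coprime_commute prime_imp_coprime)
  show ?thesis
  proof
    assume z: "residue p q = 0"
    obtain a b where ab: "q = of_int a / of_int b" "\<not> p dvd b" "b \<noteq> 0" using q by (rule p_integralE)
    from residue_cong[OF p1 ab(1) cop[OF ab(2)]] z have "p dvd a"
      by (simp add: cong_sym_eq[of 0] cong_0_iff)
    then obtain c where "a = p * c" by blast
    then have "q / of_int p = of_int c / of_int b" using ab p1 by simp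
    then show "p_integral p (q / of_int p)" by (rule p_integralI[OF p ab(2)])
  next
    assume "p_integral p (q / of_int p)"
    then obtain a b where ab: "q / of_int p = of_int a / of_int b" "\<not> p dvd b" "b \<noteq> 0" by (rule p_integralE)
    then have "q = of_int (p * a) / of_int b" using p1 by (simp add: field_simps)
    then show "residue p q = 0" using ab(2) p1 cop
      by (intro residue_eqI[where a = "p * a" and b = b]) (auto simp: cong_def)
  qed
qed

section \<open>Chinese remaindering\<close>

lemma crt_eqI:
  assumes "coprime m p" "x \<in> {0..<p * m}" "[x = a] (mod m)" "[x = b] (mod p)"
  shows "crt m a p b = x"
  unfolding crt_def
proof (rule the_equality)
  fix y assume y: "y \<in> {0..<p * m} \<and> [y = a] (mod m) \<and> [y = b] (mod p)"
  have "p dvd y - x" "m dvd y - x"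
    using y assms(3,4) by (meson cong_iff_dvd_diff cong_sym cong_trans)+
  then have "p * m dvd y - x" by (rule divides_mult) (use assms(1) in \<open>simp add: coprime_commute\<close>)
  then have "[y = x] (mod p * m)" by (simp add: cong_iff_dvd_diff)
  then show "y = x" using y assms(2) by (simp add: cong_def)
qed (use assms in simp)

lemma crt_range:
  assumes "coprime m p" "m > 1" "p > 1"
  shows "crt m a p b \<in> {0..<p * m}"
proof -
  obtain x where x: "[x = a] (mod m)" "[x = b] (mod p)"
    using binary_chinese_remainder_int[OF assms(1)] by blast
  have "crt m a p b = x mod (p * m)"
  proof (rule crt_eqI[OF assms(1)])
    show "x mod (p * m) \<in> {0..<p * m}" using assms by simp
    show "[x mod (p * m) = a] (mod m)" "[x mod (p * m) = b] (mod p)"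
      using x by (simp_all add: cong_def mod_mod_cancel)
  qed
  then show ?thesis using assms by simp
qed

lemma crt_residue:
  assumes "coprime m p" "m > 1" "p > 1" "coprime m (denom q)" "coprime p (denom q)"
  shows "crt m (residue m q) p (residue p q) = residue (p * m) q"
proof (rule crt_eqI[OF assms(1)])
  have pm: "p * m > 1" using assms(2,3) by (simp add: less_1_mult)
  have c: "coprime (denom q) (p * m)" "coprime (denom q) m" "coprime (denom q) p"
    using assms by (simp_all add: coprime_commute)
  note r = residue_range[OF _ rat_eq_denom] residue_cong[OF _ rat_eq_denom]
  show "residue (p * m) q \<in> {0..<p * m}" using r(1,2)[OF pm c(1)] by simp
  have big: "[residue (p * m) q * denom q = fst (quotient_of q)] (mod p * m)" using r(3)[OF pm c(1)] .
  have "[residue (p * m) q * denom q = residue m q * denom q] (mod m)"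
    using cong_dvd_modulus[OF big, of m] r(3)[OF assms(2) c(2)] cong_trans cong_sym dvd_triv_right by blast
  then show "[residue (p * m) q = residue m q] (mod m)" using c(2) by (simp add: cong_mult_rcancel)
  have "[residue (p * m) q * denom q = residue p q * denom q] (mod p)"
    using cong_dvd_modulus[OF big, of p] r(3)[OF assms(3) c(3)] cong_trans cong_sym dvd_triv_left by blast
  then show "[residue (p * m) q = residue p q] (mod p)" using c(3) by (simp add: cong_mult_rcancel)
qed


section \<open>Polynomial rings as homomorphic images\<close>


text \<open>
  A homomorphism \<open>\<pi>\<close> from a subring \<open>S\<close> of the rational numbers onto \<open>R\<close> makes the polynomial ring over
  \<open>R\<close> an image \<open>\<phi>\<close> of the polynomials over \<open>S\<close>, from which it inherits the ring axioms. The two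
  instances are \<open>\<pi> = id\<close> on the rational numbers, and reduction modulo \<open>p\<close> on the \<open>p\<close>-integral numbers.
\<close>
locale coeff_map =
  fixes S :: "rat set" and R :: "('a, 'm) ring_scheme" (structure) and \<pi> :: "rat \<Rightarrow> 'a"
  assumes base_cring: "cring R"
    and S_0: "0 \<in> S" and S_1: "1 \<in> S" and S_uminus: "x \<in> S \<Longrightarrow> - x \<in> S"
    and S_add: "x \<in> S \<Longrightarrow> y \<in> S \<Longrightarrow> x + y \<in> S"
    and S_mult: "x \<in> S \<Longrightarrow> y \<in> S \<Longrightarrow> x * y \<in> S"
    and \<pi>_1: "\<pi> 1 = \<one>"
    and \<pi>_add: "x \<in> S \<Longrightarrow> y \<in> S \<Longrightarrow> \<pi> (x + y) = \<pi> x \<oplus> \<pi> y"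
    and \<pi>_mult: "x \<in> S \<Longrightarrow> y \<in> S \<Longrightarrow> \<pi> (x * y) = \<pi> x \<otimes> \<pi> y"
    and \<pi>_image: "\<pi> ` S = carrier R"
begin

sublocale base: cring R by (rule base_cring)

lemma \<pi>_closed: "x \<in> S \<Longrightarrow> \<pi> x \<in> carrier R"
  using \<pi>_image by blast

lemma \<pi>_0: "\<pi> 0 = \<zero>"
  using \<pi>_add[OF S_0 S_0] \<pi>_closed[OF S_0] base.add.l_cancel_one'[of "\<pi> 0" "\<pi> 0"] by simp

lemma S_sum: "(\<And>k. k \<in> K \<Longrightarrow> f k \<in> S) \<Longrightarrow> sum f K \<in> S"
  by (induction K rule: infinite_finite_induct) (auto intro: S_0 S_add)

lemma \<pi>_sum:
  "finite K \<Longrightarrow> (\<And>k. k \<in> K \<Longrightarrow> f k \<in> S) \<Longrightarrow> \<pi> (sum f K) = (\<Oplus>k\<in>K. \<pi> (f k))"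
proof (induction K rule: finite_induct)
  case (insert k K)
  then show ?case using S_sum[of K f] by (simp add: \<pi>_add \<pi>_closed Pi_def)
qed (simp add: \<pi>_0)

definition SP :: "('v multiset \<Rightarrow>\<^sub>0 rat) set"
  where "SP = {a. \<forall>t. lookup a t \<in> S}"

definition \<phi> :: "('v multiset \<Rightarrow>\<^sub>0 rat) \<Rightarrow> 'v multiset \<Rightarrow> 'a"
  where "\<phi> a = (\<lambda>t. \<pi> (lookup a t))"

lemma SP_0: "0 \<in> SP" and SP_1: "1 \<in> SP"
  by (simp_all add: SP_def S_0 S_1 lookup_one when_def)

lemma SP_add: "a \<in> SP \<Longrightarrow> b \<in> SP \<Longrightarrow> a + b \<in> SP"
  and SP_uminus: "a \<in> SP \<Longrightarrow> - a \<in> SP"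
  by (simp_all add: SP_def lookup_add S_add S_uminus)

lemma SP_diff: "a \<in> SP \<Longrightarrow> b \<in> SP \<Longrightarrow> a - b \<in> SP"
  using SP_add[of a "- b"] SP_uminus[of b] by simp

lemma SP_mult: "a \<in> SP \<Longrightarrow> b \<in> SP \<Longrightarrow> a * b \<in> SP"
  by (auto simp: SP_def lookup_mult_sum intro!: S_sum S_mult)

lemma SP_single: "c \<in> S \<Longrightarrow> single t c \<in> SP"
  by (simp add: SP_def lookup_single when_def S_0)

lemma SP_power: "a \<in> SP \<Longrightarrow> a ^ n \<in> SP"
  by (induction n) (auto intro: SP_1 SP_mult)

lemma SP_sum: "(\<And>k. k \<in> K \<Longrightarrow> f k \<in> SP) \<Longrightarrow> sum f K \<in> SP"
  by (induction K rule: infinite_finite_induct) (auto intro: SP_0 SP_add)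

lemma \<phi>_closed: "a \<in> SP \<Longrightarrow> \<phi> a \<in> carrier (mpoly_ring R)"
proof -
  assume a: "a \<in> SP"
  have "supp R (\<phi> a) \<subseteq> keys a" by (auto simp: supp_def \<phi>_def in_keys_iff \<pi>_0)
  then have "finite (supp R (\<phi> a))" by (rule finite_subset) simp
  then show ?thesis using a \<pi>_closed by (auto simp: mpoly_ring_def \<phi>_def SP_def)
qed

lemma \<phi>_surj: "carrier (mpoly_ring R) \<subseteq> \<phi> ` SP"
proof
  fix h :: "'v multiset \<Rightarrow> 'a" assume h: "h \<in> carrier (mpoly_ring R)"
  define c where "c t = (if h t = \<zero> then 0 else SOME q. q \<in> S \<and> \<pi> q = h t)" for t
  have "\<exists>q. q \<in> S \<and> \<pi> q = h t" for t
    using h \<pi>_image by (auto simp: mpoly_ring_def image_subset_iff image_iff) (metis imageE)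
  then have c: "c t \<in> S \<and> \<pi> (c t) = h t" for t
    using someI_ex[of "\<lambda>q. q \<in> S \<and> \<pi> q = h t"] by (auto simp: c_def S_0 \<pi>_0)
  have "{t. c t \<noteq> 0} \<subseteq> supp R h" by (auto simp: c_def supp_def)
  then have "finite {t. c t \<noteq> 0}" using h finite_subset by (auto simp: mpoly_ring_def)
  then have "lookup (Abs_poly_mapping c) = c" by simp
  then have "Abs_poly_mapping c \<in> SP" "\<phi> (Abs_poly_mapping c) = h" using c by (auto simp: SP_def \<phi>_def)
  then show "h \<in> \<phi> ` SP" by blast
qed

lemma \<phi>_image: "\<phi> ` SP = carrier (mpoly_ring R)"
  using \<phi>_surj \<phi>_closed by blast

lemma \<phi>_add: "a \<in> SP \<Longrightarrow> b \<in> SP \<Longrightarrow> \<phi> (a + b) = \<phi> a \<oplus>\<^bsub>mpoly_ring R\<^esub> \<phi> b"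
  by (simp add: \<phi>_def mpoly_ring_def lookup_add SP_def \<pi>_add)

lemma \<phi>_mult: "a \<in> SP \<Longrightarrow> b \<in> SP \<Longrightarrow> \<phi> (a * b) = \<phi> a \<otimes>\<^bsub>mpoly_ring R\<^esub> \<phi> b"
proof -
  assume ab: "a \<in> SP" "b \<in> SP"
  have "\<phi> (a * b) t = (\<Oplus>s\<in>{s. s \<subseteq># t}. \<phi> a s \<otimes> \<phi> b (t - s))" for t
  proof -
    have "\<phi> (a * b) t = (\<Oplus>s\<in>{s. s \<subseteq># t}. \<pi> (lookup a s * lookup b (t - s)))"
      unfolding \<phi>_def lookup_mult_sum
      by (rule \<pi>_sum[OF finite_submultisets]) (use ab in \<open>simp add: SP_def S_mult\<close>)
    also have "\<dots> = (\<Oplus>s\<in>{s. s \<subseteq># t}. \<phi> a s \<otimes> \<phi> b (t - s))"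
      by (rule base.finsum_cong') (use ab in \<open>auto simp: SP_def \<phi>_def \<pi>_mult \<pi>_closed\<close>)
    finally show ?thesis .
  qed
  then show ?thesis by (auto simp: mpoly_ring_def)
qed

lemma \<phi>_0: "\<phi> 0 = \<zero>\<^bsub>mpoly_ring R\<^esub>" and \<phi>_1: "\<phi> 1 = \<one>\<^bsub>mpoly_ring R\<^esub>"
  by (simp_all add: \<phi>_def mpoly_ring_def \<pi>_0 \<pi>_1 lookup_one when_def fun_eq_iff)

lemma \<phi>_single: "\<phi> (single {#} c) = mpoly_const R (\<pi> c)"
  by (simp add: \<phi>_def mpoly_const_def lookup_single when_def fun_eq_iff \<pi>_0)

lemma cring_mpoly: "cring (mpoly_ring R :: ('v multiset \<Rightarrow> 'a) ring)"
proof -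
  define A :: "('v multiset \<Rightarrow>\<^sub>0 rat) ring" where "A = \<lparr>carrier = SP, monoid.mult = (*), one = 1, ring.zero = 0, add = (+)\<rparr>"
  have A: "carrier A = SP" "monoid.mult A = (*)" "\<one>\<^bsub>A\<^esub> = 1" "\<zero>\<^bsub>A\<^esub> = 0" "add A = (+)"
    by (simp_all add: A_def)
  have ringA: "ring A"
  proof (rule ringI)
    show "abelian_group A"
    proof (rule abelian_groupI)
      fix a assume "a \<in> carrier A"
      then show "\<exists>b\<in>carrier A. b \<oplus>\<^bsub>A\<^esub> a = \<zero>\<^bsub>A\<^esub>"
        by (intro bexI[of _ "- a"]) (simp_all add: A SP_uminus)
    qed (auto simp: A SP_0 SP_add algebra_simps)
    show "Group.monoid A"
      by (rule monoidI) (auto simp: A SP_1 SP_mult mult.assoc)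
  qed (auto simp: A algebra_simps)
  have hom: "\<phi> \<in> ring_hom A (mpoly_ring R)"
    by (rule ring_hom_memI) (simp_all add: A \<phi>_closed \<phi>_mult \<phi>_add \<phi>_1)
  have "mpoly_ring R\<lparr>carrier := \<phi> ` carrier A, zero := \<phi> \<zero>\<^bsub>A\<^esub>\<rparr> = mpoly_ring R"
    by (simp add: A \<phi>_image \<phi>_0)
  then have ring: "ring (mpoly_ring R :: ('v multiset \<Rightarrow> 'a) ring)"
    using ring.ring_hom_imp_img_ring[OF ringA hom] by simp
  have comm: "x \<otimes>\<^bsub>mpoly_ring R\<^esub> y = y \<otimes>\<^bsub>mpoly_ring R\<^esub> x"
    if xy: "x \<in> carrier (mpoly_ring R)" "y \<in> carrier (mpoly_ring R)" for x y :: "'v multiset \<Rightarrow> 'a"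
  proof -
    obtain a b where "a \<in> SP" "b \<in> SP" "x = \<phi> a" "y = \<phi> b" using xy \<phi>_image by (metis imageE)
    then show ?thesis by (metis \<phi>_mult mult.commute)
  qed
  show ?thesis
    by (intro cring.intro ring comm_monoid.intro comm_monoid_axioms.intro comm ring.is_monoid)
qed

lemma \<phi>_power:
  fixes a :: "'v multiset \<Rightarrow>\<^sub>0 rat"
  shows "a \<in> SP \<Longrightarrow> \<phi> (a ^ n) = \<phi> a [^]\<^bsub>mpoly_ring R\<^esub> n"
proof (induction n)
  case (Suc n)
  interpret M: cring "mpoly_ring R :: ('v multiset \<Rightarrow> 'a) ring" by (rule cring_mpoly)
  have "\<phi> (a ^ Suc n) = \<phi> a \<otimes>\<^bsub>mpoly_ring R\<^esub> \<phi> (a ^ n)"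
    unfolding power_Suc by (rule \<phi>_mult[OF Suc.prems SP_power[OF Suc.prems]])
  also have "\<dots> = \<phi> (a ^ n) \<otimes>\<^bsub>mpoly_ring R\<^esub> \<phi> a"
    by (intro M.m_comm \<phi>_closed SP_power Suc.prems)
  finally show ?case using Suc.IH[OF Suc.prems] by simp
qed (simp add: \<phi>_1)

lemma \<phi>_sum:
  fixes f :: "'k \<Rightarrow> 'v multiset \<Rightarrow>\<^sub>0 rat"
  assumes "finite K" "\<And>k. k \<in> K \<Longrightarrow> f k \<in> SP"
  shows "\<phi> (sum f K) = (\<Oplus>\<^bsub>mpoly_ring R\<^esub>k\<in>K. \<phi> (f k))"
proof -
  interpret M: cring "mpoly_ring R :: ('v multiset \<Rightarrow> 'a) ring" by (rule cring_mpoly)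
  show ?thesis
    using assms
  proof (induction K rule: finite_induct)
    case (insert k K)
    then show ?case using SP_sum[of K f] by (simp add: \<phi>_add \<phi>_closed Pi_def)
  qed (simp add: \<phi>_0)
qed

lemma const_hom: "mpoly_const R \<in> ring_hom R (mpoly_ring R)"
proof (rule ring_hom_memI)
  fix x y assume "x \<in> carrier R" "y \<in> carrier R"
  then obtain c d where cd: "c \<in> S" "d \<in> S" "x = \<pi> c" "y = \<pi> d" using \<pi>_image by (metis imageE)
  show "mpoly_const R x \<in> carrier (mpoly_ring R)"
    unfolding cd(3) \<phi>_single[symmetric] by (rule \<phi>_closed[OF SP_single[OF cd(1)]])
  show "mpoly_const R (x \<otimes> y) = mpoly_const R x \<otimes>\<^bsub>mpoly_ring R\<^esub> mpoly_const R y"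
    unfolding cd(3,4) \<pi>_mult[OF cd(1,2), symmetric] \<phi>_single[symmetric]
      \<phi>_mult[OF SP_single[OF cd(1)] SP_single[OF cd(2)], symmetric] by (simp add: mult_single)
  show "mpoly_const R (x \<oplus> y) = mpoly_const R x \<oplus>\<^bsub>mpoly_ring R\<^esub> mpoly_const R y"
    unfolding cd(3,4) \<pi>_add[OF cd(1,2), symmetric] \<phi>_single[symmetric]
      \<phi>_add[OF SP_single[OF cd(1)] SP_single[OF cd(2)], symmetric] by (simp add: single_add)
next
  show "mpoly_const R \<one> = \<one>\<^bsub>mpoly_ring R\<^esub>"
    unfolding \<pi>_1[symmetric] \<phi>_single[symmetric] using \<phi>_1 by simp
qed

lemma eval_\<phi>:
  fixes F :: "'v multiset \<Rightarrow>\<^sub>0 rat"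
  assumes F: "F \<in> SP" and h: "\<And>i. h i \<in> S" and H: "H \<in> carrier (UP R)" "\<And>i. H i = \<pi> (h i)"
    and n: "\<And>i. i > n \<Longrightarrow> H i = \<zero>"
  shows "UnivPoly.eval R (mpoly_ring R) (mpoly_const R) (\<phi> F) H = \<phi> (\<Sum>i\<le>n. smul (h i) (F ^ i))"
proof -
  interpret M: cring "mpoly_ring R :: ('v multiset \<Rightarrow> 'a) ring" by (rule cring_mpoly)
  have UP: "UP_ring R" by (rule UP_ring.intro) (rule base.ring_axioms)
  have co: "up_ring.coeff (UP R) H i = H i" for i using H(1) by (simp add: UP_def)
  have deg: "deg R H \<le> n" using n H(1) by (intro UP_ring.deg_aboveI[OF UP]) (simp_all add: co)
  let ?t = "\<lambda>i. mpoly_const R (H i) \<otimes>\<^bsub>mpoly_ring R\<^esub> \<phi> F [^]\<^bsub>mpoly_ring R\<^esub> i"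
  have t: "?t i = \<phi> (smul (h i) (F ^ i))" for i
    unfolding H(2) \<phi>_single[symmetric] \<phi>_power[OF F, symmetric]
    by (rule \<phi>_mult[OF SP_single[OF h] SP_power[OF F], symmetric])
  have SPt: "smul (h i) (F ^ i) \<in> SP" for i using F h by (intro SP_mult SP_single SP_power)
  have cl: "?t i \<in> carrier (mpoly_ring R)" for i unfolding t by (rule \<phi>_closed[OF SPt])
  have "UnivPoly.eval R (mpoly_ring R) (mpoly_const R) (\<phi> F) H = (\<Oplus>\<^bsub>mpoly_ring R\<^esub>i\<in>{..deg R H}. ?t i)"
    by (simp add: UP.eval_on_carrier[OF H(1)] co)
  also have "\<dots> = (\<Oplus>\<^bsub>mpoly_ring R\<^esub>i\<in>{..n}. ?t i)"
  proof (rule M.add.finprod_mono_neutral_cong_left)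
    fix i assume "i \<in> {..n} - {..deg R H}"
    then have "H i = \<zero>" using UP_ring.deg_aboveD[OF UP _ H(1), of i] by (simp add: co)
    moreover have "mpoly_const R \<zero> = \<zero>\<^bsub>mpoly_ring R :: ('v multiset \<Rightarrow> 'a) ring\<^esub>" by (simp add: mpoly_const_def mpoly_ring_def)
    ultimately show "?t i = \<zero>\<^bsub>mpoly_ring R\<^esub>" using \<phi>_closed[OF F] by simp
  qed (use deg cl in auto)
  also have "\<dots> = \<phi> (\<Sum>i\<le>n. smul (h i) (F ^ i))"
    unfolding t by (rule \<phi>_sum[symmetric]) (simp_all add: SPt)
  finally show ?thesis .
qed

end

section \<open>Minimal polynomials\<close>

lemma coeff_UP: "h \<in> carrier (UP R) \<Longrightarrow> up_ring.coeff (UP R) h i = h i"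
  by (simp add: UP_def)

lemma zero_UP: "\<zero>\<^bsub>UP R\<^esub> = (\<lambda>_. \<zero>\<^bsub>R\<^esub>)"
  by (simp add: UP_def)

lemma zero_FactRing: "\<zero>\<^bsub>M Quot J\<^esub> = J"
  by (simp add: FactRing_def)

locale minimal_polynomial =
  fixes R :: "('a, 'm) ring_scheme" (structure) and J :: "('v multiset \<Rightarrow> 'a) set" and g :: "'v multiset \<Rightarrow> 'a"
  assumes base_field: "field R"
    and ideal_J: "ideal J (mpoly_ring R)"
    and mpoly_cring: "cring (mpoly_ring R :: ('v multiset \<Rightarrow> 'a) ring)"
    and const_ring_hom: "mpoly_const R \<in> ring_hom R (mpoly_ring R :: ('v multiset \<Rightarrow> 'a) ring)"
    and g_closed: "g \<in> carrier (mpoly_ring R)"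
begin

definition evM :: "(nat \<Rightarrow> 'a) \<Rightarrow> 'v multiset \<Rightarrow> 'a"
  where "evM = UnivPoly.eval R (mpoly_ring R) (mpoly_const R) g"

definition K :: "(nat \<Rightarrow> 'a) set"
  where "K = {h \<in> carrier (UP R). evM h \<in> J}"

lemma evM_hom: "evM \<in> ring_hom (UP R) (mpoly_ring R)"
  unfolding evM_def
  by (rule UP_pre_univ_prop.eval_ring_hom[OF UP_pre_univ_propI g_closed])
    (use base_field in \<open>simp add: field_def domain_def\<close>, (rule mpoly_cring const_ring_hom)+)

lemma kernel_eq: "a_kernel (UP R) (quot_ring R J) (subst_hom R g J) = K"
proof -
  interpret M: cring "mpoly_ring R :: ('v multiset \<Rightarrow> 'a) ring" by (rule mpoly_cring)
  interpret J: ideal J "mpoly_ring R" by (rule ideal_J)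
  interpret U: UP_domain R "UP R"
    using base_field by (simp add: UP_domain_def field_def)
  interpret Q: cring "quot_ring R J" by (rule J.quotient_is_cring[OF mpoly_cring])
  interpret q: ring_hom_cring "mpoly_ring R" "quot_ring R J" "(+>\<^bsub>mpoly_ring R\<^esub>) J"
    by (rule J.rcos_ring_hom_cring[OF mpoly_cring])
  have cc: "c \<in> carrier R \<Longrightarrow> mpoly_const R c \<in> carrier (mpoly_ring R :: ('v multiset \<Rightarrow> 'a) ring)" for c :: 'a
    using ring_hom_closed[OF const_ring_hom] .
  have "subst_hom R g J h = J +>\<^bsub>mpoly_ring R\<^esub> evM h" if h: "h \<in> carrier (UP R)" for h
  proof -
    have co: "up_ring.coeff (UP R) h i \<in> carrier R" for i using h by simp
    have "evM h = (\<Oplus>\<^bsub>mpoly_ring R\<^esub>i\<in>{..deg R h}. mpoly_const R (up_ring.coeff (UP R) h i) \<otimes>\<^bsub>mpoly_ring R\<^esub> g [^]\<^bsub>mpoly_ring R\<^esub> i)"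
      unfolding evM_def U.eval_on_carrier[OF h] ..
    then have "J +>\<^bsub>mpoly_ring R\<^esub> evM h = (\<Oplus>\<^bsub>quot_ring R J\<^esub>i\<in>{..deg R h}.
        J +>\<^bsub>mpoly_ring R\<^esub> (mpoly_const R (up_ring.coeff (UP R) h i) \<otimes>\<^bsub>mpoly_ring R\<^esub> g [^]\<^bsub>mpoly_ring R\<^esub> i))"
      using co cc g_closed by (simp add: q.hom_finsum Pi_def comp_def)
    also have "\<dots> = (\<Oplus>\<^bsub>quot_ring R J\<^esub>i\<in>{..deg R h}.
        quot_const R J (up_ring.coeff (UP R) h i) \<otimes>\<^bsub>quot_ring R J\<^esub> (J +>\<^bsub>mpoly_ring R\<^esub> g) [^]\<^bsub>quot_ring R J\<^esub> i)"
      using co cc g_closed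
      by (intro Q.finsum_cong') (auto simp: quot_const_def)
    also have "\<dots> = subst_hom R g J h" unfolding subst_hom_def U.eval_on_carrier[OF h] ..
    finally show ?thesis by simp
  qed
  moreover have "\<zero>\<^bsub>quot_ring R J\<^esub> = J" by (rule zero_FactRing)
  moreover have "J +>\<^bsub>mpoly_ring R\<^esub> x = J \<longleftrightarrow> x \<in> J" if "x \<in> carrier (mpoly_ring R)" for x
    using J.rcos_const_imp_mem[OF that] M.a_rcos_zero[OF ideal_J] by blast
  ultimately have "subst_hom R g J h = \<zero>\<^bsub>quot_ring R J\<^esub> \<longleftrightarrow> evM h \<in> J" if "h \<in> carrier (UP R)" for h
    using that ring_hom_closed[OF evM_hom that] by simp
  then show ?thesis
    unfolding a_kernel_def' K_def by (intro Collect_cong conj_cong refl)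
qed

lemma ideal_K: "ideal K (UP R)"
  unfolding K_def
proof (rule ring_hom_ring.ideal_vimage[OF ring_hom_ringI2[OF _ _ evM_hom] ideal_J])
  show "ring (mpoly_ring R :: ('v multiset \<Rightarrow> 'a) ring)" using mpoly_cring by (simp add: cring_def)
  show "ring (UP R)"
    using base_field by (intro UP_ring.UP_ring) (simp add: UP_ring_def field_def domain_def cring_def)
qed


text \<open>
  A monic element of least degree generates the kernel, by division with remainder, and the difference
  of two such elements has smaller degree.
\<close>
lemma min_poly_props:
  assumes "\<exists>h\<in>K. h \<noteq> \<zero>\<^bsub>UP R\<^esub>"
  shows min_poly_mem: "min_poly R g J \<in> K"
    and min_poly_monic: "min_poly R g J (deg R (min_poly R g J)) = \<one>"
    and min_poly_deg_le: "h \<in> K \<Longrightarrow> h \<noteq> \<zero>\<^bsub>UP R\<^esub> \<Longrightarrow> deg R (min_poly R g J) \<le> deg R h"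
    and min_poly_unique: "\<nu> \<in> K \<Longrightarrow> \<nu> (deg R (min_poly R g J)) = \<one> \<Longrightarrow>
      (\<And>i. i > deg R (min_poly R g J) \<Longrightarrow> \<nu> i = \<zero>) \<Longrightarrow> \<nu> = min_poly R g J"
proof -
  interpret base: field R by (rule base_field)
  interpret U: UP_domain R "UP R" by (rule UP_domain.intro) (rule base.domain_axioms)
  interpret K: ideal K "UP R" by (rule ideal_K)
  have KC: "h \<in> K \<Longrightarrow> h \<in> carrier (UP R)" for h by (rule K.Icarr)
  have co: "up_ring.coeff (UP R) h i = h i" if "h \<in> carrier (UP R)" for h i using that by (rule coeff_UP)
  define P where "P d \<longleftrightarrow> (\<exists>h\<in>K. h \<noteq> \<zero>\<^bsub>UP R\<^esub> \<and> deg R h = d)" for d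
  have "\<exists>d. P d" using assms by (auto simp: P_def)
  then have "P (LEAST d. P d)" by (rule LeastI_ex)
  then obtain h0 where h0: "h0 \<in> K" "h0 \<noteq> \<zero>\<^bsub>UP R\<^esub>" "deg R h0 = (LEAST d. P d)" by (auto simp: P_def)
  define d where "d = (LEAST d. P d)"
  have least: "d \<le> deg R h" if "h \<in> K" "h \<noteq> \<zero>\<^bsub>UP R\<^esub>" for h
    unfolding d_def using that by (intro Least_le) (auto simp: P_def)
  have small: "h = \<zero>\<^bsub>UP R\<^esub>" if h: "h \<in> K" "\<And>i. i \<ge> d \<Longrightarrow> h i = \<zero>" for h
  proof (rule ccontr)
    assume "h \<noteq> \<zero>\<^bsub>UP R\<^esub>"
    then have "up_ring.coeff (UP R) h (deg R h) \<noteq> \<zero>" using KC[OF h(1)] by (rule U.lcoeff_nonzero)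
    then show False using h(2)[OF least[OF h(1) \<open>h \<noteq> _\<close>]] co[OF KC[OF h(1)]] by simp
  qed
  have diff: "(h \<ominus>\<^bsub>UP R\<^esub> h') i = h i \<ominus> h' i" if "h \<in> carrier (UP R)" "h' \<in> carrier (UP R)" for h h' i
    using U.coeff_minus[OF that, of i] co that by simp
  have unique: "h = h'"
    if h: "h \<in> K" "h d = \<one>" "\<And>i. i > d \<Longrightarrow> h i = \<zero>"
      and h': "h' \<in> K" "h' d = \<one>" "\<And>i. i > d \<Longrightarrow> h' i = \<zero>" for h h'
  proof -
    have mem: "h \<ominus>\<^bsub>UP R\<^esub> h' \<in> K"
      using h(1) h'(1) K.a_closed K.a_inv_closed by (simp add: a_minus_def)
    have "(h \<ominus>\<^bsub>UP R\<^esub> h') i = \<zero>" if "i \<ge> d" for i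
    proof (cases "i = d")
      case True
      then show ?thesis
        using diff[OF KC[OF h(1)] KC[OF h'(1)], of i] h(2) h'(2) by (simp add: base.minus_eq base.r_neg)
    next
      case False
      then have "i > d" using that by simp
      then show ?thesis
        using diff[OF KC[OF h(1)] KC[OF h'(1)], of i] h(3)[of i] h'(3)[of i] by (simp add: base.minus_eq)
    qed
    then have "h \<ominus>\<^bsub>UP R\<^esub> h' = \<zero>\<^bsub>UP R\<^esub>" by (rule small[OF mem])
    then show ?thesis using KC[OF h(1)] KC[OF h'(1)] by (simp add: U.P.r_right_minus_eq)
  qed
  let ?lc = "up_ring.coeff (UP R) h0 d"
  have lc: "?lc \<in> carrier R" "?lc \<noteq> \<zero>"
    using h0 KC U.lcoeff_nonzero[OF h0(2) KC[OF h0(1)]] by (simp_all add: d_def)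
  then have unit: "?lc \<in> Units R" using base.field_Units by simp
  define \<mu> where "\<mu> = up_ring.monom (UP R) (inv ?lc) 0 \<otimes>\<^bsub>UP R\<^esub> h0"
  have ic: "inv ?lc \<in> carrier R" using unit by simp
  have \<mu>K: "\<mu> \<in> K" unfolding \<mu>_def using h0(1) ic by (intro K.I_l_closed) simp_all
  have \<mu>c: "\<mu> i = inv ?lc \<otimes> h0 i" for i
  proof -
    have "\<mu> = inv ?lc \<odot>\<^bsub>UP R\<^esub> h0" unfolding \<mu>_def by (rule U.monom_mult_is_smult[OF ic KC[OF h0(1)]])
    then have "up_ring.coeff (UP R) \<mu> i = inv ?lc \<otimes> up_ring.coeff (UP R) h0 i"
      using U.coeff_smult[OF ic KC[OF h0(1)], of i] by simp
    then show ?thesis unfolding co[OF KC[OF \<mu>K]] co[OF KC[OF h0(1)]] .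
  qed
  have \<mu>d: "\<mu> d = \<one>" using \<mu>c unit co[OF KC[OF h0(1)]] by simp
  have \<mu>z: "\<mu> i = \<zero>" if "i > d" for i
    using U.deg_aboveD[OF _ KC[OF h0(1)], of i] h0(3) that \<mu>c[of i] ic co[OF KC[OF h0(1)]] by (simp add: d_def)
  have \<mu>0: "\<mu> \<noteq> \<zero>\<^bsub>UP R\<^esub>"
    using \<mu>d base.one_not_zero by (metis zero_UP)
  have \<mu>deg: "deg R \<mu> = d"
    using least[OF \<mu>K \<mu>0] U.deg_aboveI[of d \<mu>] \<mu>z KC[OF \<mu>K] co by (simp add: le_antisym)
  have gen: "Idl\<^bsub>UP R\<^esub> {\<mu>} = K"
  proof
    show "Idl\<^bsub>UP R\<^esub> {\<mu>} \<subseteq> K" using \<mu>K by (intro U.P.genideal_minimal ideal_K) simp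
    show "K \<subseteq> Idl\<^bsub>UP R\<^esub> {\<mu>}"
    proof
      fix h assume h: "h \<in> K"
      obtain q r and k :: nat where qr: "q \<in> carrier (UP R)" "r \<in> carrier (UP R)"
        "up_ring.coeff (UP R) \<mu> (deg R \<mu>) [^] k \<odot>\<^bsub>UP R\<^esub> h = \<mu> \<otimes>\<^bsub>UP R\<^esub> q \<oplus>\<^bsub>UP R\<^esub> r"
        "r = \<zero>\<^bsub>UP R\<^esub> \<or> deg R r < deg R \<mu>"
        using U.long_div_theorem[OF KC[OF \<mu>K] KC[OF h] \<mu>0] by blast
      have "up_ring.coeff (UP R) \<mu> (deg R \<mu>) = \<one>" using \<mu>deg \<mu>d co[OF KC[OF \<mu>K]] by simp
      then have eq: "h = \<mu> \<otimes>\<^bsub>UP R\<^esub> q \<oplus>\<^bsub>UP R\<^esub> r" using qr(3) KC[OF h] by simp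
      have \<mu>q: "\<mu> \<otimes>\<^bsub>UP R\<^esub> q \<in> K" using K.I_r_closed[OF \<mu>K qr(1)] .
      have "r = \<ominus>\<^bsub>UP R\<^esub> (\<mu> \<otimes>\<^bsub>UP R\<^esub> q) \<oplus>\<^bsub>UP R\<^esub> h"
        unfolding eq by (rule U.P.r_neg1[OF KC[OF \<mu>q] qr(2), symmetric])
      then have rK: "r \<in> K" using K.a_closed[OF K.a_inv_closed[OF \<mu>q] h] by simp
      have "r = \<zero>\<^bsub>UP R\<^esub>" using qr(4) least[OF rK] \<mu>deg by (metis leD)
      then have "h = \<mu> \<otimes>\<^bsub>UP R\<^esub> q" using eq KC[OF \<mu>q] by simp
      moreover have "ideal (Idl\<^bsub>UP R\<^esub> {\<mu>}) (UP R)" using KC[OF \<mu>K] by (intro U.P.genideal_ideal) simp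
      ultimately show "h \<in> Idl\<^bsub>UP R\<^esub> {\<mu>}"
        using ideal.I_r_closed[OF _ U.P.genideal_self'[OF KC[OF \<mu>K]] qr(1)] by simp
    qed
  qed
  have min: "min_poly R g J = \<mu>"
    unfolding min_poly_def kernel_eq
  proof (rule the_equality)
    show "\<mu> \<in> carrier (UP R) \<and> \<mu> (deg R \<mu>) = \<one> \<and> Idl\<^bsub>UP R\<^esub> {\<mu>} = K"
      using KC[OF \<mu>K] \<mu>deg \<mu>d gen by simp
  next
    fix \<nu> assume \<nu>: "\<nu> \<in> carrier (UP R) \<and> \<nu> (deg R \<nu>) = \<one> \<and> Idl\<^bsub>UP R\<^esub> {\<nu>} = K"
    then have \<nu>K: "\<nu> \<in> K" using U.P.genideal_self' by blast
    have \<nu>0: "\<nu> \<noteq> \<zero>\<^bsub>UP R\<^esub>"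
      using \<nu> base.one_not_zero by (metis zero_UP)
    have "\<mu> \<in> PIdl\<^bsub>UP R\<^esub> \<nu>" using \<nu> \<mu>K U.P.cgenideal_eq_genideal by blast
    then obtain x where x: "x \<in> carrier (UP R)" "\<mu> = x \<otimes>\<^bsub>UP R\<^esub> \<nu>" by (auto simp: cgenideal_def)
    then have "x \<noteq> \<zero>\<^bsub>UP R\<^esub>" using \<mu>0 \<nu> by auto
    then have "deg R \<mu> = deg R x + deg R \<nu>"
      unfolding x(2) by (rule U.deg_mult[OF _ \<nu>0 x(1) KC[OF \<nu>K]])
    then have deg: "deg R \<nu> = d" using least[OF \<nu>K \<nu>0] \<mu>deg by linarith
    show "\<nu> = \<mu>"
    proof (rule unique[OF \<nu>K _ _ \<mu>K \<mu>d \<mu>z])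
      show "\<nu> d = \<one>" using \<nu> deg by blast
      show "\<nu> i = \<zero>" if "i > d" for i
        using U.deg_aboveD[of \<nu> i] co[OF KC[OF \<nu>K], of i] that deg KC[OF \<nu>K] by simp
    qed
  qed
  show "min_poly R g J \<in> K" "min_poly R g J (deg R (min_poly R g J)) = \<one>"
    using \<mu>K \<mu>d by (simp_all add: min \<mu>deg)
  show "h \<in> K \<Longrightarrow> h \<noteq> \<zero>\<^bsub>UP R\<^esub> \<Longrightarrow> deg R (min_poly R g J) \<le> deg R h"
    using least by (simp add: min \<mu>deg)
  show "\<nu> = min_poly R g J" if "\<nu> \<in> K" "\<nu> (deg R (min_poly R g J)) = \<one>"
    "\<And>i. i > deg R (min_poly R g J) \<Longrightarrow> \<nu> i = \<zero>"
    using unique[OF that(1) _ _ \<mu>K \<mu>d \<mu>z] that by (simp add: min \<mu>deg)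
qed

end


section \<open>Reduction of the ideal modulo a prime\<close>

lemma (in zero_dim_ideal) GB_divides: "t \<notin> std \<Longrightarrow> \<exists>g\<in>GB. LT g \<subseteq># t"
  using reduced_gb_GB unfolding std_def reduced_gb_def by blast

lemma (in zero_dim_ideal) GB_mem: "g \<in> GB \<Longrightarrow> g \<in> I" "g \<in> GB \<Longrightarrow> g \<noteq> 0" "g \<in> GB \<Longrightarrow> lookup g (LT g) = 1"
  using reduced_gb_GB unfolding reduced_gb_def by blast+


text \<open>
  The basis is monic and \<open>p\<close>-integral, so it rewrites a monomial as a \<open>p\<close>-integral combination of
  smaller ones without changing the value of \<open>L\<close>, until only standard monomials remain.
\<close>
lemma (in zero_dim_ideal) functional_integral:
  assumes p: "Factorial_Ring.prime p" and G: "\<And>g t. g \<in> GB \<Longrightarrow> p_integral p (lookup g t)"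
    and lin: "Vector_Spaces.linear smul (*) L" and L0: "\<And>a. a \<in> I \<Longrightarrow> L a = 0"
    and std: "\<And>b. b \<in> std \<Longrightarrow> p_integral p (D * L (single b 1))"
    and a: "\<And>t. p_integral p (lookup a t)"
  shows "p_integral p (D * L a)"
proof -
  interpret L: Vector_Spaces.linear smul "(*)" L by (rule lin)
  have Ls: "L (single t c) = c * L (single t 1)" for t c
    using L.scale[of c "single t 1"] by (simp add: mult_single)
  have mono: "p_integral p (D * L (single t 1))" for t
  proof (induction t rule: wf_induct_rule[OF ord_wf])
    case (1 t)
    show ?case
    proof (cases "t \<in> std")
      case False
      then obtain g where g: "g \<in> GB" "LT g \<subseteq># t" using GB_divides by blast
      define s where "s = t - LT g"
      have t: "t = s + LT g" using g(2) by (simp add: s_def)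
      let ?T = "keys g - {LT g}"
      have LTg: "LT g \<in> keys g" using LT_in_keys GB_mem(2)[OF g(1)] by blast
      have "single s 1 * g = single s 1 * (\<Sum>u\<in>keys g. single u (lookup g u))"
        by (simp flip: poly_mapping_monomial_sum)
      then have "single s 1 * g = (\<Sum>u\<in>keys g. single (s + u) (lookup g u))"
        by (simp add: sum_distrib_left mult_single)
      then have "0 = L (\<Sum>u\<in>keys g. single (s + u) (lookup g u))"
        using L0[OF mult_mem[OF GB_mem(1)[OF g(1)]], of "single s 1"] by simp
      also have "\<dots> = (\<Sum>u\<in>keys g. lookup g u * L (single (s + u) 1))"
        unfolding L.sum by (rule sum.cong) (simp_all add: Ls[of _ "lookup g _"])
      also have "\<dots> = L (single t 1) + (\<Sum>u\<in>?T. lookup g u * L (single (s + u) 1))"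
        using LTg GB_mem(3)[OF g(1)] t by (subst sum.remove[of _ "LT g"]) simp_all
      finally have Lt: "L (single t 1) = - (\<Sum>u\<in>?T. lookup g u * L (single (s + u) 1))"
        by (simp add: eq_neg_iff_add_eq_0)
      have "D * L (single t 1) = - (D * (\<Sum>u\<in>?T. lookup g u * L (single (s + u) 1)))"
        unfolding Lt by (rule mult_minus_right)
      also have "D * (\<Sum>u\<in>?T. lookup g u * L (single (s + u) 1)) =
          (\<Sum>u\<in>?T. lookup g u * (D * L (single (s + u) 1)))"
        unfolding sum_distrib_left by (rule sum.cong[OF refl], rule mult.left_commute)
      finally have DLt: "D * L (single t 1) = - (\<Sum>u\<in>?T. lookup g u * (D * L (single (s + u) 1)))" .
      show ?thesis
        unfolding DLt
      proof (rule p_integral_uminus[OF p], rule p_integral_sum[OF p], rule p_integral_mult[OF p])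
        fix u assume u: "u \<in> ?T"
        then have "(u, LT g) \<in> \<sigma>" using LT_max[OF GB_mem(2)[OF g(1)]] by blast
        then have "(s + u, t) \<in> \<sigma> - Id" using ord_add[of u "LT g" s] u t by simp
        then show "p_integral p (D * L (single (s + u) 1))" by (rule 1)
      qed (rule G[OF g(1)])
    next
      case True
      then show ?thesis by (rule std)
    qed
  qed
  have "a = (\<Sum>t\<in>keys a. single t (lookup a t))" by (rule poly_mapping_monomial_sum)
  then have "L a = (\<Sum>t\<in>keys a. L (single t (lookup a t)))" by (metis L.sum)
  also have "\<dots> = (\<Sum>t\<in>keys a. lookup a t * L (single t 1))"
    by (rule sum.cong) (simp_all add: Ls[of _ "lookup a _"])
  finally have La: "L a = (\<Sum>t\<in>keys a. lookup a t * L (single t 1))" .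
  have "D * L a = (\<Sum>t\<in>keys a. lookup a t * (D * L (single t 1)))"
    unfolding La sum_distrib_left by (rule sum.cong[OF refl], rule mult.left_commute)
  also have "p_integral p \<dots>" by (intro p_integral_sum[OF p] p_integral_mult[OF p] a mono)
  finally show ?thesis .
qed

lemma field_residue_ring: "Factorial_Ring.prime p \<Longrightarrow> field (residue_ring p)"
proof -
  assume p: "Factorial_Ring.prime p"
  then have "p > 0" by (rule prime_gt_0_int)
  then have eq: "p = int (nat p)" by simp
  have "Factorial_Ring.prime (nat p)"
    using p unfolding prime_int_nat_transfer[of p] by (rule conjunct2)
  then have "residues_prime (nat p)" by (rule residues_prime.intro)
  then show ?thesis by (subst eq) (rule residues_prime.is_field)
qed

lemma coeff_map_residue:
  assumes p: "Factorial_Ring.prime p"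
  shows "coeff_map {q. p_integral p q} (residue_ring p) (residue p)"
proof -
  have p1: "p > 1" using p prime_gt_1_int by blast
  interpret residues p "residue_ring p" using p1 by unfold_locales
  note cop = p_integral_coprime[OF p]
  show ?thesis
  proof
    show "residue p 1 = \<one>\<^bsub>residue_ring p\<^esub>" using residue_1[OF p1] by (simp add: res_one_eq)
  next
    fix x y assume "x \<in> {q. p_integral p q}" "y \<in> {q. p_integral p q}"
    then have xy: "coprime p (denom x)" "coprime p (denom y)" using cop by auto
    show "residue p (x + y) = residue p x \<oplus>\<^bsub>residue_ring p\<^esub> residue p y"
      using residue_add[OF p1 xy] by (simp add: res_add_eq)
    show "residue p (x * y) = residue p x \<otimes>\<^bsub>residue_ring p\<^esub> residue p y"
      using residue_mult[OF p1 xy] by (simp add: res_mult_eq)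
  next
    show "residue p ` {q. p_integral p q} = carrier (residue_ring p)"
    proof
      show "residue p ` {q. p_integral p q} \<subseteq> carrier (residue_ring p)"
        using residue_range[OF p1 rat_eq_denom] cop by (auto simp: res_carrier_eq coprime_commute)
      show "carrier (residue_ring p) \<subseteq> residue p ` {q. p_integral p q}"
      proof
        fix x assume "x \<in> carrier (residue_ring p)"
        then have "x = residue p (of_int x)" using residue_of_int[OF p1, of x] by (simp add: res_carrier_eq)
        then show "x \<in> residue p ` {q. p_integral p q}" using p_integral_of_int[OF p] by blast
      qed
    qed
  qed (auto intro: p_integral_0[OF p] p_integral_1[OF p] p_integral_uminus[OF p] p_integral_add[OF p] p_integral_mult[OF p])
qed

locale integral_basis = zero_dim_ideal \<sigma> I for \<sigma> and I :: "('v::finite multiset \<Rightarrow>\<^sub>0 rat) set" +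
  fixes p :: int
  assumes p: "Factorial_Ring.prime p" and GB_integral: "g \<in> GB \<Longrightarrow> p_integral p (lookup g t)"
begin

sublocale C: coeff_map "{q. p_integral p q}" "residue_ring p" "residue p"
  by (rule coeff_map_residue[OF p])

abbreviation Mp :: "('v multiset \<Rightarrow> int) ring" where "Mp \<equiv> mpoly_ring (residue_ring p)"

lemma GB_SP: "GB \<subseteq> C.SP"
  using GB_integral by (auto simp: C.SP_def)


text \<open>
  Reducing \<open>a\<close> to \<open>0\<close> by the monic basis never leaves the \<open>p\<close>-integral polynomials, so every
  reduction step can be read modulo \<open>p\<close>.
\<close>
lemma reduction_mem:
  assumes J: "ideal J Mp" "C.\<phi> ` GB \<subseteq> J" and a: "a \<in> I" "a \<in> C.SP"
  shows "C.\<phi> a \<in> J"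
proof -
  interpret Mp: cring Mp by (rule C.cring_mpoly)
  interpret J: ideal J Mp by (rule J)
  have \<phi>0: "C.\<phi> 0 \<in> J" unfolding C.\<phi>_0 by (rule J.zero_closed)
  have "\<forall>a. LT a = t \<longrightarrow> a \<in> I \<longrightarrow> a \<in> C.SP \<longrightarrow> C.\<phi> a \<in> J" for t
  proof (induction t rule: wf_induct_rule[OF ord_wf])
    case (1 t)
    show ?case
    proof (intro allI impI)
      fix a assume a: "LT a = t" "a \<in> I" "a \<in> C.SP"
      show "C.\<phi> a \<in> J"
      proof (cases "a = 0")
        case True
        then show ?thesis using \<phi>0 by simp
      next
        case False
        obtain g where g: "g \<in> GB" "LT g \<subseteq># t" using GB_divides LT_notin_std[OF a(2) False] a(1) by blast
        define s c where "s = t - LT g" and "c = lookup a t"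
        have t: "t = s + LT g" using g(2) by (simp add: s_def)
        define b where "b = single s c * g"
        have cS: "c \<in> {q. p_integral p q}" using a(3) by (simp add: C.SP_def c_def)
        have b: "b \<in> I" "b \<in> C.SP"
          using mult_mem[OF GB_mem(1)[OF g(1)]] C.SP_mult[OF C.SP_single[OF cS]] g(1) GB_SP
          by (auto simp: b_def)
        have \<phi>b: "C.\<phi> b \<in> J"
        proof -
          have "C.\<phi> b = C.\<phi> (single s c) \<otimes>\<^bsub>Mp\<^esub> C.\<phi> g"
            unfolding b_def using g(1) GB_SP by (intro C.\<phi>_mult C.SP_single[OF cS]) blast
          also have "\<dots> \<in> J"
            using g(1) J(2) by (intro J.I_l_closed C.\<phi>_closed C.SP_single[OF cS]) blast
          finally show ?thesis .
        qed
        have ab: "a - b \<in> I" "a - b \<in> C.SP" using diff_mem[OF a(2) b(1)] C.SP_diff[OF a(3) b(2)] .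
        have "C.\<phi> (a - b) \<in> J"
        proof (cases "a - b = 0")
          case True
          then show ?thesis using \<phi>0 by simp
        next
          case nz: False
          let ?u = "LT (a - b)"
          have u: "?u \<in> keys (a - b)" by (rule LT_in_keys[OF nz])
          have "lookup b t = c" using GB_mem(3)[OF g(1)] by (simp add: b_def t)
          then have "?u \<noteq> t" using u by (auto simp: in_keys_iff lookup_minus c_def)
          have "?u \<in> keys a \<or> ?u \<in> keys b" using u by (auto simp: in_keys_iff lookup_minus)
          moreover have "(u, t) \<in> \<sigma>" if "u \<in> keys b" for u
          proof -
            have c0: "c \<noteq> 0" using LT_in_keys[OF False] a(1) by (simp add: c_def in_keys_iff)
            obtain v where v: "v \<in> keys g" "u = s + v"
              using \<open>u \<in> keys b\<close> unfolding b_def keys_single_mult[OF c0] by blast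
            then show ?thesis using LT_max[OF GB_mem(2)[OF g(1)] v(1)] ord_add t by simp
          qed
          ultimately have "(?u, t) \<in> \<sigma>" using LT_max[OF False] a(1) by blast
          with \<open>?u \<noteq> t\<close> show ?thesis using 1[of ?u] ab by blast
        qed
        then have "C.\<phi> (a - b) \<oplus>\<^bsub>Mp\<^esub> C.\<phi> b \<in> J" using \<phi>b by (rule J.a_closed)
        then show ?thesis using C.\<phi>_add[OF ab(2) b(2)] by simp
      qed
    qed
  qed
  then show ?thesis using a by blast
qed

lemma image_ideal: "ideal (C.\<phi> ` (I \<inter> C.SP)) Mp"
proof -
  interpret Mp: cring Mp by (rule C.cring_mpoly)
  have sub: "C.\<phi> ` (I \<inter> C.SP) \<subseteq> carrier Mp" using C.\<phi>_closed by blast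
  have lmult: "x \<otimes>\<^bsub>Mp\<^esub> a \<in> C.\<phi> ` (I \<inter> C.SP)" if ax: "a \<in> C.\<phi> ` (I \<inter> C.SP)" "x \<in> carrier Mp" for a x
  proof -
    obtain b where b: "b \<in> I" "b \<in> C.SP" "a = C.\<phi> b" using ax(1) by blast
    obtain c where c: "c \<in> C.SP" "x = C.\<phi> c" using ax(2) C.\<phi>_image by blast
    have "x \<otimes>\<^bsub>Mp\<^esub> a = C.\<phi> (c * b)" using b c by (simp add: C.\<phi>_mult)
    moreover have "c * b \<in> I \<inter> C.SP" using mult_mem[OF b(1)] C.SP_mult[OF c(1) b(2)] by blast
    ultimately show ?thesis by blast
  qed
  have add: "a \<oplus>\<^bsub>Mp\<^esub> a' \<in> C.\<phi> ` (I \<inter> C.SP)"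
    if aa: "a \<in> C.\<phi> ` (I \<inter> C.SP)" "a' \<in> C.\<phi> ` (I \<inter> C.SP)" for a a'
  proof -
    obtain b b' where b: "b \<in> I" "b \<in> C.SP" "a = C.\<phi> b" "b' \<in> I" "b' \<in> C.SP" "a' = C.\<phi> b'" using aa by blast
    have "a \<oplus>\<^bsub>Mp\<^esub> a' = C.\<phi> (b + b')" using b by (simp add: C.\<phi>_add)
    moreover have "b + b' \<in> I \<inter> C.SP" using add_mem[OF b(1,4)] C.SP_add[OF b(2,5)] by blast
    ultimately show ?thesis by blast
  qed
  have zero: "\<zero>\<^bsub>Mp\<^esub> \<in> C.\<phi> ` (I \<inter> C.SP)"
    using C.\<phi>_0 zero_mem C.SP_0 by (metis IntI imageI)
  have neg: "\<ominus>\<^bsub>Mp\<^esub> a \<in> C.\<phi> ` (I \<inter> C.SP)" if "a \<in> C.\<phi> ` (I \<inter> C.SP)" for a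
  proof -
    have "a \<in> carrier Mp" using that sub by blast
    then have "\<ominus>\<^bsub>Mp\<^esub> a = (\<ominus>\<^bsub>Mp\<^esub> \<one>\<^bsub>Mp\<^esub>) \<otimes>\<^bsub>Mp\<^esub> a" by (simp add: Mp.l_minus)
    then show ?thesis using lmult[OF that, of "\<ominus>\<^bsub>Mp\<^esub> \<one>\<^bsub>Mp\<^esub>"] by simp
  qed
  show ?thesis
  proof (rule idealI[OF Mp.ring_axioms])
    show "subgroup (C.\<phi> ` (I \<inter> C.SP)) (add_monoid Mp)"
      by (rule Mp.add.subgroupI[OF sub _ neg add]) (use zero in blast)
    show "x \<otimes>\<^bsub>Mp\<^esub> a \<in> C.\<phi> ` (I \<inter> C.SP)" "a \<otimes>\<^bsub>Mp\<^esub> x \<in> C.\<phi> ` (I \<inter> C.SP)"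
      if "a \<in> C.\<phi> ` (I \<inter> C.SP)" "x \<in> carrier Mp" for a x
      using lmult[OF that] Mp.m_comm[of a x] that sub by auto
  qed
qed


text \<open>
  Membership in the ideal modulo \<open>p\<close> lifts to characteristic zero.
\<close>
lemma generated_ideal: "Idl\<^bsub>Mp\<^esub> (C.\<phi> ` GB) = C.\<phi> ` (I \<inter> C.SP)"
proof
  interpret Mp: cring Mp by (rule C.cring_mpoly)
  have GBI: "C.\<phi> ` GB \<subseteq> C.\<phi> ` (I \<inter> C.SP)" using GB_mem(1) GB_SP by blast
  then show "Idl\<^bsub>Mp\<^esub> (C.\<phi> ` GB) \<subseteq> C.\<phi> ` (I \<inter> C.SP)"
    by (rule Mp.genideal_minimal[OF image_ideal])
  have car: "C.\<phi> ` GB \<subseteq> carrier Mp" using GB_SP C.\<phi>_closed by blast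
  show "C.\<phi> ` (I \<inter> C.SP) \<subseteq> Idl\<^bsub>Mp\<^esub> (C.\<phi> ` GB)"
    using reduction_mem[OF Mp.genideal_ideal[OF car] Mp.genideal_self[OF car]] by blast
qed

end


section \<open>The minimal polynomial over the rationals\<close>

lemma QQ_simps: "carrier QQ = UNIV" "\<zero>\<^bsub>QQ\<^esub> = 0" "\<one>\<^bsub>QQ\<^esub> = 1" "x \<oplus>\<^bsub>QQ\<^esub> y = x + y" "x \<otimes>\<^bsub>QQ\<^esub> y = x * y"
  by (simp_all add: ring_of_type_algebra_def)

lemma field_QQ: "field QQ"
  by (rule field_from_type_algebra)

interpretation qq: coeff_map UNIV QQ "\<lambda>x. x"
  by (rule coeff_map.intro[OF cring_from_type_algebra]) (auto simp: QQ_simps)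

lemma qq_SP: "qq.SP = UNIV" by (simp add: qq.SP_def)

lemma qq_\<phi>: "qq.\<phi> a = lookup a" by (simp add: qq.\<phi>_def)

lemma lookup_QQ:
  "lookup (a + b) = lookup a \<oplus>\<^bsub>mpoly_ring QQ\<^esub> lookup b"
  "lookup (a * b) = lookup a \<otimes>\<^bsub>mpoly_ring QQ\<^esub> lookup b"
  "lookup 0 = \<zero>\<^bsub>mpoly_ring QQ\<^esub>"
  "lookup a \<in> carrier (mpoly_ring QQ)"
  "mpoly_const QQ c = lookup (single {#} c)"
  using qq.\<phi>_add[of a b] qq.\<phi>_mult[of a b] qq.\<phi>_0 qq.\<phi>_closed[of a] qq.\<phi>_single[of c, symmetric]
  by (simp_all add: qq_SP qq_\<phi>)

lemma carrier_QQ: "carrier (mpoly_ring QQ) = range lookup"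
  using qq.\<phi>_image[symmetric] by (simp add: qq_SP qq_\<phi>[abs_def])

lemma lookup_minus_QQ: "lookup (a - b) = lookup a \<ominus>\<^bsub>mpoly_ring QQ\<^esub> lookup b"
proof -
  interpret M: cring "mpoly_ring QQ :: ('v multiset \<Rightarrow> rat) ring" by (rule qq.cring_mpoly)
  have "lookup (- b) \<oplus>\<^bsub>mpoly_ring QQ\<^esub> lookup b = \<zero>\<^bsub>mpoly_ring QQ\<^esub>"
    by (simp flip: lookup_QQ(1,3))
  then have "lookup (- b) = \<ominus>\<^bsub>mpoly_ring QQ\<^esub> lookup b"
    using M.minus_equality lookup_QQ(4) by metis
  then show ?thesis using lookup_QQ(1)[of a "- b"] by (simp add: a_minus_def)
qed


text \<open>
  The dimension is built up by adjoining one vector at a time; \<open>S\<close> collects representatives of these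
  vectors.
\<close>
lemma finite_codimension:
  assumes I: "ideal I (mpoly_ring QQ :: ('v multiset \<Rightarrow> rat) ring)"
    and dim: "ring.dimension (quot_ring QQ I) d (quot_const QQ I ` carrier QQ) E"
  shows "E \<subseteq> carrier (quot_ring QQ I) \<and>
    (\<exists>S. finite S \<and> (\<forall>a. I +>\<^bsub>mpoly_ring QQ\<^esub> lookup a \<in> E \<longrightarrow> a \<in> polyvs.span (S \<union> {a. lookup a \<in> I})))"
proof -
  interpret M: cring "mpoly_ring QQ :: ('v multiset \<Rightarrow> rat) ring" by (rule qq.cring_mpoly)
  interpret I: ideal I "mpoly_ring QQ" by (rule I)
  interpret Q: ring "quot_ring QQ I" by (rule I.quotient_is_ring)
  let ?r = "\<lambda>x. I +>\<^bsub>mpoly_ring QQ\<^esub> x"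
  note hom = I.rcos_ring_hom
  have mem: "lookup a \<in> I" if "?r (lookup a) = I" for a
    by (rule I.rcos_const_imp_mem[OF lookup_QQ(4) that])
  show ?thesis
    using dim
  proof (induction d "quot_const QQ I ` carrier QQ" E rule: Q.dimension.induct)
    case zero_dim
    have "a \<in> polyvs.span ({} \<union> {a. lookup a \<in> I})" if "?r (lookup a) \<in> {\<zero>\<^bsub>quot_ring QQ I\<^esub>}" for a
      using that mem[of a] by (auto simp: zero_FactRing intro: polyvs.span_base)
    then show ?case by (intro conjI exI[of _ "{}"]) auto
  next
    case (Suc_dim v E n)
    from Suc_dim(4) obtain S where S: "finite S" "\<And>a. ?r (lookup a) \<in> E \<Longrightarrow> a \<in> polyvs.span (S \<union> {a. lookup a \<in> I})"
      by blast
    have E: "E \<subseteq> carrier (quot_ring QQ I)" using Suc_dim(4) by blast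
    have surj: "\<exists>b. u = ?r (lookup b)" if "u \<in> carrier (quot_ring QQ I)" for u
      using that by (auto simp: FactRing_def A_RCOSETS_def' carrier_QQ)
    obtain b where b: "v = ?r (lookup b)" using surj[OF Suc_dim(1)] by blast
    let ?L = "Q.line_extension (quot_const QQ I ` carrier QQ) v E"
    have kc: "quot_const QQ I c \<in> carrier (quot_ring QQ I)" for c
      unfolding quot_const_def lookup_QQ(5) using ring_hom_closed[OF hom lookup_QQ(4)] .
    have sub: "?L \<subseteq> carrier (quot_ring QQ I)"
      using E kc Suc_dim(1) unfolding Q.line_extension_mem_iff subset_iff by auto
    have "a \<in> polyvs.span (insert b S \<union> {a. lookup a \<in> I})" if a: "?r (lookup a) \<in> ?L" for a
    proof -
      obtain c u where cu: "u \<in> E" "?r (lookup a) = quot_const QQ I c \<otimes>\<^bsub>quot_ring QQ I\<^esub> v \<oplus>\<^bsub>quot_ring QQ I\<^esub> u"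
        using a unfolding Q.line_extension_mem_iff by blast
      obtain w where w: "u = ?r (lookup w)" using surj cu(1) E by blast
      have "?r (lookup (smul c b + w)) = ?r (lookup a)"
        unfolding cu(2) w b quot_const_def lookup_QQ(1,2,5)
        by (simp add: ring_hom_mult[OF hom] ring_hom_add[OF hom] lookup_QQ(4))
      then have "lookup (a - (smul c b + w)) \<in> I"
        unfolding lookup_minus_QQ
        by (intro M.quotient_eq_iff_same_a_r_cos[OF I lookup_QQ(4) lookup_QQ(4), THEN iffD2]) simp
      then have "a - (smul c b + w) \<in> polyvs.span (insert b S \<union> {a. lookup a \<in> I})"
        by (intro polyvs.span_base) simp
      moreover have "w \<in> polyvs.span (insert b S \<union> {a. lookup a \<in> I})"
        using S(2)[of w] cu(1) w polyvs.span_mono[of "S \<union> {a. lookup a \<in> I}" "insert b S \<union> {a. lookup a \<in> I}"] by blast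
      moreover have "smul c b \<in> polyvs.span (insert b S \<union> {a. lookup a \<in> I})"
        by (intro polyvs.span_scale polyvs.span_base) simp
      ultimately have "(a - (smul c b + w)) + (smul c b + w) \<in> polyvs.span (insert b S \<union> {a. lookup a \<in> I})"
        by (intro polyvs.span_add)
      then show ?thesis by simp
    qed
    then show ?case using sub S(1) by (intro conjI exI[of _ "insert b S"]) auto
  qed
qed

locale modular_problem =
  fixes \<sigma> :: "'v::finite multiset rel" and I :: "('v multiset \<Rightarrow> rat) set" and f :: "'v multiset \<Rightarrow> rat"
  assumes ordering: "term_ordering \<sigma>" and zd: "zero_dimensional QQ I" and f: "f \<in> carrier (mpoly_ring QQ)"
begin

definition I0 :: "('v multiset \<Rightarrow>\<^sub>0 rat) set" where "I0 = {a. lookup a \<in> I}"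

definition F :: "'v multiset \<Rightarrow>\<^sub>0 rat" where "F = Abs_poly_mapping f"

lemma ideal_I: "ideal I (mpoly_ring QQ)"
  using zd by (simp add: zero_dimensional_def)

lemma lookup_F: "lookup F = f"
  using f unfolding carrier_QQ F_def by (auto simp: lookup_inverse)

lemma lookup_I0: "lookup ` I0 = I"
proof -
  have "I \<subseteq> range lookup" using ideal.Icarr[OF ideal_I] carrier_QQ by blast
  then show ?thesis by (auto simp: I0_def)
qed

sublocale Z: zero_dim_ideal \<sigma> I0
proof
  interpret I: ideal I "mpoly_ring QQ" by (rule ideal_I)
  show "term_ordering \<sigma>" by (rule ordering)
  show "0 \<in> I0" unfolding I0_def mem_Collect_eq lookup_QQ(3)
    by (rule additive_subgroup.zero_closed[OF ideal.axioms(1)[OF ideal_I]])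
  show "a + b \<in> I0" if "a \<in> I0" "b \<in> I0" for a b
    using I.a_closed that unfolding I0_def mem_Collect_eq lookup_QQ(1) by blast
  show "c * a \<in> I0" if "a \<in> I0" for a c
    using I.I_l_closed[OF _ lookup_QQ(4)] that unfolding I0_def mem_Collect_eq lookup_QQ(2) by blast
  show "\<exists>S. finite S \<and> polyvs.span (S \<union> I0) = UNIV"
  proof -
    obtain d where "ring.dimension (quot_ring QQ I) d (quot_const QQ I ` carrier QQ) (carrier (quot_ring QQ I))"
      using zd by (auto simp: zero_dimensional_def)
    then obtain S where S: "finite S"
      "\<And>a. I +>\<^bsub>mpoly_ring QQ\<^esub> lookup a \<in> carrier (quot_ring QQ I) \<Longrightarrow> a \<in> polyvs.span (S \<union> {a. lookup a \<in> I})"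
      using finite_codimension[OF ideal_I] by blast
    have "a \<in> polyvs.span (S \<union> I0)" for a
      unfolding I0_def using S(2)[OF ring_hom_closed[OF I.rcos_ring_hom lookup_QQ(4)]] .
    with S(1) show ?thesis by blast
  qed
qed

sublocale mq: minimal_polynomial QQ I f
  by (rule minimal_polynomial.intro[OF field_QQ ideal_I qq.cring_mpoly qq.const_hom f])

definition ev :: "nat \<Rightarrow> (nat \<Rightarrow> rat) \<Rightarrow> 'v multiset \<Rightarrow>\<^sub>0 rat"
  where "ev n h = (\<Sum>i\<le>n. smul (h i) (F ^ i))"

definition \<mu> :: "nat \<Rightarrow> rat" where "\<mu> = min_poly QQ f I"

definition d :: nat where "d = deg QQ \<mu>"

lemma UP_QQ: "(\<And>i. i > n \<Longrightarrow> h i = 0) \<Longrightarrow> h \<in> carrier (UP QQ)"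
  by (auto simp: UP_def up_def QQ_simps)

lemma kernel_QQ:
  assumes "\<And>i. i > n \<Longrightarrow> h i = 0"
  shows "h \<in> mq.K \<longleftrightarrow> ev n h \<in> I0"
    and "UnivPoly.eval QQ (mpoly_ring QQ) (mpoly_const QQ) f h \<in> I \<longleftrightarrow> ev n h \<in> I0"
proof -
  have h: "h \<in> carrier (UP QQ)" using assms by (rule UP_QQ)
  have "UnivPoly.eval QQ (mpoly_ring QQ) (mpoly_const QQ) (qq.\<phi> F) h = qq.\<phi> (\<Sum>i\<le>n. smul (h i) (F ^ i))"
    by (rule qq.eval_\<phi>) (use h assms in \<open>simp_all add: qq_SP QQ_simps\<close>)
  then have e: "UnivPoly.eval QQ (mpoly_ring QQ) (mpoly_const QQ) f h = lookup (ev n h)"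
    by (simp add: qq_\<phi> lookup_F ev_def)
  then show "UnivPoly.eval QQ (mpoly_ring QQ) (mpoly_const QQ) f h \<in> I \<longleftrightarrow> ev n h \<in> I0"
    by (simp add: I0_def)
  then show "h \<in> mq.K \<longleftrightarrow> ev n h \<in> I0" using h by (simp add: mq.K_def mq.evM_def)
qed


text \<open>
  The infinitely many powers of \<open>f\<close> are dependent modulo \<open>I\<close>.
\<close>
lemma nonzero_kernel: "\<exists>h\<in>mq.K. h \<noteq> \<zero>\<^bsub>UP QQ\<^esub>"
proof -
  obtain S where S: "finite S" "polyvs.span (S \<union> I0) = UNIV" using Z.finite_codim by blast
  have "\<exists>K0 c. finite K0 \<and> K0 \<subseteq> (UNIV :: nat set) \<and> (\<exists>k\<in>K0. c k \<noteq> 0) \<and> (\<Sum>k\<in>K0. smul (c k) (F ^ k)) \<in> I0"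
    by (rule polyvs.infinite_family_dependent[OF S(1) Z.ideal_subspace]) (simp_all add: S(2))
  then obtain K0 c k where K0: "finite K0" "k \<in> K0" "c k \<noteq> 0" "(\<Sum>k\<in>K0. smul (c k) (F ^ k)) \<in> I0"
    by blast
  define h where "h i = (if i \<in> K0 then c i else 0)" for i
  have le: "i \<le> Max K0" if "i \<in> K0" for i using that K0(1) by simp
  have hz: "h i = 0" if "i > Max K0" for i
    using that le[of i] by (cases "i \<in> K0") (simp_all add: h_def)
  have "ev (Max K0) h = (\<Sum>k\<in>K0. smul (c k) (F ^ k))"
    unfolding ev_def by (rule sum.mono_neutral_cong_right) (auto simp: h_def le)
  then have "h \<in> mq.K" using kernel_QQ(1)[OF hz] K0(4) by simp
  moreover have "h \<noteq> \<zero>\<^bsub>UP QQ\<^esub>"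
  proof
    assume "h = \<zero>\<^bsub>UP QQ\<^esub>"
    then have "h k = 0" by (simp add: zero_UP QQ_simps)
    then show False using K0 by (simp add: h_def)
  qed
  ultimately show ?thesis by blast
qed

lemma UP_ring_QQ: "UP_ring QQ"
  using ring_from_type_algebra by (rule UP_ring.intro)

lemma \<mu>_monic: "\<mu> d = 1"
  using mq.min_poly_monic[OF nonzero_kernel] by (simp add: \<mu>_def d_def QQ_simps)

lemma \<mu>_above: "i > d \<Longrightarrow> \<mu> i = 0"
proof -
  assume i: "i > d"
  have \<mu>: "\<mu> \<in> carrier (UP QQ)" using mq.min_poly_mem[OF nonzero_kernel] by (simp add: \<mu>_def mq.K_def)
  show ?thesis
    using UP_ring.deg_aboveD[OF UP_ring_QQ _ \<mu>, of i] i coeff_UP[OF \<mu>] by (simp add: d_def QQ_simps)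
qed

lemma ev_\<mu>: "ev d \<mu> \<in> I0"
  using mq.min_poly_mem[OF nonzero_kernel] kernel_QQ(1)[OF \<mu>_above] by (simp add: \<mu>_def)

lemma \<mu>_minimal:
  assumes "ev e h \<in> I0" "h e \<noteq> 0" "\<And>i. i > e \<Longrightarrow> h i = 0"
  shows "d \<le> e"
proof -
  have "h \<in> mq.K" using kernel_QQ(1)[of e h] assms by simp
  moreover have "h \<noteq> \<zero>\<^bsub>UP QQ\<^esub>" using assms(2) by (auto simp: zero_UP QQ_simps)
  ultimately have "d \<le> deg QQ h" using mq.min_poly_deg_le[OF nonzero_kernel] by (simp add: d_def \<mu>_def)
  also have "deg QQ h \<le> e"
    using assms(3) coeff_UP[OF UP_QQ[OF assms(3)]] UP_QQ[OF assms(3)]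
    by (intro UP_ring.deg_aboveI[OF UP_ring_QQ]) (simp_all add: QQ_simps)
  finally show ?thesis .
qed

lemma \<mu>_unique:
  assumes "ev d h \<in> I0" "h d = 1" "\<And>i. i > d \<Longrightarrow> h i = 0"
  shows "h = \<mu>"
  unfolding \<mu>_def
proof (rule mq.min_poly_unique[OF nonzero_kernel])
  show "h \<in> mq.K" using kernel_QQ(1)[of d h] assms by simp
qed (use assms in \<open>simp_all add: QQ_simps d_def \<mu>_def\<close>)


text \<open>
  By minimality of \<open>\<mu>\<close> the powers of \<open>f\<close> of degree less than \<open>d\<close> are independent modulo \<open>I\<close>.
\<close>
lemma power_functional:
  assumes "e < d"
  obtains L where "Vector_Spaces.linear smul (*) L" "\<And>a. a \<in> I0 \<Longrightarrow> L a = 0"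
    "\<And>i. i < e \<Longrightarrow> L (F ^ i) = 0" "L (F ^ e) = 1"
proof (rule polyvs.triangular_functional[OF Z.ideal_subspace, of "\<lambda>i. F ^ i" e])
  fix c
  show "smul 1 (F ^ e) + (\<Sum>i<e. smul (c i) (F ^ i)) \<notin> I0"
  proof
    assume *: "smul 1 (F ^ e) + (\<Sum>i<e. smul (c i) (F ^ i)) \<in> I0"
    define h where "h i = (if i < e then c i else if i = e then 1 else 0)" for i
    have "ev e h = smul 1 (F ^ e) + (\<Sum>i<e. smul (c i) (F ^ i))"
      by (simp add: ev_def h_def lessThan_Suc_atMost[symmetric] add.commute)
    then have "d \<le> e" using * by (intro \<mu>_minimal[of e h]) (simp_all add: h_def)
    with assms show False by simp
  qed
qed (use that in blast)

lemma usable_integral_basis: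
  assumes "usable \<sigma> I f p"
  shows "integral_basis \<sigma> I0 p" and "\<And>t. p_integral p (lookup F t)"
proof -
  have p: "Factorial_Ring.prime p" and nd: "\<not> p dvd den f" "\<not> p dvd den_ideal \<sigma> I"
    using assms by (auto simp: usable_def)
  have coeffs: "p_integral p (lookup a t)" if "\<not> p dvd den (lookup a)" for a and t :: "'v multiset"
  proof (cases "lookup a t = 0")
    case True
    then show ?thesis using p_integral_0[OF p] by simp
  next
    case False
    then have "denom (lookup a t) dvd den (lookup a)"
      unfolding den_def Z.supp_lookup by (intro dvd_Lcm) (auto simp: in_keys_iff)
    then show ?thesis using that unfolding p_integral_def by (meson dvd_trans)
  qed
  show "p_integral p (lookup F t)" for t using coeffs[of F t] nd(1) by (simp add: lookup_F)
  show "integral_basis \<sigma> I0 p"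
  proof
    show "Factorial_Ring.prime p" by (rule p)
    fix g t assume "g \<in> Z.GB"
    then have "den (lookup g) dvd den_ideal \<sigma> I"
      unfolding den_ideal_def using Z.reduced_groebner_basis_eq
      by (intro dvd_Lcm) (simp add: lookup_I0)
    then show "p_integral p (lookup g t)" using nd(2) coeffs by (meson dvd_trans)
  qed
qed


text \<open>
  The product of the denominators of \<open>L\<close> on the standard monomials serves all primes at once.
\<close>
lemma integrality_bound:
  assumes "Vector_Spaces.linear smul (*) L"
  obtains D :: rat where "D \<noteq> 0" "\<And>p b. Factorial_Ring.prime p \<Longrightarrow> b \<in> Z.std \<Longrightarrow> p_integral p (D * L (single b 1))"
proof -
  define den where "den b = (of_int (denom (L (single b 1))) :: rat)" for b
  define D where "D = (\<Prod>b\<in>Z.std. den b)"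
  have nz: "den b \<noteq> 0" for b using denom_pos[of "L (single b 1)"] by (simp add: den_def)
  then have "D \<noteq> 0" by (simp add: D_def Z.finite_std)
  moreover have "p_integral p (D * L (single b 1))" if p: "Factorial_Ring.prime p" and b: "b \<in> Z.std" for p b
  proof -
    have "D = den b * (\<Prod>b\<in>Z.std - {b}. den b)" unfolding D_def by (rule prod.remove[OF Z.finite_std b])
    then have "D * L (single b 1) = (den b * L (single b 1)) * (\<Prod>b\<in>Z.std - {b}. den b)" by simp
    also have "den b * L (single b 1) = of_int (fst (quotient_of (L (single b 1))))"
      using rat_eq_denom[of "L (single b 1)"] nz[of b] by (simp add: den_def field_simps)
    also have "(\<Prod>b\<in>Z.std - {b}. den b) = of_int (\<Prod>b\<in>Z.std - {b}. denom (L (single b 1)))"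
      by (simp add: den_def)
    finally have "D * L (single b 1) = of_int (fst (quotient_of (L (single b 1))) * (\<Prod>b\<in>Z.std - {b}. denom (L (single b 1))))"
      by (simp only: of_int_mult)
    then show ?thesis using p_integral_of_int[OF p] by metis
  qed
  ultimately show ?thesis by (rule that)
qed


text \<open>
  If \<open>\<mu>\<close> were not integral at \<open>p\<close>, its primitive multiple would have a smaller degree \<open>e\<close> modulo \<open>p\<close>.
  The functional for \<open>e\<close> maps the powers of \<open>f\<close> to a sequence that satisfies the recurrence given by
  this multiple, in contradiction to \<open>fatou\<close>.
\<close>
lemma \<mu>_integral:
  assumes us: "usable \<sigma> I f p"
  shows "p_integral p (\<mu> i)"
proof -
  interpret B: integral_basis \<sigma> I0 p by (rule usable_integral_basis(1)[OF us])
  note p = B.p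
  have FSP: "F \<in> B.C.SP" using usable_integral_basis(2)[OF us] by (simp add: B.C.SP_def)
  have "\<forall>i\<le>d. p_integral p (\<mu> i)"
  proof (rule ccontr)
    assume "\<not> ?thesis"
    then have ex: "\<exists>i\<le>d. \<not> p_integral p (\<mu> i)" by blast
    obtain t e where te: "e < d" "\<And>i. i \<le> d \<Longrightarrow> p_integral p (of_int p ^ t * \<mu> i)"
      "\<not> p_integral p (of_int p ^ t * \<mu> e / of_int p)"
      "\<And>i. e < i \<Longrightarrow> i \<le> d \<Longrightarrow> p_integral p (of_int p ^ t * \<mu> i / of_int p)"
      by (rule primitive_multiple[where c = \<mu> and d = d, OF p \<mu>_monic ex]) (rule that)
    obtain L where L: "Vector_Spaces.linear smul (*) L" "\<And>a. a \<in> I0 \<Longrightarrow> L a = 0"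
      "\<And>i. i < e \<Longrightarrow> L (F ^ i) = 0" "L (F ^ e) = 1" using power_functional[OF te(1)] by blast
    interpret L: Vector_Spaces.linear smul "(*)" L by (rule L(1))
    obtain D :: rat where D: "D \<noteq> 0" "\<And>p b. Factorial_Ring.prime p \<Longrightarrow> b \<in> Z.std \<Longrightarrow> p_integral p (D * L (single b 1))"
      using integrality_bound[OF L(1)] by blast
    have bounded: "p_integral p (D * L (F ^ k))" for k
    proof (rule Z.functional_integral[OF p B.GB_integral L(1,2) D(2)[OF p]])
      show "p_integral p (lookup (F ^ k) t)" for t
        using B.C.SP_power[OF FSP, of k] by (simp add: B.C.SP_def)
    qed
    have rec: "(\<Sum>i\<le>d. (of_int p ^ t * \<mu> i) * L (F ^ (k + i))) = 0" for k
    proof -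
      have "L (single 0 (of_int p ^ t) * F ^ k * ev d \<mu>) = 0" by (intro L(2) Z.mult_mem ev_\<mu>)
      also have "single 0 (of_int p ^ t) * F ^ k * ev d \<mu> = (\<Sum>i\<le>d. smul (of_int p ^ t * \<mu> i) (F ^ (k + i)))"
        unfolding ev_def sum_distrib_left
      proof (rule sum.cong[OF refl])
        fix i
        have "single 0 (of_int p ^ t) * F ^ k * (smul (\<mu> i) (F ^ i))
            = (single 0 (of_int p ^ t) * single 0 (\<mu> i)) * (F ^ k * F ^ i)"
          by (simp only: mult.assoc mult.left_commute)
        then show "single 0 (of_int p ^ t) * F ^ k * (smul (\<mu> i) (F ^ i)) = smul (of_int p ^ t * \<mu> i) (F ^ (k + i))"
          by (simp only: mult_single power_add add_0)
      qed
      also have "L \<dots> = (\<Sum>i\<le>d. (of_int p ^ t * \<mu> i) * L (F ^ (k + i)))"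
        by (simp only: L.sum L.scale)
      finally show ?thesis .
    qed
    have eb: "of_int p ^ t * \<mu> e \<noteq> 0" "p_integral p (1 / (of_int p ^ t * \<mu> e))"
      using p_integral_inverse[OF p te(2)[OF less_imp_le[OF te(1)]] te(3)] by blast+
    show False
      by (rule fatou[OF p D(1) bounded L(3,4) rec te(2) less_imp_le[OF te(1)] eb te(4)])
  qed
  then show ?thesis using \<mu>_above[of i] p_integral_0[OF p] by (cases "i \<le> d") auto
qed

lemma min_poly_mod_setup:
  assumes us: "usable \<sigma> I f p"
  shows "minimal_polynomial (residue_ring p) (ideal_residue \<sigma> I p) (mpoly_residue p f)"
    and "ideal_residue \<sigma> I p =
      coeff_map.\<phi> (residue p) ` (I0 \<inter> coeff_map.SP {q. p_integral p q})"
    and "mpoly_residue p f = coeff_map.\<phi> (residue p) F"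
proof -
  interpret B: integral_basis \<sigma> I0 p by (rule usable_integral_basis(1)[OF us])
  have FSP: "F \<in> B.C.SP" using usable_integral_basis(2)[OF us] by (simp add: B.C.SP_def)
  have \<phi>: "mpoly_residue p (lookup a) = B.C.\<phi> a" for a :: "'v multiset \<Rightarrow>\<^sub>0 rat"
    by (simp add: mpoly_residue_def B.C.\<phi>_def)
  then have gb: "mpoly_residue p ` reduced_groebner_basis QQ \<sigma> I = B.C.\<phi> ` Z.GB"
    using Z.reduced_groebner_basis_eq by (simp add: lookup_I0 image_image)
  show ideal: "ideal_residue \<sigma> I p = B.C.\<phi> ` (I0 \<inter> B.C.SP)"
    unfolding ideal_residue_def gb by (rule B.generated_ideal)
  show f: "mpoly_residue p f = B.C.\<phi> F" using \<phi>[of F] by (simp add: lookup_F)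
  show "minimal_polynomial (residue_ring p) (ideal_residue \<sigma> I p) (mpoly_residue p f)"
    unfolding ideal f
    by (rule minimal_polynomial.intro[OF field_residue_ring[OF B.p] B.image_ideal B.C.cring_mpoly
          B.C.const_hom B.C.\<phi>_closed[OF FSP]])
qed

end


section \<open>The minimal polynomials modulo primes\<close>

lemma residue_ring_simps: "\<zero>\<^bsub>residue_ring m\<^esub> = 0" "\<one>\<^bsub>residue_ring m\<^esub> = 1"
  "x \<in> carrier (residue_ring m) \<longleftrightarrow> 0 \<le> x \<and> x < m"
  by (auto simp: residue_ring_def)

lemma UP_residue_ring:
  "x \<in> carrier (UP (residue_ring m)) \<longleftrightarrow> (\<forall>i. 0 \<le> x i \<and> x i < m) \<and> (\<exists>n. \<forall>i>n. x i = 0)"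
  by (auto simp: UP_def up_def bound_def residue_ring_simps)

lemma UP_ring_residue: "m > 1 \<Longrightarrow> UP_ring (residue_ring m)"
  by (intro UP_ring.intro cring.axioms(1) residues.cring) (rule residues.intro)

lemma deg_residue_ring:
  assumes "m > 1" "\<And>i. 0 \<le> x i \<and> x i < m" "x e \<noteq> 0" "\<And>i. i > e \<Longrightarrow> x i = 0"
  shows "deg (residue_ring m) x = e"
proof -
  have x: "x \<in> carrier (UP (residue_ring m))" using assms unfolding UP_residue_ring by blast
  show ?thesis
  proof (rule antisym)
    show "deg (residue_ring m) x \<le> e"
      using x assms(4) by (intro UP_ring.deg_aboveI[OF UP_ring_residue[OF assms(1)]])
        (simp_all add: coeff_UP[OF x] residue_ring_simps)
    show "e \<le> deg (residue_ring m) x"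
      using x assms(3) by (intro UP_ring.deg_belowI[OF UP_ring_residue[OF assms(1)]])
        (simp_all add: coeff_UP[OF x] residue_ring_simps)
  qed
qed

context modular_problem
begin

abbreviation \<nu> :: "int \<Rightarrow> nat \<Rightarrow> int" where "\<nu> p \<equiv> min_poly_mod \<sigma> I f p"

abbreviation deg_mod :: "int \<Rightarrow> nat" where "deg_mod p \<equiv> deg (residue_ring p) (\<nu> p)"


text \<open>
  By \<open>\<mu>_integral\<close> the reduction of \<open>\<mu>\<close> is a monic element of the kernel modulo \<open>p\<close>, which bounds the
  degree, and by uniqueness it is the minimal polynomial if the degrees agree. The last part lifts
  the relation satisfied by the minimal polynomial modulo \<open>p\<close>: with the coefficients read as integers,
  its value at \<open>f\<close> lies in \<open>I\<close> up to \<open>p\<close> times a \<open>p\<close>-integral polynomial.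
\<close>
lemma min_poly_mod_props:
  assumes us: "usable \<sigma> I f p"
  shows \<nu>_range: "0 \<le> \<nu> p i \<and> \<nu> p i < p"
    and \<nu>_monic: "\<nu> p (deg_mod p) = 1"
    and \<nu>_above: "i > deg_mod p \<Longrightarrow> \<nu> p i = 0"
    and deg_mod_le: "deg_mod p \<le> d"
    and \<nu>_eq_residue: "deg_mod p = d \<Longrightarrow> \<nu> p i = residue p (\<mu> i)"
    and \<nu>_lift: "\<exists>a\<in>I0. \<forall>t. p_integral p (lookup (ev (deg_mod p) (\<lambda>i. of_int (\<nu> p i)) - a) t / of_int p)"
proof -
  interpret B: integral_basis \<sigma> I0 p by (rule usable_integral_basis(1)[OF us])
  note p = B.p
  have p1: "p > 1" using p prime_gt_1_int by blast
  note UPp = UP_ring_residue[OF p1]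
  have FSP: "F \<in> B.C.SP" using usable_integral_basis(2)[OF us] by (simp add: B.C.SP_def)
  note red = min_poly_mod_setup[OF us]
  interpret mp: minimal_polynomial "residue_ring p" "ideal_residue \<sigma> I p" "mpoly_residue p f" by (rule red(1))
  have kernel: "(\<lambda>i. residue p (h i)) \<in> mp.K \<longleftrightarrow> B.C.\<phi> (ev n h) \<in> B.C.\<phi> ` (I0 \<inter> B.C.SP)"
    if h: "\<And>i. p_integral p (h i)" "\<And>i. i > n \<Longrightarrow> residue p (h i) = 0" for h n
  proof -
    have H: "(\<lambda>i. residue p (h i)) \<in> carrier (UP (residue_ring p))"
      unfolding UP_residue_ring
      using h B.C.\<pi>_closed[unfolded residue_ring_simps] by (intro conjI exI[of _ n]) auto
    have "mp.evM (\<lambda>i. residue p (h i)) = B.C.\<phi> (ev n h)"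
      by (subst mp.evM_def, subst red(3), subst ev_def, rule B.C.eval_\<phi>[OF FSP _ H])
        (use h in \<open>simp_all add: residue_ring_simps\<close>)
    then show ?thesis using H by (subst mp.K_def, subst red(2)) simp
  qed
  let ?H = "\<lambda>i. residue p (\<mu> i)"
  have Hz: "?H i = 0" if "i > d" for i using \<mu>_above[OF that] residue_0[OF p1] by simp
  have Hd: "?H d = 1" using \<mu>_monic residue_1[OF p1] by simp
  have ev_SP: "ev n h \<in> B.C.SP" if "\<And>i. p_integral p (h i)" for n h
    unfolding ev_def using that by (intro B.C.SP_sum B.C.SP_mult B.C.SP_single B.C.SP_power[OF FSP]) simp
  have HK: "?H \<in> mp.K"
  proof -
    have "?H \<in> mp.K \<longleftrightarrow> B.C.\<phi> (ev d \<mu>) \<in> B.C.\<phi> ` (I0 \<inter> B.C.SP)"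
      by (rule kernel) (simp_all add: \<mu>_integral[OF us] Hz)
    moreover have "B.C.\<phi> (ev d \<mu>) \<in> B.C.\<phi> ` (I0 \<inter> B.C.SP)"
      using ev_\<mu> ev_SP[OF \<mu>_integral[OF us]] by (intro imageI IntI)
    ultimately show ?thesis by blast
  qed
  have HC: "?H \<in> carrier (UP (residue_ring p))" using HK by (simp add: mp.K_def)
  have H0: "?H \<noteq> \<zero>\<^bsub>UP (residue_ring p)\<^esub>"
  proof
    assume "?H = \<zero>\<^bsub>UP (residue_ring p)\<^esub>"
    then have "?H d = 0" unfolding zero_UP residue_ring_simps by metis
    with Hd show False by simp
  qed
  have ex: "\<exists>h\<in>mp.K. h \<noteq> \<zero>\<^bsub>UP (residue_ring p)\<^esub>" using HK H0 by blast
  have \<nu>: "\<nu> p = min_poly (residue_ring p) (mpoly_residue p f) (ideal_residue \<sigma> I p)"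
    by (simp add: min_poly_mod_def)
  have \<nu>K: "\<nu> p \<in> mp.K" unfolding \<nu> by (rule mp.min_poly_mem[OF ex])
  then have \<nu>C: "\<nu> p \<in> carrier (UP (residue_ring p))" by (simp add: mp.K_def)
  show range: "0 \<le> \<nu> p i \<and> \<nu> p i < p" for i using \<nu>C by (simp add: UP_residue_ring)
  show monic: "\<nu> p (deg_mod p) = 1"
    using mp.min_poly_monic[OF ex] by (simp add: \<nu> residue_ring_simps)
  show above: "\<nu> p i = 0" if "i > deg_mod p" for i
    using UP_ring.deg_aboveD[OF UPp that \<nu>C] by (simp add: coeff_UP[OF \<nu>C] residue_ring_simps)
  have "deg_mod p \<le> deg (residue_ring p) ?H"
    using mp.min_poly_deg_le[OF ex HK H0] by (simp add: \<nu>)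
  also have "\<dots> \<le> d"
    using Hz HC coeff_UP[OF HC] by (intro UP_ring.deg_aboveI[OF UPp]) (simp_all add: residue_ring_simps)
  finally show "deg_mod p \<le> d" .
  show "\<nu> p i = residue p (\<mu> i)" if "deg_mod p = d"
  proof -
    have "?H = \<nu> p"
      unfolding \<nu>
      by (rule mp.min_poly_unique[OF ex HK]) (use that Hd Hz in \<open>simp_all add: \<nu> residue_ring_simps\<close>)
    then show ?thesis by metis
  qed
  show "\<exists>a\<in>I0. \<forall>t. p_integral p (lookup (ev (deg_mod p) (\<lambda>i. of_int (\<nu> p i)) - a) t / of_int p)"
  proof -
    let ?h = "\<lambda>i. of_int (\<nu> p i) :: rat"
    have hi: "p_integral p (?h i)" for i by (rule p_integral_of_int[OF p])
    have hr: "residue p (?h i) = \<nu> p i" for i using residue_of_int[OF p1] range by simp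
    have "(\<lambda>i. residue p (?h i)) \<in> mp.K \<longleftrightarrow> B.C.\<phi> (ev (deg_mod p) ?h) \<in> B.C.\<phi> ` (I0 \<inter> B.C.SP)"
    proof (rule kernel[OF hi])
      show "residue p (?h i) = 0" if "i > deg_mod p" for i unfolding hr by (rule above[OF that])
    qed
    then have "B.C.\<phi> (ev (deg_mod p) ?h) \<in> B.C.\<phi> ` (I0 \<inter> B.C.SP)"
      unfolding hr using \<nu>K by simp
    then obtain a where a: "a \<in> I0" "a \<in> B.C.SP" "B.C.\<phi> (ev (deg_mod p) ?h) = B.C.\<phi> a" by blast
    let ?b = "ev (deg_mod p) ?h - a"
    have b: "?b \<in> B.C.SP" using ev_SP[OF hi] a(2) by (rule B.C.SP_diff)
    have "p_integral p (lookup ?b t / of_int p)" for t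
    proof -
      have int: "lookup ?b t \<in> {q. p_integral p q}" "lookup a t \<in> {q. p_integral p q}"
        using b a(2) by (simp_all add: B.C.SP_def)
      have "residue p (lookup a t) = residue p (lookup ?b t + lookup a t)"
        using fun_cong[OF a(3), of t] by (simp add: B.C.\<phi>_def lookup_minus)
      also have "\<dots> = residue p (lookup ?b t) \<oplus>\<^bsub>residue_ring p\<^esub> residue p (lookup a t)"
        by (rule B.C.\<pi>_add[OF int])
      finally have "residue p (lookup ?b t) = \<zero>\<^bsub>residue_ring p\<^esub>"
        using B.C.base.add.r_cancel_one'[OF B.C.\<pi>_closed[OF int(2)] B.C.\<pi>_closed[OF int(1)]] by simp
      then show ?thesis using residue_eq_0_iff[OF p] int(1) by (simp add: residue_ring_simps)
    qed
    then show ?thesis using a(1) by blast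
  qed
qed


text \<open>
  If the degree modulo \<open>p\<close> is \<open>e < d\<close>, the functional for \<open>e\<close> takes the value \<open>1\<close> at the lifted
  relation, which is \<open>p\<close> times a \<open>p\<close>-integral polynomial modulo \<open>I\<close>. So \<open>p\<close> divides a denominator of
  this functional on the finitely many standard monomials.
\<close>
lemma finite_bad_primes: "finite {p. usable \<sigma> I f p \<and> deg_mod p \<noteq> d}"
proof -
  have fin: "finite {p. usable \<sigma> I f p \<and> deg_mod p = e}" if e: "e < d" for e
  proof -
    obtain L where L: "Vector_Spaces.linear smul (*) L" "\<And>a. a \<in> I0 \<Longrightarrow> L a = 0"
      "\<And>i. i < e \<Longrightarrow> L (F ^ i) = 0" "L (F ^ e) = 1" by (rule power_functional[OF e]) (rule that)
    interpret L: Vector_Spaces.linear smul "(*)" L by (rule L(1))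
    have "{p. usable \<sigma> I f p \<and> deg_mod p = e} \<subseteq> (\<Union>b\<in>Z.std. {p. p dvd denom (L (single b 1))})"
    proof (rule subsetI, rule ccontr)
      fix p assume "p \<in> {p. usable \<sigma> I f p \<and> deg_mod p = e}"
        and good: "p \<notin> (\<Union>b\<in>Z.std. {p. p dvd denom (L (single b 1))})"
      then have us: "usable \<sigma> I f p" and deg: "deg_mod p = e" by auto
      interpret B: integral_basis \<sigma> I0 p by (rule usable_integral_basis(1)[OF us])
      note p = B.p
      have p1: "p > 1" using p prime_gt_1_int by blast
      let ?h = "\<lambda>i. of_int (\<nu> p i) :: rat"
      obtain a where a: "a \<in> I0" "\<And>t. p_integral p (lookup (ev e ?h - a) t / of_int p)"
        using \<nu>_lift[OF us] deg by auto
      have "L (ev e ?h) = (\<Sum>i\<le>e. ?h i * L (F ^ i))" unfolding ev_def by (simp only: L.sum L.scale)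
      also have "\<dots> = (\<Sum>i\<in>{e}. ?h i * L (F ^ i))"
        by (rule sum.mono_neutral_right) (auto simp: L(3))
      finally have "L (ev e ?h) = 1" using L(4) \<nu>_monic[OF us] deg by simp
      then have "L (ev e ?h - a) = 1" using L.diff[of "ev e ?h" a] L(2)[OF a(1)] by simp
      then have Lb: "1 * L (smul (1 / of_int p) (ev e ?h - a)) = 1 / of_int p"
        unfolding L.scale by simp
      have "p_integral p (1 * L (smul (1 / of_int p) (ev e ?h - a)))"
      proof (rule Z.functional_integral[OF p B.GB_integral L(1,2)])
        show "p_integral p (1 * L (single b 1))" if "b \<in> Z.std" for b
          using good that by (simp add: p_integral_def)
        show "p_integral p (lookup (smul (1 / of_int p) (ev e ?h - a)) t)" for t
          using a(2)[of t] by simp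
      qed
      then have "p_integral p (1 / of_int p)" unfolding Lb .
      then have "residue p 1 = 0" using residue_eq_0_iff[OF p p_integral_1[OF p]] by simp
      then show False using residue_1[OF p1] by simp
    qed
    moreover have "finite {p. p dvd denom q}" for q
      using denom_pos[of q] by (intro finite_divisors_int) simp
    ultimately show ?thesis using Z.finite_std by (meson finite_UN finite_subset)
  qed
  have "{p. usable \<sigma> I f p \<and> deg_mod p \<noteq> d} \<subseteq> (\<Union>e<d. {p. usable \<sigma> I f p \<and> deg_mod p = e})"
    using deg_mod_le by (auto simp: le_less)
  then show ?thesis by (rule finite_subset) (use fin in simp)
qed

end

section \<open>The main loop\<close>

locale modular_run = modular_problem \<sigma> I f
  for \<sigma> :: "'v::finite multiset rel" and I :: "('v multiset \<Rightarrow> rat) set" and f :: "'v multiset \<Rightarrow> rat" +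
  fixes reconstruct :: reconstruction and ps :: "nat \<Rightarrow> int"
  assumes reconstruct: "fault_tolerant_reconstruction reconstruct"
    and us: "usable \<sigma> I f (ps k)" and inj: "inj ps"
begin

lemma ps_prime: "Factorial_Ring.prime (ps k)"
  using us by (simp add: usable_def)

lemma ps_gt_1: "ps k > 1"
  using ps_prime prime_gt_1_int by blast

lemma ps_coprime: "i \<noteq> j \<Longrightarrow> coprime (ps i) (ps j)"
  using primes_coprime[OF ps_prime ps_prime] inj by (auto dest: injD)

lemma ps_coprime_denom: "coprime (ps k) (denom (\<mu> i))"
  using \<mu>_integral[OF us] p_integral_coprime[OF ps_prime] by blast


text \<open>
  The state after \<open>k\<close> iterations. The degree \<open>e\<close> dominates the degrees for all primes seen so far, so it
  is \<open>d\<close> from the first prime with this degree on; from then on \<open>x\<close> consists of residues of \<open>\<mu>\<close>.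
  While \<open>e < d\<close>, nothing is claimed about the coefficients of \<open>x\<close> below the leading one.
\<close>
definition loop_inv :: "nat \<Rightarrow> (nat \<Rightarrow> int) \<Rightarrow> int \<Rightarrow> nat \<Rightarrow> bool"
  where "loop_inv k x m e \<longleftrightarrow> e \<le> d \<and> m > 1 \<and> squarefree m \<and>
    (\<forall>i. coprime m (denom (\<mu> i))) \<and> (\<forall>j>k. coprime m (ps j)) \<and>
    (\<forall>i. 0 \<le> x i \<and> x i < m) \<and> x e = 1 \<and> (\<forall>i>e. x i = 0) \<and>
    (e = d \<longrightarrow> (\<forall>i. x i = residue m (\<mu> i))) \<and> (\<forall>j\<le>k. deg_mod (ps j) \<le> e)"

lemma loop_inv_deg: "loop_inv k x m e \<Longrightarrow> deg (residue_ring m) x = e"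
  by (rule deg_residue_ring) (auto simp: loop_inv_def)

lemma loop_inv_prime:
  assumes "\<forall>j\<le>k. deg_mod (ps j) \<le> deg_mod (ps k)"
  shows "loop_inv k (\<nu> (ps k)) (ps k) (deg_mod (ps k))"
  unfolding loop_inv_def
proof (intro conjI allI impI)
  show "coprime (ps k) (ps j)" if "k < j" for j using that by (intro ps_coprime) simp
  show "0 \<le> \<nu> (ps k) i" "\<nu> (ps k) i < ps k" for i using \<nu>_range[OF us] by blast+
  show "\<nu> (ps k) i = 0" if "i > deg_mod (ps k)" for i by (rule \<nu>_above[OF us that])
  show "\<nu> (ps k) i = residue (ps k) (\<mu> i)" if "deg_mod (ps k) = d" for i by (rule \<nu>_eq_residue[OF us that])
  show "deg_mod (ps j) \<le> deg_mod (ps k)" if "j \<le> k" for j using assms that by blast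
qed (rule deg_mod_le[OF us] ps_gt_1 squarefree_prime[OF ps_prime] ps_coprime_denom \<nu>_monic[OF us])+

lemma loop_inv_crt:
  assumes "loop_inv k x m e" "deg_mod (ps (Suc k)) = e"
  shows "loop_inv (Suc k) (crt_poly m x (ps (Suc k)) (\<nu> (ps (Suc k)))) (ps (Suc k) * m) e"
proof -
  let ?p = "ps (Suc k)"
  note i = assms(1)[unfolded loop_inv_def]
  have m: "m > 1" "squarefree m" "\<And>i. coprime m (denom (\<mu> i))" "\<And>j. j > k \<Longrightarrow> coprime m (ps j)"
    "\<And>i. 0 \<le> x i \<and> x i < m" "x e = 1" "\<And>i. i > e \<Longrightarrow> x i = 0" "e = d \<Longrightarrow> x i = residue m (\<mu> i)"
    "\<And>j. j \<le> k \<Longrightarrow> deg_mod (ps j) \<le> e" "e \<le> d" for i using i by blast+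
  have cop: "coprime m ?p" using m(4) by simp
  have big: "?p * m > 1" using m(1) ps_gt_1[of "Suc k"] by (simp add: less_1_mult)
  have range: "crt_poly m x ?p (\<nu> ?p) i \<in> {0..<?p * m}" for i
    unfolding crt_poly_def by (rule crt_range[OF cop m(1) ps_gt_1])
  have lead: "crt_poly m x ?p (\<nu> ?p) e = 1"
    unfolding crt_poly_def
    by (rule crt_eqI[OF cop]) (use big m(6) \<nu>_monic[OF us, of "Suc k"] assms(2) in auto)
  have above: "crt_poly m x ?p (\<nu> ?p) i = 0" if "i > e" for i
    unfolding crt_poly_def
    by (rule crt_eqI[OF cop]) (use big m(7)[OF that] \<nu>_above[OF us, of "Suc k" i] assms(2) that in auto)
  have res: "crt_poly m x ?p (\<nu> ?p) i = residue (?p * m) (\<mu> i)" if "e = d" for i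
    unfolding crt_poly_def m(8)[OF that] \<nu>_eq_residue[OF us assms(2)[unfolded that]]
    by (rule crt_residue[OF cop m(1) ps_gt_1 m(3) ps_coprime_denom])
  have "squarefree (?p * m)"
    using cop m(2) squarefree_prime[OF ps_prime] by (simp add: squarefree_mult_coprime coprime_commute)
  moreover have "coprime (?p * m) (denom (\<mu> i))" for i using m(3) ps_coprime_denom by simp
  moreover have "coprime (?p * m) (ps j)" if "j > Suc k" for j using m(4) ps_coprime that by simp
  moreover have "deg_mod (ps j) \<le> e" if "j \<le> Suc k" for j
    using m(9)[of j] assms(2) that by (cases "j = Suc k") auto
  ultimately show ?thesis
    unfolding loop_inv_def using m(10) big range lead above res by (simp add: atLeastLessThan_iff)
qed

definition state_inv :: "nat \<Rightarrow> state \<Rightarrow> bool"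
  where "state_inv k s \<longleftrightarrow> (case s of Running x m \<Rightarrow> \<exists>e. loop_inv k x m e | Returned x \<Rightarrow> x = \<mu>)"


text \<open>
  The reconstruction is monic of degree \<open>e \<le> d\<close> because the class of \<open>1\<close> is reconstructed as \<open>1\<close>. A
  monic element of the kernel of degree at most \<open>d\<close> is \<open>\<mu>\<close>.
\<close>
lemma returned_correct:
  assumes "loop_inv k x m e" and I: "UnivPoly.eval QQ (mpoly_ring QQ) (mpoly_const QQ) f (reconstruct_poly reconstruct m x) \<in> I"
  shows "reconstruct_poly reconstruct m x = \<mu>"
proof -
  let ?c = "reconstruct_poly reconstruct m x"
  have i: "m > 1" "x e = 1" "e \<le> d" using assms(1) by (simp_all add: loop_inv_def)
  have above: "?c i = 0" if "i > e" for i using that by (simp add: reconstruct_poly_def loop_inv_deg[OF assms(1)])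
  have "fst (reconstruct m 1) = 1" using reconstruct i(1) by (simp add: fault_tolerant_reconstruction_def)
  then have lead: "?c e = 1" using i(2) by (simp add: reconstruct_poly_def loop_inv_deg[OF assms(1)])
  have "ev e ?c \<in> I0" using kernel_QQ(2)[OF above] I by simp
  moreover from \<mu>_minimal[OF this _ above] lead have "d \<le> e" by simp
  ultimately show ?thesis using i(3) lead above by (intro \<mu>_unique) auto
qed

lemma step_inv:
  assumes i: "loop_inv k x m e"
  shows "state_inv (Suc k) (main_loop_step reconstruct \<sigma> I f (ps (Suc k)) x m)"
proof -
  let ?p = "ps (Suc k)"
  have keep: "loop_inv (Suc k) x m e" if "deg_mod ?p \<le> e"
    using i that unfolding loop_inv_def by (auto simp: le_Suc_eq)
  have j: "deg_mod (ps j) \<le> e" if "j \<le> k" for j using i that by (simp add: loop_inv_def)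
  have new: "loop_inv (Suc k) (\<nu> ?p) ?p (deg_mod ?p)" if "e < deg_mod ?p"
    using that j by (intro loop_inv_prime) (force simp: le_Suc_eq)
  have crt: "loop_inv (Suc k) (crt_poly m x ?p (\<nu> ?p)) (?p * m) e" if "deg_mod ?p = e"
    by (rule loop_inv_crt[OF i that])
  note ret = returned_correct[OF crt]
  consider "deg_mod ?p < e" | "deg_mod ?p > e" | "deg_mod ?p = e" by linarith
  then show ?thesis
  proof cases
    case 1
    then have "main_loop_step reconstruct \<sigma> I f ?p x m = Running x m"
      by (simp add: main_loop_step_def loop_inv_deg[OF i])
    then show ?thesis using keep 1 by (auto simp: state_inv_def)
  next
    case 2
    then have "main_loop_step reconstruct \<sigma> I f ?p x m = Running (\<nu> ?p) ?p"
      by (simp add: main_loop_step_def loop_inv_deg[OF i])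
    then show ?thesis using new[OF 2] by (auto simp: state_inv_def)
  next
    case 3
    let ?x = "crt_poly m x ?p (\<nu> ?p)" and ?m = "?p * m"
    let ?A = "all_reliable reconstruct ?m ?x"
      and ?E = "UnivPoly.eval QQ (mpoly_ring QQ) (mpoly_const QQ) f (reconstruct_poly reconstruct ?m ?x) \<in> I"
    have eq: "main_loop_step reconstruct \<sigma> I f ?p x m =
        (if ?A then if ?E then Returned (reconstruct_poly reconstruct ?m ?x) else Running x m else Running ?x ?m)"
      using 3 by (simp add: main_loop_step_def Let_def loop_inv_deg[OF i])
    consider "main_loop_step reconstruct \<sigma> I f ?p x m = Running x m"
      | "main_loop_step reconstruct \<sigma> I f ?p x m = Running ?x ?m"
      | "main_loop_step reconstruct \<sigma> I f ?p x m = Returned (reconstruct_poly reconstruct ?m ?x)"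
?E
      using eq by (cases ?A; cases ?E) simp_all
    then show ?thesis
    proof cases
      case 1
      then show ?thesis using keep 3 by (auto simp: state_inv_def)
    next
      case 2
      then show ?thesis using crt[OF 3] by (auto simp: state_inv_def)
    next
      case C: 3
      then show ?thesis using ret[OF 3 C(2)] by (simp add: state_inv_def)
    qed
  qed
qed

lemma run_inv: "state_inv k (run reconstruct \<sigma> I f ps k)"
proof (induction k)
  case 0
  then show ?case using loop_inv_prime[of 0] by (auto simp: state_inv_def)
next
  case (Suc k)
  show ?case
  proof (cases "run reconstruct \<sigma> I f ps k")
    case (Running x m)
    then obtain e where e: "loop_inv k x m e" using Suc by (auto simp: state_inv_def)
    show ?thesis using step_inv[OF e] Running by simp
  next
    case (Returned x)
    then show ?thesis using Suc by (simp add: state_inv_def)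
  qed
qed

lemma reconstruction_bound:
  "\<exists>N. \<forall>m\<ge>N. squarefree m \<longrightarrow> (\<forall>i. coprime m (denom (\<mu> i))) \<longrightarrow>
    (\<forall>i\<le>d. reconstruct m (residue m (\<mu> i)) = (\<mu> i, True))"
proof -
  have "\<forall>q. \<exists>N. \<forall>m\<ge>N. squarefree m \<longrightarrow> coprime m (denom q) \<longrightarrow> reconstruct m (residue m q) = (q, True)"
    using reconstruct unfolding fault_tolerant_reconstruction_def by (rule conjunct2)
  from choice[OF this] obtain N where N: "\<forall>q. \<forall>m\<ge>N q. squarefree m \<longrightarrow> coprime m (denom q) \<longrightarrow>
      reconstruct m (residue m q) = (q, True)" ..
  let ?N = "Max ((\<lambda>i. N (\<mu> i)) ` {..d})"
  have "N (\<mu> i) \<le> ?N" if "i \<le> d" for i using that by simp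
  then show ?thesis by (intro exI[of _ ?N]) (meson N order_trans)
qed


text \<open>
  From some index \<open>j\<close> on all primes have degree \<open>d\<close> and reach the bound for the reconstruction. The
  iteration after \<open>j\<close> returns, whatever the modulus has become by then, since the new modulus
  is at least the new prime.
\<close>
lemma terminates: "\<exists>k. run reconstruct \<sigma> I f ps k = Returned \<mu>"
proof -
  obtain N where N: "\<forall>m\<ge>N. squarefree m \<longrightarrow> (\<forall>i. coprime m (denom (\<mu> i))) \<longrightarrow>
    (\<forall>i\<le>d. reconstruct m (residue m (\<mu> i)) = (\<mu> i, True))"
    using reconstruction_bound ..
  have "finite {k. deg_mod (ps k) \<noteq> d}"
    by (rule finite_subset[OF _ finite_vimageI[OF finite_bad_primes inj]]) (use us in auto)
  moreover have "finite {k. ps k < N}"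
  proof (rule finite_subset[OF _ finite_vimageI[of "{0..<N}", OF _ inj]])
    show "{k. ps k < N} \<subseteq> ps -` {0..<N}"
    proof
      fix k assume "k \<in> {k. ps k < N}"
      then show "k \<in> ps -` {0..<N}" using ps_gt_1[of k] by simp
    qed
  qed simp
  ultimately have fin: "finite ({k. deg_mod (ps k) \<noteq> d} \<union> {k. ps k < N})" by simp
  obtain j where j: "\<And>k. k \<ge> j \<Longrightarrow> deg_mod (ps k) = d \<and> ps k \<ge> N"
  proof -
    from fin obtain b where "\<And>k. k \<in> {k. deg_mod (ps k) \<noteq> d} \<union> {k. ps k < N} \<Longrightarrow> k < b"
      using finite_nat_set_iff_bounded by metis
    then show ?thesis by (intro that[of b]) (force simp: not_less)
  qed
  show ?thesis
  proof (cases "run reconstruct \<sigma> I f ps j")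
    case (Returned x)
    then show ?thesis using run_inv[of j] by (auto simp: state_inv_def)
  next
    case (Running x m)
    then obtain e where loop_inv: "loop_inv j x m e" using run_inv[of j] by (auto simp: state_inv_def)
    then have "e = d" using j[of j] by (auto simp: loop_inv_def)
    let ?p = "ps (Suc j)"
    have p: "deg_mod ?p = d" "?p \<ge> N" using j[of "Suc j"] by auto
    let ?x = "crt_poly m x ?p (\<nu> ?p)"
    have loop_inv': "loop_inv (Suc j) ?x (?p * m) d" using loop_inv_crt[OF loop_inv] p(1) \<open>e = d\<close> by simp
    have m: "m > 1" using loop_inv by (simp add: loop_inv_def)
    have "?p * 1 \<le> ?p * m" using m ps_gt_1[of "Suc j"] by (intro mult_left_mono) auto
    then have large: "?p * m \<ge> N" using p(2) by simp
    have rec: "reconstruct (?p * m) (?x i) = (\<mu> i, True)" if "i \<le> d" for i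
    proof -
      have "squarefree (?p * m)" "\<forall>i. coprime (?p * m) (denom (\<mu> i))" "?x i = residue (?p * m) (\<mu> i)"
        using loop_inv' unfolding loop_inv_def by blast+
      then show ?thesis using N large that by simp
    qed
    have "reconstruct_poly reconstruct (?p * m) ?x = \<mu>"
      unfolding reconstruct_poly_def loop_inv_deg[OF loop_inv'] using rec \<mu>_above by (auto simp: fun_eq_iff not_le)
    moreover have "all_reliable reconstruct (?p * m) ?x"
      unfolding all_reliable_def loop_inv_deg[OF loop_inv'] using rec by simp
    moreover have "UnivPoly.eval QQ (mpoly_ring QQ) (mpoly_const QQ) f \<mu> \<in> I"
      using kernel_QQ(2)[OF \<mu>_above] ev_\<mu> by simp
    ultimately have "main_loop_step reconstruct \<sigma> I f ?p x m = Returned \<mu>"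
      unfolding main_loop_step_def Let_def loop_inv_deg[OF loop_inv] using p(1) \<open>e = d\<close> by simp
    then have "run reconstruct \<sigma> I f ps (Suc j) = Returned \<mu>" using Running by simp
    then show ?thesis ..
  qed
qed

end

theorem mainTheorem4:
  fixes \<sigma> :: "'v::finite multiset rel"
    and I :: "('v multiset \<Rightarrow> rat) set"
    and f :: "'v multiset \<Rightarrow> rat"
    and reconstruct :: reconstruction
    and ps :: "nat \<Rightarrow> int"
  assumes "term_ordering \<sigma>"
    and "zero_dimensional QQ I"
    and "f \<in> carrier (mpoly_ring QQ)"
    and "fault_tolerant_reconstruction reconstruct"
    and "\<And>k. usable \<sigma> I f (ps k)"
    and "inj ps"
  shows "\<exists>k. run reconstruct \<sigma> I f ps k = Returned (min_poly QQ f I)"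
proof -
  interpret modular_run \<sigma> I f reconstruct ps
    by unfold_locales (rule assms)+
  show ?thesis using terminates by (simp add: \<mu>_def)
qed

end
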